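(* Let $(X,\perp)$ be a homogeneously transitive orthoset of rank $\geq 4$. Then either $(X,\perp)$ is Boolean, or else there is a Hermitian space $H$ (over some $\star$-sfield), possessing a unit vector in each one-dimensional subspace, such that $(X,\perp)$ is isomorphic to $(P(H),\perp)$.
   Context: An orthoset is a non-empty set $X$ with a symmetric, irreflexive binary relation $\perp$. An automorphism of $(X,\perp)$ is a bijection $\varphi$ of $X$ with $p \perp q \Leftrightarrow \varphi(p)\perp\varphi(q)$; the group of automorphisms is denoted $\mathbf O(X)$. The rank of $X$ is the smallest cardinal $\lambda$ such that every subset of mutually orthogonal elements has cardinality $\leq \lambda$. $(X,\perp)$ is Boolean if $\perp$ is the relation $\neq$. For distinct $e,f\in X$, let $G_{ef} = \{\varphi\in\mathbf O(X) : \varphi(x)=x \text{ for all } x \in X \text{ with } x \perp e \text{ and } x\perp f\}$. $(X,\perp)$ is homogeneously transitive if for any distinct $e,f\in X$: (HT1) there is $\varphi\in G_{ef}$ with $\varphi(e)=f$; (HT2) for any further distinct elements $e', f' \in X$ there is $\tau\in\mathbf O(X)$ with $\tau(e)=e'$ and $G_{ef} = \tau^{-1}G_{e'f'}\tau$. A $\star$-sfield is a division ring $K$ equipped with an involutorial antiautomorphism $^\star$. A Hermitian space over $K$ is a left linear space $H$ over $K$ (possibly infinite-dimensional) with a map $(\cdot,\cdot)\colon H\times H \to K$ that is linear in the first argument, satisfies $(w,\alpha u+\beta v) = (w,u)\alpha^\star + (w,v)\beta^\star$ and $(u,v) = (v,u)^\star$, and is anisotropic: $(u,u)=0$ implies $u=0$.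 A unit vector is a vector $u$ with $(u,u)=1$. $P(H)$ is the set of one-dimensional subspaces $[u]$, $u \in H\setminus\{0\}$, and $[u]\perp[v]$ if $(u,v)=0$. An isomorphism of orthosets is a bijection preserving and reflecting $\perp$. *)

theory Defs
  imports "HOL-Algebra.Module"
begin

unbundle cardinal_syntax

section \<open>Orthosets\<close>

text \<open>
  The underlying set of an orthoset is the universe of an arbitrary type \<open>'a\<close>; it is non-empty
  because every type is.
\<close>

definition orthoset :: "('a \<Rightarrow> 'a \<Rightarrow> bool) \<Rightarrow> bool" where
  "orthoset orth \<longleftrightarrow> symp orth \<and> irreflp orth"

definition orthoset_iso_on ::
    "'a set \<Rightarrow> ('a \<Rightarrow> 'a \<Rightarrow> bool) \<Rightarrow> 'b set \<Rightarrow> ('b \<Rightarrow> 'b \<Rightarrow> bool) \<Rightarrow> ('a \<Rightarrow> 'b) \<Rightarrow> bool" where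
  "orthoset_iso_on X orth Y orth' \<phi> \<longleftrightarrow>
     bij_betw \<phi> X Y \<and> (\<forall>p\<in>X. \<forall>q\<in>X. orth p q \<longleftrightarrow> orth' (\<phi> p) (\<phi> q))"

definition orthoset_aut :: "('a \<Rightarrow> 'a \<Rightarrow> bool) \<Rightarrow> ('a \<Rightarrow> 'a) set" where
  "orthoset_aut orth = {\<phi>. orthoset_iso_on UNIV orth UNIV orth \<phi>}"

definition mutually_orthogonal :: "('a \<Rightarrow> 'a \<Rightarrow> bool) \<Rightarrow> 'a set \<Rightarrow> bool" where
  "mutually_orthogonal orth D \<longleftrightarrow> (\<forall>x\<in>D. \<forall>y\<in>D. x \<noteq> y \<longrightarrow> orth x y)"

definition orthogonal_bounds :: "('a \<Rightarrow> 'a \<Rightarrow> bool) \<Rightarrow> 'a rel set" where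
  "orthogonal_bounds orth =
     {r. Card_order r \<and> (\<forall>D. mutually_orthogonal orth D \<longrightarrow> |D| \<le>o r)}"

text \<open>
  Cardinals are represented, up to \<open>=o\<close>, by cardinal orders. Cardinal orders on (subsets of) the
  type \<open>'a\<close> suffice for the minimum, because \<open>|UNIV :: 'a set|\<close> is itself an upper bound.
\<close>

definition orthoset_rank :: "('a \<Rightarrow> 'a \<Rightarrow> bool) \<Rightarrow> 'a rel" where
  "orthoset_rank orth =
     (SOME r. r \<in> orthogonal_bounds orth \<and> (\<forall>r'\<in>orthogonal_bounds orth. r \<le>o r'))"

lemma orthoset_rank_least:
  "orthoset_rank orth \<in> orthogonal_bounds orth \<and>
   (\<forall>r'\<in>orthogonal_bounds orth. orthoset_rank orth \<le>o r')"
proof -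
  have "|UNIV :: 'a set| \<in> orthogonal_bounds orth"
    unfolding orthogonal_bounds_def using card_of_Card_order card_of_mono1[OF subset_UNIV] by blast
  then have "\<exists>r\<in>orthogonal_bounds orth. \<forall>r'\<in>orthogonal_bounds orth. r \<le>o r'"
    by (intro exists_minim_Card_order) (auto simp only: orthogonal_bounds_def)
  then show ?thesis
    unfolding orthoset_rank_def Bex_def by (rule someI_ex)
qed

definition Boolean_orthoset :: "('a \<Rightarrow> 'a \<Rightarrow> bool) \<Rightarrow> bool" where
  "Boolean_orthoset orth \<longleftrightarrow> (\<forall>x y. orth x y \<longleftrightarrow> x \<noteq> y)"

definition G_fix :: "('a \<Rightarrow> 'a \<Rightarrow> bool) \<Rightarrow> 'a \<Rightarrow> 'a \<Rightarrow> ('a \<Rightarrow> 'a) set" where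
  "G_fix orth e f = {\<phi> \<in> orthoset_aut orth. \<forall>x. orth x e \<and> orth x f \<longrightarrow> \<phi> x = x}"

definition homogeneously_transitive :: "('a \<Rightarrow> 'a \<Rightarrow> bool) \<Rightarrow> bool" where
  "homogeneously_transitive orth \<longleftrightarrow>
     (\<forall>e f. e \<noteq> f \<longrightarrow>
        (\<exists>\<phi>\<in>G_fix orth e f. \<phi> e = f) \<and>
        (\<forall>e' f'. e' \<noteq> f' \<longrightarrow>
           (\<exists>\<tau>\<in>orthoset_aut orth. \<tau> e = e' \<and>
              G_fix orth e f = (\<lambda>\<psi>. inv_into UNIV \<tau> \<circ> \<psi> \<circ> \<tau>) ` G_fix orth e' f')))"

section \<open>Hermitian spaces\<close>

text \<open>
  The library's fields and modules require commutative scalars, hence the following locales.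
\<close>

locale sfield = ring K for K (structure) +
  assumes one_not_zero: "\<one> \<noteq> \<zero>"
    and nonzero_Units: "Units K = carrier K - {\<zero>}"

locale star_sfield = sfield K for K (structure) +
  fixes star :: "'k \<Rightarrow> 'k"
  assumes star_closed: "a \<in> carrier K \<Longrightarrow> star a \<in> carrier K"
    and star_add: "\<lbrakk>a \<in> carrier K; b \<in> carrier K\<rbrakk> \<Longrightarrow> star (a \<oplus> b) = star a \<oplus> star b"
    and star_mult: "\<lbrakk>a \<in> carrier K; b \<in> carrier K\<rbrakk> \<Longrightarrow> star (a \<otimes> b) = star b \<otimes> star a"
    and star_star: "a \<in> carrier K \<Longrightarrow> star (star a) = a"

text \<open>As in the library, the multiplicative part of the record \<open>H\<close> is ignored.\<close>

locale left_linear_space = K?: sfield K + H?: abelian_group H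
  for K (structure) and H :: "('k, 'h, 'm) module_scheme" (structure) +
  assumes smult_closed:
      "\<lbrakk>a \<in> carrier K; u \<in> carrier H\<rbrakk> \<Longrightarrow> a \<odot>\<^bsub>H\<^esub> u \<in> carrier H"
    and smult_l_distr:
      "\<lbrakk>a \<in> carrier K; b \<in> carrier K; u \<in> carrier H\<rbrakk> \<Longrightarrow>
         (a \<oplus>\<^bsub>K\<^esub> b) \<odot>\<^bsub>H\<^esub> u = a \<odot>\<^bsub>H\<^esub> u \<oplus>\<^bsub>H\<^esub> b \<odot>\<^bsub>H\<^esub> u"
    and smult_r_distr:
      "\<lbrakk>a \<in> carrier K; u \<in> carrier H; v \<in> carrier H\<rbrakk> \<Longrightarrow>
         a \<odot>\<^bsub>H\<^esub> (u \<oplus>\<^bsub>H\<^esub> v) = a \<odot>\<^bsub>H\<^esub> u \<oplus>\<^bsub>H\<^esub> a \<odot>\<^bsub>H\<^esub> v"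
    and smult_assoc1:
      "\<lbrakk>a \<in> carrier K; b \<in> carrier K; u \<in> carrier H\<rbrakk> \<Longrightarrow>
         (a \<otimes>\<^bsub>K\<^esub> b) \<odot>\<^bsub>H\<^esub> u = a \<odot>\<^bsub>H\<^esub> (b \<odot>\<^bsub>H\<^esub> u)"
    and smult_one:
      "u \<in> carrier H \<Longrightarrow> \<one>\<^bsub>K\<^esub> \<odot>\<^bsub>H\<^esub> u = u"

locale hermitian_space = star_sfield K star + left_linear_space K H
  for K (structure) and star and H (structure) +
  fixes form :: "'b \<Rightarrow> 'b \<Rightarrow> 'a"
  assumes form_closed:
      "\<lbrakk>u \<in> carrier H; v \<in> carrier H\<rbrakk> \<Longrightarrow> form u v \<in> carrier K"
    and form_linear_left:
      "\<lbrakk>a \<in> carrier K; b \<in> carrier K; u \<in> carrier H; v \<in> carrier H; w \<in> carrier H\<rbrakk> \<Longrightarrow>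
         form (a \<odot>\<^bsub>H\<^esub> u \<oplus>\<^bsub>H\<^esub> b \<odot>\<^bsub>H\<^esub> v) w
           = a \<otimes>\<^bsub>K\<^esub> form u w \<oplus>\<^bsub>K\<^esub> b \<otimes>\<^bsub>K\<^esub> form v w"
    and form_semilinear_right:
      "\<lbrakk>a \<in> carrier K; b \<in> carrier K; u \<in> carrier H; v \<in> carrier H; w \<in> carrier H\<rbrakk> \<Longrightarrow>
         form w (a \<odot>\<^bsub>H\<^esub> u \<oplus>\<^bsub>H\<^esub> b \<odot>\<^bsub>H\<^esub> v)
           = form w u \<otimes>\<^bsub>K\<^esub> star a \<oplus>\<^bsub>K\<^esub> form w v \<otimes>\<^bsub>K\<^esub> star b"
    and form_hermitian:
      "\<lbrakk>u \<in> carrier H; v \<in> carrier H\<rbrakk> \<Longrightarrow> form u v = star (form v u)"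
    and form_anisotropic:
      "\<lbrakk>u \<in> carrier H; form u u = \<zero>\<^bsub>K\<^esub>\<rbrakk> \<Longrightarrow> u = \<zero>\<^bsub>H\<^esub>"

definition ray :: "('k, 'c) ring_scheme \<Rightarrow> ('k, 'h, 'm) module_scheme \<Rightarrow> 'h \<Rightarrow> 'h set" where
  "ray K H u = {a \<odot>\<^bsub>H\<^esub> u | a. a \<in> carrier K}"

definition proj_points ::
    "('k, 'c) ring_scheme \<Rightarrow> ('k, 'h, 'm) module_scheme \<Rightarrow> 'h set set" where
  "proj_points K H = {ray K H u | u. u \<in> carrier H \<and> u \<noteq> \<zero>\<^bsub>H\<^esub>}"

definition proj_orth ::
    "('k, 'c) ring_scheme \<Rightarrow> ('k, 'h, 'm) module_scheme \<Rightarrow> ('h \<Rightarrow> 'h \<Rightarrow> 'k) \<Rightarrow>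
     'h set \<Rightarrow> 'h set \<Rightarrow> bool" where
  "proj_orth K H form P Q \<longleftrightarrow>
     (\<exists>u v. u \<in> carrier H \<and> u \<noteq> \<zero>\<^bsub>H\<^esub> \<and> v \<in> carrier H \<and> v \<noteq> \<zero>\<^bsub>H\<^esub> \<and>
        P = ray K H u \<and> Q = ray K H v \<and> form u v = \<zero>\<^bsub>K\<^esub>)"

definition unit_vector_in_each_line ::
    "('k, 'c) ring_scheme \<Rightarrow> ('k, 'h, 'm) module_scheme \<Rightarrow> ('h \<Rightarrow> 'h \<Rightarrow> 'k) \<Rightarrow> bool" where
  "unit_vector_in_each_line K H form \<longleftrightarrow>
     (\<forall>P\<in>proj_points K H. \<exists>u\<in>P. form u u = \<one>\<^bsub>K\<^esub>)"

text \<open>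
  HOL has no quantifier over types, so the types carrying the witnesses must be named. Taking
  scalars from \<open>'a\<close> and vectors from \<open>'a \<times> 'a\<close> loses nothing: suppose \<open>P(H)\<close> is in bijection with
  the universe of \<open>'a\<close> and \<open>H\<close> has independent vectors \<open>u\<close>, \<open>v\<close> (as is the case for rank at least
  2). Then \<open>\<alpha> \<mapsto> [u + \<alpha>v]\<close> embeds \<open>K\<close> into \<open>P(H)\<close>, and writing a non-zero vector as a non-zero
  multiple of a chosen representative of its ray embeds \<open>H\<close> into \<open>P(H) \<times> K\<close>. So every such
  Hermitian space is isomorphic to one with carriers in these types.
\<close>

end

theory Submission
  imports Defs
begin

text \<open>
  By (HT1), \<open>{e, f}\<^sup>\<bottom>\<close> consists of the points of \<open>e\<^sup>\<bottom>\<close> fixed by \<open>G\<^bsub>ef\<^esub>\<close>, so (HT2) moves any pair of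
  distinct points to any other, as far as complements are concerned. In the non-Boolean case every line
  \<open>{e, f}\<^sup>\<bottom>\<^sup>\<bottom>\<close> therefore contains both a point orthogonal to \<open>e\<close> and a further point that is not.
  A Gram--Schmidt argument turns this into the exchange property and into the fact that
  every line meets every hyperplane \<open>x\<^sup>\<bottom>\<close>: the orthoset is a projective space of dimension at least
  three with a polarity.

  Fix a point \<open>b0\<close> and take \<open>b0\<^sup>\<bottom>\<close> as hyperplane at infinity. As in Artin's \<^emph>\<open>Geometric Algebra\<close>,
  Desargues' theorem provides all possible dilatations of the affine part \<open>V\<close>; translations make \<open>V\<close>
  an abelian group, and the additive maps preserving all lines through \<open>b0\<close> form a division ring \<open>K\<close>.
  The point set becomes \<open>P(V \<oplus> K)\<close>. The polars of the affine points are
  graphs of linear functionals on \<open>V\<close>; these depend additively on the point, which gives the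
  involution and the Hermitian form (Birkhoff--von Neumann), with \<open>b0\<close> spanned by a unit vector.
  Finally, an automorphism as in (HT1) fixes two orthogonal points of \<open>{b0, f}\<^sup>\<bottom>\<close>, and this rigidity forces
  it to carry the unit vector of \<open>b0\<close> to a unit vector of \<open>f\<close>.
\<close>

section \<open>Linear orthosets\<close>

text \<open>The automorphism group is used only twice: to derive the axioms of
  \<open>linear_orthoset\<close>, and at the very end to compare unit vectors. Everything in between
  follows from these axioms. The rank may be infinite, so there is neither a basis nor a dimension
  count to rely on. Closures of at most three points carry the incidence geometry, and the form is
  read off from the polarity point by point instead of from a Gram matrix. The bound 4 is what makes
  Desargues' theorem available: two orthogonal points in the complement of a pair provide a
  direction outside any given line at infinity, hence room to lift a plane configuration into a
  third dimension. The failure of Booleanity provides a third point on each line, so that an affine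
  line does not shrink to a single point when its point at infinity is removed.\<close>

locale linear_orthoset =
  fixes orth :: "'a \<Rightarrow> 'a \<Rightarrow> bool"  (infix "\<perp>" 50)
  assumes orth_sym: "x \<perp> y \<Longrightarrow> y \<perp> x"
    and orth_irrefl: "\<not> x \<perp> x"
    and ex_orthogonal: "e \<noteq> f \<Longrightarrow> \<exists>g. g \<perp> e \<and> (\<forall>z. z \<perp> e \<and> z \<perp> f \<longleftrightarrow> z \<perp> e \<and> z \<perp> g)"
    and ex_nonorthogonal:
      "e \<noteq> f \<Longrightarrow> \<exists>g. g \<noteq> e \<and> \<not> g \<perp> e \<and> (\<forall>z. z \<perp> e \<and> z \<perp> f \<longleftrightarrow> z \<perp> e \<and> z \<perp> g)"
    and ex_orthogonal_pair: "e \<noteq> f \<Longrightarrow> \<exists>g h. g \<perp> e \<and> g \<perp> f \<and> h \<perp> e \<and> h \<perp> f \<and> g \<perp> h"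
    and ex_distinct: "\<exists>f. f \<noteq> (e::'a)"
begin

section \<open>Biorthogonal closure, Gram-Schmidt orthogonalization and exchange\<close>

definition perp :: "'a set \<Rightarrow> 'a set" where
  "perp S = {x. \<forall>s\<in>S. x \<perp> s}"

definition cl :: "'a set \<Rightarrow> 'a set" where
  "cl S = perp (perp S)"

lemma perp_insert: "perp (insert x S) = {z. z \<perp> x} \<inter> perp S"
  by (auto simp: perp_def)

lemma perp_empty: "perp {} = UNIV"
  by (auto simp: perp_def)

lemma in_clI: "(\<And>z. z \<in> perp S \<Longrightarrow> z \<perp> x) \<Longrightarrow> x \<in> cl S"
  unfolding cl_def perp_def[of "perp S"] using orth_sym by blast

lemma in_clD: "x \<in> cl S \<Longrightarrow> z \<in> perp S \<Longrightarrow> z \<perp> x"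
  unfolding cl_def perp_def[of "perp S"] using orth_sym by blast

lemma subset_cl: "S \<subseteq> cl S"
  using in_clI unfolding perp_def by blast

lemma cl_base [simp]: "x \<in> S \<Longrightarrow> x \<in> cl S"
  using subset_cl by blast

lemma perp_cl: "perp (cl S) = perp S"
proof
  show "perp (cl S) \<subseteq> perp S"
    using subset_cl unfolding perp_def by blast
  show "perp S \<subseteq> perp (cl S)"
    using in_clD unfolding perp_def[of "cl S"] by blast
qed

lemma cl_least: "S \<subseteq> cl T \<Longrightarrow> cl S \<subseteq> cl T"
proof -
  assume "S \<subseteq> cl T"
  then have "perp T \<subseteq> perp S"
    unfolding perp_cl[of T, symmetric] unfolding perp_def by blast
  then show ?thesis
    using in_clI in_clD by (metis subset_eq)
qed

lemma cl_mono: "S \<subseteq> T \<Longrightarrow> cl S \<subseteq> cl T"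
  using cl_least subset_cl by blast

lemma cl_eq_if_perp_eq: "perp S = perp T \<Longrightarrow> cl S = cl T"
  by (simp add: cl_def)

lemma cl_insert_absorb: "x \<in> cl S \<Longrightarrow> cl (insert x S) = cl S"
  using cl_least[of "insert x S" S] cl_mono[of S "insert x S"] subset_cl[of S] by blast

lemma perp_pair_orthogonal: "e \<noteq> f \<Longrightarrow> \<exists>g. g \<perp> e \<and> perp {e, f} = perp {e, g}"
  using ex_orthogonal[of e f] by (auto simp: perp_def)

text \<open>This property stands in for a dimension theory: \<open>exchange\<close> and
  \<open>orthomodular\<close> hold for every such \<open>S\<close>, and it suffices to know it for
  sets of at most two points.\<close>

definition gram_schmidt :: "'a set \<Rightarrow> bool" where
  "gram_schmidt S \<longleftrightarrow> (\<forall>e. e \<notin> cl S \<longrightarrow> (\<exists>f\<in>perp S. perp (insert e S) = perp (insert f S)))"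

lemma gram_schmidt_empty: "gram_schmidt {}"
  by (auto simp: gram_schmidt_def perp_empty)

lemma gram_schmidt_cong: "perp S = perp T \<Longrightarrow> gram_schmidt S \<Longrightarrow> gram_schmidt T"
  by (simp add: gram_schmidt_def perp_insert cl_def)

text \<open>The point \<open>e\<close> is made orthogonal to \<open>S\<close> first, giving
  \<open>f\<close>, and then \<open>f\<close> to \<open>s\<close>, giving \<open>g\<close>. The
  second step does not spoil the first: all of \<open>S\<close> is orthogonal to \<open>s\<close>
  and \<open>f\<close>, hence to \<open>g\<close>.\<close>

lemma gram_schmidt_insert:
  assumes S: "gram_schmidt S" and s: "s \<in> perp S"
  shows "gram_schmidt (insert s S)"
  unfolding gram_schmidt_def
proof (intro allI impI)
  fix e assume e: "e \<notin> cl (insert s S)"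
  then have "e \<notin> cl S" using cl_mono[of S "insert s S"] by blast
  then obtain f where f: "f \<in> perp S" "perp (insert e S) = perp (insert f S)"
    using S unfolding gram_schmidt_def by blast
  have "f \<noteq> s"
    using e cl_eq_if_perp_eq[OF f(2)] subset_cl[of "insert e S"] by auto
  then obtain g where g: "g \<perp> s" "perp {s, f} = perp {s, g}"
    using perp_pair_orthogonal by metis
  have "g \<perp> t" if "t \<in> S" for t
  proof -
    have "t \<in> perp {s, f}" using that s f(1) orth_sym unfolding perp_def by blast
    then show ?thesis using g(2) orth_sym unfolding perp_def by blast
  qed
  then have "g \<in> perp (insert s S)" using g(1) by (auto simp: perp_def)
  moreover have "perp (insert e (insert s S)) = perp (insert g (insert s S))"
  proof -
    have "perp (insert e (insert s S)) = {z. z \<perp> s} \<inter> perp (insert e S)"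
      by (auto simp: perp_insert)
    also have "\<dots> = perp {s, f} \<inter> perp S" unfolding f(2) by (auto simp: perp_insert perp_empty)
    also have "\<dots> = perp (insert g (insert s S))"
      unfolding g(2) by (auto simp: perp_insert perp_empty)
    finally show ?thesis .
  qed
  ultimately show "\<exists>f\<in>perp (insert s S). perp (insert e (insert s S)) = perp (insert f (insert s S))"
    by blast
qed

text \<open>Only orthogonal points can be inserted, so \<open>b\<close> is first replaced by a point
  \<open>g\<close> orthogonal to \<open>a\<close>; this is harmless because the property depends on
  the complement alone.\<close>

lemma gram_schmidt_pair: "gram_schmidt {a, b}"
proof (cases "a = b")
  case True
  then show ?thesis using gram_schmidt_insert[OF gram_schmidt_empty, of a] by (simp add: perp_empty)
next
  case False
  then obtain g where g: "g \<perp> a" "perp {a, b} = perp {a, g}"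
    using perp_pair_orthogonal by blast
  have "gram_schmidt {a}"
    using gram_schmidt_insert[OF gram_schmidt_empty, of a] by (simp add: perp_empty)
  then have "gram_schmidt {g, a}"
    using gram_schmidt_insert g(1) by (simp add: perp_def)
  moreover have "perp {g, a} = perp {a, b}" using g(2) by (auto simp: perp_insert)
  ultimately show ?thesis using gram_schmidt_cong by blast
qed

text \<open>If \<open>x\<close> and \<open>y\<close> differ, making \<open>x\<close> orthogonal to
  \<open>y\<close> gives a point \<open>h\<close> orthogonal to \<open>y\<close> and
  \<open>S\<close>, hence to \<open>x\<close> by the closure assumption. Then \<open>h\<close> lies
  in the complement of \<open>{y, x}\<close>, which is that of \<open>{y, h}\<close>, and is
  orthogonal to itself.\<close>

lemma orthogonal_generator_unique:
  assumes "x \<in> perp S" "y \<in> perp S" "x \<in> cl (insert y S)"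
  shows "x = y"
proof (rule ccontr)
  assume "x \<noteq> y"
  then obtain h where h: "h \<perp> y" "perp {y, x} = perp {y, h}"
    using perp_pair_orthogonal by metis
  have "h \<perp> t" if "t \<in> S" for t
  proof -
    have "t \<in> perp {y, x}" using that assms orth_sym unfolding perp_def by blast
    then show ?thesis using h(2) orth_sym unfolding perp_def by blast
  qed
  then have "h \<in> perp (insert y S)" using h(1) by (auto simp: perp_def)
  then have "h \<perp> x" using assms(3) in_clD by blast
  then have "h \<in> perp {y, h}" using h unfolding perp_def by blast
  then show False using orth_irrefl by (auto simp: perp_def)
qed

text \<open>Modulo \<open>S\<close>, both points may be replaced by representatives orthogonal to
  \<open>S\<close>, and there uniqueness of the orthogonal generator makes the two coincide.\<close>

lemma exchange:
  assumes S: "gram_schmidt S" and x: "x \<in> cl (insert y S)" "x \<notin> cl S"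
  shows "y \<in> cl (insert x S)"
proof -
  have "y \<notin> cl S" using x cl_insert_absorb by blast
  then obtain y' where y': "y' \<in> perp S" "perp (insert y S) = perp (insert y' S)"
    using S unfolding gram_schmidt_def by blast
  obtain x' where x': "x' \<in> perp S" "perp (insert x S) = perp (insert x' S)"
    using S x(2) unfolding gram_schmidt_def by blast
  have "x' \<in> cl (insert x S)"
    using cl_eq_if_perp_eq[OF x'(2)] subset_cl by auto
  also have "\<dots> \<subseteq> cl (insert y S)"
    using x(1) cl_least subset_cl by (metis insert_subset)
  also have "\<dots> = cl (insert y' S)"
    using cl_eq_if_perp_eq[OF y'(2)] .
  finally have "x' = y'" using orthogonal_generator_unique x'(1) y'(1) by blast
  then have "cl (insert x S) = cl (insert y S)"
    using x'(2) y'(2) cl_eq_if_perp_eq by metis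
  then show ?thesis using subset_cl by blast
qed

text \<open>Otherwise the component \<open>y'\<close> of \<open>y\<close> orthogonal to
  \<open>S\<close> is also orthogonal to \<open>n\<close>, hence to all of
  \<open>cl (insert n S)\<close>, where it lies itself.\<close>

lemma orthomodular:
  assumes S: "gram_schmidt S" and n: "n \<in> perp S" and y: "y \<in> cl (insert n S)" "y \<perp> n"
  shows "y \<in> cl S"
proof (rule ccontr)
  assume "y \<notin> cl S"
  then obtain y' where y': "y' \<in> perp S" "perp (insert y S) = perp (insert y' S)"
    using S unfolding gram_schmidt_def by blast
  have cl_eq: "cl (insert y S) = cl (insert y' S)" using y'(2) cl_eq_if_perp_eq by blast
  have "n \<in> perp (insert y S)" using n y(2) orth_sym by (auto simp: perp_def)
  moreover have "y' \<in> cl (insert y S)" using cl_eq subset_cl by blast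
  ultimately have "n \<perp> y'" using in_clD by blast
  then have "y' \<in> perp (insert n S)" using y'(1) orth_sym by (auto simp: perp_def)
  moreover have "y' \<in> cl (insert n S)"
  proof -
    have "insert y S \<subseteq> cl (insert n S)" using y(1) subset_cl[of "insert n S"] by simp
    then show ?thesis using \<open>y' \<in> cl (insert y S)\<close> cl_least by blast
  qed
  ultimately have "y' \<perp> y'" using in_clD by blast
  then show False using orth_irrefl by blast
qed

section \<open>Lines, planes and hyperplanes\<close>

lemma cl_singleton: "cl {e} = {e}"
proof -
  have "f = e" if "f \<in> cl {e}" for f
    using that orthogonal_generator_unique[of f "{}" e] by (simp add: perp_empty)
  then show ?thesis using subset_cl[of "{e}"] by blast
qed

lemma cl_pair_exchange: "x \<in> cl {a, y} \<Longrightarrow> x \<noteq> a \<Longrightarrow> y \<in> cl {a, x}"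
  using exchange[of "{a}" x y] gram_schmidt_pair[of a a] by (simp add: insert_commute cl_singleton)

lemma cl_pair_eq:
  assumes "x \<in> cl {a, b}" "y \<in> cl {a, b}" "x \<noteq> y"
  shows "cl {x, y} = cl {a, b}"
proof
  show "cl {x, y} \<subseteq> cl {a, b}" using assms by (intro cl_least) simp
  have ab: "cl {x, y} = cl {a, b}"
    if "x \<in> cl {a, b}" "y \<in> cl {a, b}" "x \<noteq> y" "x \<noteq> a" for a b x y
  proof -
    have "b \<in> cl {a, x}" using that cl_pair_exchange by blast
    then have 1: "cl {a, b} = cl {a, x}"
      using that subset_cl by (intro antisym cl_least) auto
    then have "a \<in> cl {x, y}" using that cl_pair_exchange[of y x a] by (simp add: insert_commute)
    then have "cl {a, x} \<subseteq> cl {x, y}" using subset_cl by (intro cl_least) auto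
    moreover have "cl {x, y} \<subseteq> cl {a, b}" using that by (intro cl_least) simp
    ultimately show ?thesis using 1 by simp
  qed
  show "cl {a, b} \<subseteq> cl {x, y}"
  proof (cases "x = a")
    case True
    then have "cl {y, x} = cl {a, b}" using ab[of y a b x] assms by blast
    then show ?thesis by (simp add: insert_commute)
  next
    case False
    then show ?thesis using ab assms by blast
  qed
qed

text \<open>For \<open>x\<close> off the line, let \<open>x'\<close> be its component orthogonal to
  the line and \<open>y\<close> its projection onto the line. A point of the line orthogonal to
  \<open>y\<close> is orthogonal to \<open>x'\<close> as well, hence to \<open>x\<close>. This
  reduces the claim to points on the line.\<close>

lemma line_meets_hyperplane:
  assumes "p \<noteq> q"
  shows "\<exists>r\<in>cl {p, q}. r \<perp> x"
proof -
  have in_line: "\<exists>r\<in>cl {p, q}. r \<perp> y" if y: "y \<in> cl {p, q}" for y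
  proof -
    obtain t where t: "t \<in> {p, q}" "t \<noteq> y" using assms by blast
    then obtain r where r: "r \<perp> y" "perp {y, t} = perp {y, r}"
      using perp_pair_orthogonal by metis
    then have "r \<in> cl {y, t}" using cl_eq_if_perp_eq[OF r(2)] subset_cl by blast
    moreover have "cl {y, t} \<subseteq> cl {p, q}" using t y subset_cl by (intro cl_least) blast
    ultimately show ?thesis using r(1) by blast
  qed
  show ?thesis
  proof (cases "x \<in> cl {p, q}")
    case True
    then show ?thesis using in_line by blast
  next
    case False
    then obtain x' where x': "x' \<in> perp {p, q}" "perp {x, p, q} = perp {x', p, q}"
      using gram_schmidt_pair[of p q] unfolding gram_schmidt_def by blast
    show ?thesis
    proof (cases "x = x'")
      case True
      then have "p \<perp> x" using x'(1) orth_sym by (auto simp: perp_def)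
      then show ?thesis using subset_cl by blast
    next
      case False
      then obtain y where y: "y \<perp> x'" "perp {x', x} = perp {x', y}"
        using perp_pair_orthogonal by metis
      have "y \<in> cl {x', x}" using cl_eq_if_perp_eq[OF y(2)] subset_cl by blast
      moreover have "cl {x', x} \<subseteq> cl {x', p, q}"
        using cl_eq_if_perp_eq[OF x'(2)] subset_cl by (intro cl_least) blast
      ultimately have "y \<in> cl {p, q}" using orthomodular[OF gram_schmidt_pair x'(1)] y(1) by blast
      then obtain r where r: "r \<in> cl {p, q}" "r \<perp> y" using in_line by blast
      have "x' \<perp> r" using r(1) x'(1) in_clD by blast
      then have "r \<in> perp {x', x}" using y(2) r(2) orth_sym by (auto simp: perp_def)
      then show ?thesis using r(1) by (auto simp: perp_def)
    qed
  qed
qed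

text \<open>Within the plane, the line \<open>a p\<close> is cut out by the hyperplane orthogonal to
  its normal \<open>n\<close>, and the line \<open>b q\<close> meets every hyperplane.\<close>

lemma coplanar_lines_meet:
  assumes "b \<noteq> q" "b \<in> cl {a, p, q}"
  shows "\<exists>r. r \<in> cl {a, p} \<and> r \<in> cl {b, q}"
proof (cases "q \<in> cl {a, p}")
  case True
  then show ?thesis using subset_cl by blast
next
  case False
  then obtain n where n: "n \<in> perp {a, p}" "perp {q, a, p} = perp {n, a, p}"
    using gram_schmidt_pair[of a p] unfolding gram_schmidt_def by blast
  obtain r where r: "r \<in> cl {b, q}" "r \<perp> n" using line_meets_hyperplane[OF assms(1)] by blast
  have "cl {b, q} \<subseteq> cl {q, a, p}"
    using assms(2) subset_cl by (intro cl_least) (auto simp: insert_commute)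
  then have "r \<in> cl {n, a, p}" using r(1) cl_eq_if_perp_eq[OF n(2)] by blast
  then show ?thesis using orthomodular[OF gram_schmidt_pair n(1)] r by blast
qed

text \<open>The line contains a point orthogonal to \<open>e\<close> and one that is neither
  \<open>e\<close> nor orthogonal to \<open>e\<close>; they cannot both be \<open>f\<close>.\<close>

lemma ex_third_point:
  assumes "e \<noteq> f"
  shows "\<exists>g\<in>cl {e, f}. g \<noteq> e \<and> g \<noteq> f"
proof -
  obtain g where g: "g \<perp> e" "perp {e, f} = perp {e, g}"
    using perp_pair_orthogonal[OF assms] by blast
  obtain h where h: "h \<noteq> e" "\<not> h \<perp> e" "perp {e, f} = perp {e, h}"
    using ex_nonorthogonal[OF assms] by (auto simp: perp_def)
  have "g \<in> cl {e, f}" "h \<in> cl {e, f}"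
    using cl_eq_if_perp_eq[OF g(2)] cl_eq_if_perp_eq[OF h(3)] subset_cl by auto
  then show ?thesis using g h orth_irrefl by metis
qed

end

section \<open>Homogeneously transitive orthosets are linear\<close>

lemma orthoset_autD:
  assumes "\<tau> \<in> orthoset_aut orth"
  shows "bij \<tau>" "orth p q \<longleftrightarrow> orth (\<tau> p) (\<tau> q)"
  using assms by (auto simp: orthoset_aut_def orthoset_iso_on_def)

lemma ex_fixing_aut:
  assumes "homogeneously_transitive orth" "e \<noteq> f"
  obtains \<phi> where "\<phi> \<in> G_fix orth e f" "\<phi> e = f"
  using assms unfolding homogeneously_transitive_def by blast

text \<open>
  This recovers \<open>{e, f}\<close>'s orthogonal complement from \<open>e\<close> and the group \<open>G_fix orth e f\<close>, so that a
  conjugation between such groups transports the complements.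
\<close>

lemma orth_pair_iff_fixed:
  assumes "homogeneously_transitive orth" "e \<noteq> f"
  shows "orth z e \<and> orth z f \<longleftrightarrow> orth z e \<and> (\<forall>\<phi>\<in>G_fix orth e f. \<phi> z = z)"
proof
  assume r: "orth z e \<and> (\<forall>\<phi>\<in>G_fix orth e f. \<phi> z = z)"
  obtain \<phi> where \<phi>: "\<phi> \<in> G_fix orth e f" "\<phi> e = f"
    by (rule ex_fixing_aut[OF assms])
  then have "orth (\<phi> z) (\<phi> e)"
    using r orthoset_autD(2)[of \<phi> orth z e] by (simp add: G_fix_def)
  then show "orth z e \<and> orth z f" using r \<phi> by metis
qed (simp add: G_fix_def)

text \<open>(HT2) controls the image of the first point only, so \<open>\<tau> y\<close> need not be
  \<open>f\<close>. The conjugation of the groups nevertheless shows that \<open>\<tau> y\<close>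
  and \<open>f\<close> have the same complement together with \<open>e\<close>.\<close>

lemma transport_pair:
  assumes ht: "homogeneously_transitive orth" and "x \<noteq> y" "e \<noteq> f"
  shows "\<exists>\<tau>\<in>orthoset_aut orth. \<tau> x = e \<and> (\<forall>z. orth z e \<and> orth z (\<tau> y) \<longleftrightarrow> orth z e \<and> orth z f)"
proof -
  obtain \<tau> where \<tau>: "\<tau> \<in> orthoset_aut orth" "\<tau> x = e"
      "G_fix orth x y = (\<lambda>\<psi>. inv_into UNIV \<tau> \<circ> \<psi> \<circ> \<tau>) ` G_fix orth e f"
    using assms unfolding homogeneously_transitive_def by blast
  have "orth z e \<and> orth z (\<tau> y) \<longleftrightarrow> orth z e \<and> orth z f" for z
  proof -
    define w where "w = inv_into UNIV \<tau> z"
    have z: "z = \<tau> w"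
      using orthoset_autD(1)[OF \<tau>(1)] unfolding w_def by (simp add: bij_is_surj surj_f_inv_f)
    have inv: "inv_into UNIV \<tau> p = w \<longleftrightarrow> p = \<tau> w" for p
      using orthoset_autD(1)[OF \<tau>(1)] by (metis bij_inv_eq_iff)
    have "orth z e \<and> orth z (\<tau> y) \<longleftrightarrow> orth w x \<and> orth w y"
      using orthoset_autD(2)[OF \<tau>(1)] z \<tau>(2) by metis
    also have "\<dots> \<longleftrightarrow> orth w x \<and> (\<forall>\<phi>\<in>G_fix orth x y. \<phi> w = w)"
      using orth_pair_iff_fixed[OF ht assms(2)] .
    also have "\<dots> \<longleftrightarrow> orth z e \<and> (\<forall>\<psi>\<in>G_fix orth e f. \<psi> z = z)"
      using orthoset_autD(2)[OF \<tau>(1), of w x] \<tau>(2,3) inv by (auto simp: z)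
    also have "\<dots> \<longleftrightarrow> orth z e \<and> orth z f"
      using orth_pair_iff_fixed[OF ht assms(3)] by blast
    finally show ?thesis .
  qed
  then show ?thesis using \<tau> by blast
qed

lemma card_le_iff:
  assumes "finite S" "finite T"
  shows "|S| \<le>o |T| \<longleftrightarrow> card S \<le> card T"
  using card_of_ordLeq[of S T] inj_on_iff_card_le[OF assms] by simp

text \<open>The rank is a least upper bound among cardinals on \<open>'a\<close>, so 3 itself is not
  at hand as a competitor. If there is no orthogonal quadruple, an orthogonal set \<open>D\<close>
  of maximal size exists, and \<open>|D|\<close> is an upper bound below 4.\<close>

lemma rank_ge_4:
  assumes "|{..<4::nat}| \<le>o orthoset_rank orth"
  shows "\<exists>D. mutually_orthogonal orth D \<and> finite D \<and> card D = 4"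
proof (rule ccontr)
  assume no: "\<not> ?thesis"
  have small: "finite D \<and> card D < 4" if D: "mutually_orthogonal orth D" for D
  proof (rule ccontr)
    assume l: "\<not> (finite D \<and> card D < 4)"
    obtain E where E: "E \<subseteq> D" "finite E" "card E = 4"
    proof (cases "finite D")
      case True
      then obtain E where "E \<subseteq> D" "card E = 4" using l obtain_subset_with_card_n[of 4 D] by auto
      then show ?thesis using that True finite_subset by blast
    next
      case False
      then show ?thesis using that infinite_arbitrarily_large by blast
    qed
    have "mutually_orthogonal orth E" using D E(1) by (auto simp: mutually_orthogonal_def)
    then show False using no E by blast
  qed
  have "card ` Collect (mutually_orthogonal orth) \<subseteq> {..<4}"
    using small by blast
  then have "finite (card ` Collect (mutually_orthogonal orth))"
    using finite_subset by blast
  moreover have "mutually_orthogonal orth {}" by (simp add: mutually_orthogonal_def)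
  ultimately obtain D where D: "mutually_orthogonal orth D"
      "\<And>E. mutually_orthogonal orth E \<Longrightarrow> card E \<le> card D"
    using Max_in[of "card ` Collect (mutually_orthogonal orth)"]
      Max_ge[of "card ` Collect (mutually_orthogonal orth)"] by fastforce
  have "|D| \<in> orthogonal_bounds orth"
    unfolding orthogonal_bounds_def mem_Collect_eq
    using card_le_iff[OF conjunct1[OF small] conjunct1[OF small]] D card_of_Card_order by metis
  then have "orthoset_rank orth \<le>o |D|" using orthoset_rank_least by blast
  then have "|{..<4::nat}| \<le>o |D|" using assms ordLeq_transitive by blast
  then have "card {..<4::nat} \<le> card D"
    using card_le_iff small[OF D(1)] by blast
  then show False using small[OF D(1)] by simp
qed

text \<open>Two fixed configurations are moved to an arbitrary pair \<open>e\<close>,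
  \<open>f\<close>: an orthogonal quadruple, which the rank provides, and a non-orthogonal pair of
  distinct points, which exists because the orthoset is not Boolean.\<close>

lemma linear_orthoset_of_transitive:
  assumes o: "orthoset orth" and ht: "homogeneously_transitive orth"
    and rank: "|{..<4::nat}| \<le>o orthoset_rank orth" and nb: "\<not> Boolean_orthoset orth"
  shows "linear_orthoset orth"
proof -
  have sym: "\<And>x y. orth x y \<Longrightarrow> orth y x" and irr: "\<And>x. \<not> orth x x"
    using o by (auto simp: orthoset_def dest: sympD irreflpD)
  obtain D where D: "mutually_orthogonal orth D" "finite D" "card D = 4" using rank_ge_4[OF rank] by blast
  have "\<exists>a b c d. D = {a, b, c, d} \<and> a \<noteq> b \<and> a \<noteq> c \<and> a \<noteq> d \<and> b \<noteq> c \<and> b \<noteq> d \<and> c \<noteq> d"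
    using D(3) by (auto simp: card_Suc_eq numeral_eq_Suc)
  then obtain a b c d where abcd: "orth a b" "orth c a" "orth c b" "orth d a" "orth d b" "orth c d"
    using D(1) unfolding mutually_orthogonal_def by (metis insertCI)
  have ab: "a \<noteq> b" using abcd irr by blast
  obtain x y where xy: "x \<noteq> y" "\<not> orth x y" using nb irr by (auto simp: Boolean_orthoset_def)
  show ?thesis
  proof
    fix e f :: 'a assume ef: "e \<noteq> f"
    obtain \<tau> where \<tau>: "\<tau> \<in> orthoset_aut orth" "\<tau> a = e"
        "\<And>z. orth z e \<and> orth z (\<tau> b) \<longleftrightarrow> orth z e \<and> orth z f"
      using transport_pair[OF ht ab ef] by blast
    note \<tau>o = orthoset_autD(2)[OF \<tau>(1)]
    have "orth (\<tau> b) e" using \<tau>o[of b a] abcd(1) sym \<tau>(2) by metis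
    then show "\<exists>g. orth g e \<and> (\<forall>z. orth z e \<and> orth z f \<longleftrightarrow> orth z e \<and> orth z g)" using \<tau>(3) by blast
    have "orth (\<tau> c) e" "orth (\<tau> c) (\<tau> b)" "orth (\<tau> d) e" "orth (\<tau> d) (\<tau> b)" "orth (\<tau> c) (\<tau> d)"
      using abcd \<tau>o \<tau>(2) by metis+
    then show "\<exists>g h. orth g e \<and> orth g f \<and> orth h e \<and> orth h f \<and> orth g h" using \<tau>(3) by blast
    obtain \<sigma> where \<sigma>: "\<sigma> \<in> orthoset_aut orth" "\<sigma> x = e"
        "\<And>z. orth z e \<and> orth z (\<sigma> y) \<longleftrightarrow> orth z e \<and> orth z f"
      using transport_pair[OF ht xy(1) ef] by blast
    have "\<sigma> y \<noteq> e" using \<sigma>(2) xy(1) orthoset_autD(1)[OF \<sigma>(1)] by (metis bij_pointE)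
    moreover have "\<not> orth (\<sigma> y) e" using orthoset_autD(2)[OF \<sigma>(1), of y x] xy(2) sym \<sigma>(2) by metis
    ultimately show "\<exists>g. g \<noteq> e \<and> \<not> orth g e \<and> (\<forall>z. orth z e \<and> orth z f \<longleftrightarrow> orth z e \<and> orth z g)"
      using \<sigma>(3) by blast
  next
    show "\<exists>f. f \<noteq> (e::'a)" for e using ab by metis
  qed (use sym irr in blast)+
qed

section \<open>Dilatations and translations of an affine space\<close>

text \<open>
  \<open>M\<close> is the set of points at infinity of the affine space \<open>A\<close>, \<open>R p x y\<close> says that \<open>x\<close> and \<open>y\<close> lie on
  an affine line with point at infinity \<open>p\<close>, and \<open>L p q\<close> is the line at infinity through \<open>p\<close> and \<open>q\<close>.
\<close>

locale affine_directions =
  fixes A :: "'a set" and M :: "'d set"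
    and R :: "'d \<Rightarrow> 'a \<Rightarrow> 'a \<Rightarrow> bool" and L :: "'d \<Rightarrow> 'd \<Rightarrow> 'd set"
  assumes R_in: "R p x y \<Longrightarrow> p \<in> M \<and> x \<in> A \<and> y \<in> A"
    and R_refl: "p \<in> M \<Longrightarrow> x \<in> A \<Longrightarrow> R p x x"
    and R_sym: "R p x y \<Longrightarrow> R p y x"
    and R_trans: "R p x y \<Longrightarrow> R p y z \<Longrightarrow> R p x z"
    and R_ex: "x \<in> A \<Longrightarrow> y \<in> A \<Longrightarrow> \<exists>p. R p x y"
    and R_unique: "R p x y \<Longrightarrow> R q x y \<Longrightarrow> p \<noteq> q \<Longrightarrow> x = y"
    and menelaus: "R p a c \<Longrightarrow> R q a d \<Longrightarrow> R r c d \<Longrightarrow> c \<noteq> d \<Longrightarrow> r \<in> L p q"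
    and veblen: "R r a b \<Longrightarrow> r \<in> L p q \<Longrightarrow> p \<in> M \<Longrightarrow> q \<in> M \<Longrightarrow> p \<noteq> q \<Longrightarrow> \<exists>x. R p a x \<and> R q b x"
    and R_move: "x \<in> A \<Longrightarrow> p \<in> M \<Longrightarrow> \<exists>y. y \<noteq> x \<and> R p x y"
    and L_left: "p \<in> M \<Longrightarrow> q \<in> M \<Longrightarrow> p \<in> L p q"
    and L_right: "p \<in> M \<Longrightarrow> q \<in> M \<Longrightarrow> q \<in> L p q"
    and L_eq: "p \<in> M \<Longrightarrow> q \<in> M \<Longrightarrow> r \<in> L p q \<Longrightarrow> s \<in> L p q \<Longrightarrow> r \<noteq> s \<Longrightarrow> L r s = L p q"
    and L_same: "p \<in> M \<Longrightarrow> L p p = {p}"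
    and noncoplanar: "p \<in> M \<Longrightarrow> q \<in> M \<Longrightarrow> \<exists>s\<in>M. s \<notin> L p q"
begin

section \<open>Parallelism, triangles and Desargues' theorem\<close>

lemma R_meet: "R p a x \<Longrightarrow> R p a y \<Longrightarrow> R q b x \<Longrightarrow> R q b y \<Longrightarrow> p \<noteq> q \<Longrightarrow> x = y"
  by (metis R_sym R_trans R_unique)

lemma L_eq_left: "p \<in> M \<Longrightarrow> q \<in> M \<Longrightarrow> r \<in> L p q \<Longrightarrow> r \<noteq> p \<Longrightarrow> L p r = L p q"
  using L_eq[of p q p r] L_left by metis

lemma ex_off_line: "a \<in> A \<Longrightarrow> p \<in> M \<Longrightarrow> \<exists>q c. q \<noteq> p \<and> c \<noteq> a \<and> R q a c \<and> \<not> R p a c"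
  by (metis L_left R_move R_unique noncoplanar)

text \<open>The one-sided form admits a degenerate image: for \<open>x \<noteq> y\<close> the points
  \<open>x'\<close> and \<open>y'\<close> may coincide, whereas \<open>x = y\<close> forces them
  to.\<close>

definition par :: "'a \<Rightarrow> 'a \<Rightarrow> 'a \<Rightarrow> 'a \<Rightarrow> bool" where
  "par x y x' y' \<longleftrightarrow> (\<forall>p. R p x y \<longrightarrow> R p x' y')"

definition ncol :: "'a \<Rightarrow> 'a \<Rightarrow> 'a \<Rightarrow> bool" where
  "ncol a b c \<longleftrightarrow> a \<in> A \<and> b \<in> A \<and> c \<in> A \<and> (\<forall>p. R p a b \<longrightarrow> \<not> R p a c)"

lemma parD: "par x y x' y' \<Longrightarrow> R p x y \<Longrightarrow> R p x' y'"
  by (simp add: par_def)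

lemma par_sym: "par x y x' y' \<Longrightarrow> par y x y' x'"
  using R_sym by (meson par_def)

lemma parI: "R p x y \<Longrightarrow> x \<noteq> y \<Longrightarrow> R p x' y' \<Longrightarrow> par x y x' y'"
  unfolding par_def using R_unique by blast

lemma par_same: "par x x x' y' \<Longrightarrow> x \<in> A \<Longrightarrow> x' = y'"
proof -
  assume a: "par x x x' y'" "x \<in> A"
  obtain p where "R p x x" using R_ex a by blast
  then obtain q where "q \<in> M" "q \<noteq> p" using noncoplanar L_left R_in by metis
  then show ?thesis using a \<open>R p x x\<close> R_refl R_unique parD by metis
qed

lemma ncol_in: "ncol a b c \<Longrightarrow> a \<in> A \<and> b \<in> A \<and> c \<in> A"
  by (simp add: ncol_def)

lemma ncol_swap: "ncol a b c \<Longrightarrow> ncol a c b"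
  unfolding ncol_def by blast

lemma ncol_distinct: "ncol a b c \<Longrightarrow> a \<noteq> b \<and> a \<noteq> c \<and> b \<noteq> c"
  unfolding ncol_def using R_ex R_refl R_in by metis

lemma ncol_rot: "ncol a b c \<Longrightarrow> ncol b a c"
  unfolding ncol_def using R_sym R_trans by meson

lemma ncolD: "ncol a b c \<Longrightarrow> R p a b \<Longrightarrow> R q a c \<Longrightarrow> p \<noteq> q"
  unfolding ncol_def by blast

lemma ncol_or_on_line: "a \<in> A \<Longrightarrow> b \<in> A \<Longrightarrow> x \<in> A \<Longrightarrow> R p a b \<Longrightarrow> a \<noteq> b \<Longrightarrow> ncol a b x \<or> R p a x"
  unfolding ncol_def using R_unique by blast

lemma ncolI: "R p a b \<Longrightarrow> a \<noteq> b \<Longrightarrow> x \<in> A \<Longrightarrow> \<not> R p a x \<Longrightarrow> ncol a b x"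
  using ncol_or_on_line R_in by blast

lemma ncol_image:
  assumes "ncol a b c" "par a b a' b'" "par a c a' c'" "par b c b' c'" "a' \<noteq> b'"
  shows "ncol a' b' c'"
proof -
  obtain p p1 q1 where R: "R p a b" "R p1 a c" "R q1 b c"
    using assms(1) R_ex ncol_in by meson
  then have ne: "p \<noteq> p1" "p \<noteq> q1"
    using assms(1) ncolD ncol_rot R_sym by metis+
  have R': "R p a' b'" "R p1 a' c'" "R q1 b' c'" using R assms parD by blast+
  have "\<not> R p a' c'" using R' ne assms(5) R_unique R_sym R_trans by metis
  then show ?thesis using ncolI R' assms(5) R_in by blast
qed

text \<open>By \<open>menelaus\<close>, the direction of \<open>a b\<close> is on the line at
  infinity through the directions of \<open>a x\<close> and \<open>b x\<close>. Since
  \<open>a' b'\<close> has this direction too, \<open>veblen\<close> makes the parallels through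
  \<open>a'\<close> and \<open>b'\<close> meet.\<close>

lemma ex_image:
  assumes "ncol a b x" "par a b a' b'"
  shows "\<exists>x'\<in>A. par a x a' x' \<and> par b x b' x'"
proof -
  obtain p p1 q1 where R: "R p a b" "R p1 a x" "R q1 b x"
    using assms(1) R_ex ncol_in by meson
  have ne: "a \<noteq> b" "a \<noteq> x" "b \<noteq> x" using assms(1) ncol_distinct by blast+
  have "p1 \<noteq> q1" using assms(1) R ncolD ncol_swap ncol_rot R_sym by metis
  moreover have "p \<in> L p1 q1" using menelaus[OF R_sym[OF R(2)] R_sym[OF R(3)] R(1)] ne by blast
  moreover have "R p a' b'" using R(1) assms(2) parD by blast
  ultimately obtain x' where "R p1 a' x'" "R q1 b' x'"
    using veblen R_in R by metis
  then show ?thesis using parI R ne R_in by meson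
qed

text \<open>
  The directions of \<open>c d\<close> and of \<open>c' d'\<close> both lie on the lines at infinity of the planes \<open>a c d\<close> and
  \<open>b c d\<close>, and these two lines are distinct.
\<close>

lemma par_noncoplanar:
  assumes "ncol a b c" "ncol a b d" "R p a b" "R p1 a c" "R p2 a d" "p2 \<notin> L p p1"
    and "par a c a' c'" "par b c b' c'" "par a d a' d'" "par b d b' d'" "c \<noteq> d"
  shows "par c d c' d'"
proof -
  obtain q1 q2 r where R: "R q1 b c" "R q2 b d" "R r c d"
    using assms(1,2) R_ex ncol_in by meson
  have R': "R p1 a' c'" "R p2 a' d'" "R q1 b' c'" "R q2 b' d'"
    using assms R parD by blast+
  obtain r' where r': "R r' c' d'" using R' R_ex R_in by meson
  have M: "p \<in> M" "p1 \<in> M" "p2 \<in> M" "q1 \<in> M" "q2 \<in> M" "r \<in> M" "r' \<in> M"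
    using assms R r' R_in by blast+
  have ne: "p \<noteq> p1" "q1 \<noteq> p1"
    using assms(1,3,4) R(1) ncolD ncol_rot ncol_swap R_sym by metis+
  have "q1 \<in> L p p1"
    using menelaus[of p a b p1 c q1] assms(3,4) R(1) assms(1) ncol_distinct by blast
  then have L1: "L q1 p1 = L p p1" using L_eq[of p p1 q1 p1] M L_right ne by simp
  have q1: "q1 \<notin> L p1 p2"
  proof
    assume "q1 \<in> L p1 p2"
    then have "L q1 p1 = L p1 p2" using L_eq[of p1 p2 q1 p1] M L_left ne by simp
    then show False using L1 assms(6) L_right M by simp
  qed
  have "R r c' d'"
  proof (cases "c' = d'")
    case True
    then show ?thesis using R_refl M r' R_in by blast
  next
    case False
    have "r \<in> L p1 p2" "r \<in> L q1 q2" using menelaus assms(4,5,11) R by blast+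
    moreover have "r' \<in> L p1 p2" "r' \<in> L q1 q2" using menelaus R' r' False by blast+
    ultimately have "r = r'" using q1 L_eq[of p1 p2 r r'] L_eq[of q1 q2 r r'] M L_left[of q1 q2] by auto
    then show ?thesis using r' by simp
  qed
  then show ?thesis using parI R(3) assms(11) by blast
qed

text \<open>
  If \<open>d\<close> lies in the plane \<open>a b c\<close>, an auxiliary point \<open>e\<close> off this plane reduces the claim to three
  instances of the noncoplanar case.
\<close>

lemma par_desargues:
  assumes nc: "ncol a b c" "ncol a b d"
    and par: "par a b a' b'" "par a c a' c'" "par b c b' c'" "par a d a' d'" "par b d b' d'"
    and ne': "a' \<noteq> b'"
  shows "par c d c' d'"
proof (cases "c = d")
  case True
  obtain p p1 q1 where R: "R p a b" "R p1 a c" "R q1 b c"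
    using nc(1) R_ex ncol_in by meson
  then have "p1 \<noteq> q1" using nc(1) ncolD ncol_swap ncol_rot R_sym by metis
  moreover have "R p1 a' c'" "R p1 a' d'" "R q1 b' c'" "R q1 b' d'"
    using R True par parD by blast+
  ultimately have "c' = d'" using R_meet by blast
  then show ?thesis using True R_refl R_in \<open>R p1 a' c'\<close> unfolding par_def by blast
next
  case False
  obtain p p1 p2 where R: "R p a b" "R p1 a c" "R p2 a d"
    using nc R_ex ncol_in by meson
  have M: "p \<in> M" "p1 \<in> M" "p2 \<in> M" using R R_in by blast+
  have ne: "p \<noteq> p1" "p \<noteq> p2" using R nc ncolD by blast+
  show ?thesis
  proof (cases "p2 \<in> L p p1")
    case False
    then show ?thesis using par_noncoplanar nc R par \<open>c \<noteq> d\<close> by blast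
  next
    case True
    then have L2: "L p p2 = L p p1" using L_eq_left[OF M(1,2)] ne by metis
    obtain s where s: "s \<in> M" "s \<notin> L p p1" using noncoplanar M by blast
    obtain e where e: "e \<noteq> a" "R s a e" using R_move s R R_in by meson
    have "s \<noteq> p" using s L_left M by blast
    then have "\<not> R p a e" using e R_unique by metis
    then have "ncol a b e" using ncolI[OF R(1)] nc(1) ncol_distinct e R_in by metis
    then obtain e' where e': "par a e a' e'" "par b e b' e'" using ex_image par(1) by blast
    have "s \<noteq> p1" "s \<noteq> p2" using s True L_right M by blast+
    then have "c \<noteq> e" "d \<noteq> e" using R e R_unique nc ncol_distinct by metis+
    then have ce: "par c e c' e'" and de: "par d e d' e'"
      using par_noncoplanar[OF nc(1) \<open>ncol a b e\<close> R(1,2) e(2) s(2) par(2,3) e']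
        par_noncoplanar[OF nc(2) \<open>ncol a b e\<close> R(1,3) e(2) _ par(4,5) e'] s(2) L2 by auto
    have nac: "ncol a e c" "ncol a e d"
      using e R \<open>s \<noteq> p1\<close> \<open>s \<noteq> p2\<close> R_in R_unique nc ncol_distinct unfolding ncol_def by metis+
    show ?thesis
    proof (cases "p1 = p2")
      case True
      then have "R p1 c d" "R p1 c' d'" using R par parD R_sym R_trans by metis+
      then show ?thesis using parI \<open>c \<noteq> d\<close> by blast
    next
      case False
      \<comment> \<open>The third noncoplanar instance uses the segment \<open>a e\<close> in the
        role of \<open>a b\<close>; its direction \<open>s\<close> is off the line at infinity of
        the plane \<open>a c d\<close>.\<close>
      have "p2 \<notin> L s p1"
      proof
        assume "p2 \<in> L s p1"
        then have "L p2 p1 = L s p1" using L_eq[of s p1 p2 p1] False L_right M s by simp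
        moreover have "L p2 p1 = L p p1" using L_eq[of p p1 p2 p1] False True L_right M by simp
        ultimately show False using s L_left M by blast
      qed
      then show ?thesis
        using par_noncoplanar[OF nac e(2) R(2,3) _ par(2) par_sym[OF ce] par(4) par_sym[OF de] \<open>c \<noteq> d\<close>]
        by blast
    qed
  qed
qed

section \<open>Dilatations: existence and uniqueness\<close>

definition dilatation :: "('a \<Rightarrow> 'a) \<Rightarrow> bool" where
  "dilatation \<phi> \<longleftrightarrow> (\<forall>x\<in>A. \<phi> x \<in> A) \<and> (\<forall>p x y. R p x y \<longrightarrow> R p (\<phi> x) (\<phi> y))"

lemma dilatation_closed: "dilatation \<phi> \<Longrightarrow> x \<in> A \<Longrightarrow> \<phi> x \<in> A"
  by (simp add: dilatation_def)

lemma dilatation_R: "dilatation \<phi> \<Longrightarrow> R p x y \<Longrightarrow> R p (\<phi> x) (\<phi> y)"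
  by (simp add: dilatation_def)

lemma dilatation_const: "c \<in> A \<Longrightarrow> dilatation (\<lambda>_. c)"
  unfolding dilatation_def using R_refl R_in by blast

lemma dilatation_id: "dilatation (\<lambda>x. x)"
  by (simp add: dilatation_def)

lemma dilatation_comp: "dilatation \<phi> \<Longrightarrow> dilatation \<psi> \<Longrightarrow> dilatation (\<lambda>x. \<phi> (\<psi> x))"
  by (simp add: dilatation_def)

text \<open>The pair \<open>a\<close>, \<open>b\<close> is completed to a triangle
  \<open>a b c\<close> with parallel image \<open>a' b' c'\<close>. The image of \<open>x\<close> is
  found by drawing parallels through two vertices whose side misses \<open>x\<close>; Desargues'
  theorem makes the third parallel pass through the same point.\<close>

lemma ex_dilatation:
  assumes "a \<noteq> b" "a' \<noteq> b'" "R p a b" "R p a' b'"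
  shows "\<exists>\<phi>. dilatation \<phi> \<and> \<phi> a = a' \<and> \<phi> b = b'"
proof -
  obtain q c where c: "q \<noteq> p" "c \<noteq> a" "R q a c" "\<not> R p a c"
    using ex_off_line assms(3) R_in by meson
  have abc: "ncol a b c" using ncolI assms c R_in by blast
  have pab: "par a b a' b'" using parI assms by blast
  obtain c' where c': "c' \<in> A" "par a c a' c'" "par b c b' c'"
    using ex_image[OF abc pab] by blast
  have abc': "ncol a' b' c'" using ncol_image abc pab c' assms(2) by blast
  define Q where "Q x x' \<longleftrightarrow> x' \<in> A \<and> par a x a' x' \<and> par b x b' x' \<and> par c x c' x'" for x x'
  have ex: "\<exists>x'. Q x x'" if x: "x \<in> A" for x
  proof -
    have A: "a \<in> A" "b \<in> A" "c \<in> A" using abc ncol_in by blast+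
    consider "x = a" | "ncol a b x" | "x \<noteq> a" "R p a x"
      using ncol_or_on_line assms A x by blast
    then show ?thesis
    proof cases
      case 1
      then have "Q x a'"
        unfolding Q_def using pab c' par_sym R_refl R_in assms(4) by (meson par_def)
      then show ?thesis by blast
    next
      case 2
      then obtain x' where "x' \<in> A" "par a x a' x'" "par b x b' x'"
        using ex_image pab by blast
      moreover from this have "par c x c' x'"
        using par_desargues[OF abc 2 pab c'(2,3)] assms(2) by blast
      ultimately show ?thesis unfolding Q_def by blast
    next
      case 3
      then have acx: "ncol a c x"
        using c A R_in R_unique unfolding ncol_def by metis
      then obtain x' where x': "x' \<in> A" "par a x a' x'" "par c x c' x'"
        using ex_image c'(2) by blast
      moreover have "a' \<noteq> c'" using abc' ncol_distinct by blast
      ultimately have "par b x b' x'"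
        using par_desargues[OF ncol_swap[OF abc] acx c'(2) pab par_sym[OF c'(3)]] by blast
      then show ?thesis using x' unfolding Q_def by blast
    qed
  qed
  define \<phi> where "\<phi> x = (SOME x'. Q x x')" for x
  have Q: "Q x (\<phi> x)" if "x \<in> A" for x
    unfolding \<phi>_def using someI_ex[OF ex[OF that]] .
  have vertex: "\<phi> a = a'" "\<phi> b = b'" "\<phi> c = c'"
    using Q abc par_same ncol_in unfolding Q_def by metis+
  have "par x y (\<phi> x) (\<phi> y)" if xy: "x \<in> A" "y \<in> A" for x y
  proof -
    have A: "a \<in> A" "b \<in> A" "c \<in> A" using abc ncol_in by blast+
    note Qx = Q[OF xy(1), unfolded Q_def] and Qy = Q[OF xy(2), unfolded Q_def]
    obtain r where r: "R r b c" using R_ex A by blast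
    have d: "p \<noteq> q" "p \<noteq> r" "q \<noteq> r" "a \<noteq> b" "a \<noteq> c" "b \<noteq> c" "a' \<noteq> b'" "a' \<noteq> c'" "b' \<noteq> c'"
      using abc abc' assms(3) c(3) r ncolD ncol_rot ncol_swap R_sym ncol_distinct by metis+
    \<comment> \<open>A point other than a vertex lies on at most one side of the triangle, so at
      least one side avoids both \<open>x\<close> and \<open>y\<close>, and Desargues' theorem over
      that side gives the parallelism.\<close>
    have ab: ?thesis if "ncol a b x" "ncol a b y"
      using par_desargues[OF that pab] Qx Qy d by blast
    have ac: ?thesis if "ncol a c x" "ncol a c y"
      using par_desargues[OF that c'(2)] Qx Qy d by blast
    have bc: ?thesis if "ncol b c x" "ncol b c y"
      using par_desargues[OF that c'(3)] Qx Qy d by blast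
    have vx: ?thesis if "x \<in> {a, b, c}" using that vertex Qy by auto
    have vy: ?thesis if "y \<in> {a, b, c}" using that vertex Qx par_sym by auto
    have on: "ncol a b z \<or> R p a z" "ncol a c z \<or> R q a z" "ncol b c z \<or> R r b z" if "z \<in> A" for z
      using ncol_or_on_line A that assms(3) c(3) r d by blast+
    have vert: "z \<in> {a, b, c}"
      if "R p a z \<and> R q a z \<or> R p a z \<and> R r b z \<or> R q a z \<and> R r b z" for z
    proof -
      have "z = a" if "R p a z" "R q a z" using that d R_unique by metis
      moreover have "z = b" if "R p a z" "R r b z"
        using that d R_unique assms(3) R_sym R_trans by metis
      moreover have "z = c" if "R q a z" "R r b z"
        using that d R_unique c(3) r R_sym R_trans by metis
      ultimately show ?thesis using that by blast
    qed
    show ?thesis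
      using ab ac bc vx vy on[OF xy(1)] on[OF xy(2)] vert[of x] vert[of y] by argo
  qed
  then have "dilatation \<phi>"
    unfolding dilatation_def using Q R_in parD unfolding Q_def by metis
  then show ?thesis using vertex by blast
qed

text \<open>A point off the line of two points with known images is the intersection of lines whose
  images are known. Points on the line \<open>a b\<close> are reached through an auxiliary
  \<open>c\<close> off it.\<close>

lemma dilatation_unique:
  assumes \<phi>: "dilatation \<phi>" and \<psi>: "dilatation \<psi>" and "a \<in> A" "b \<in> A" "a \<noteq> b"
    and eq: "\<phi> a = \<psi> a" "\<phi> b = \<psi> b" and x: "x \<in> A"
  shows "\<phi> x = \<psi> x"
proof -
  have off: "\<phi> y = \<psi> y" if nc: "ncol s t y" and st: "\<phi> s = \<psi> s" "\<phi> t = \<psi> t" for s t y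
  proof -
    obtain p q where R: "R p s y" "R q t y" using nc R_ex ncol_in by meson
    then have "p \<noteq> q" using nc ncolD ncol_swap ncol_rot R_sym by metis
    then show ?thesis using R dilatation_R[OF \<phi>] dilatation_R[OF \<psi>] R_meet st by metis
  qed
  obtain p where p: "R p a b" using assms R_ex by blast
  obtain q c where c: "q \<noteq> p" "c \<noteq> a" "R q a c" "\<not> R p a c"
    using ex_off_line p R_in by meson
  have "ncol a b c" using ncolI p c assms(5) R_in by blast
  then have \<phi>c: "\<phi> c = \<psi> c" using off eq by blast
  consider "x = a" | "ncol a b x" | "x \<noteq> a" "R p a x" using ncol_or_on_line assms p by blast
  then show ?thesis
  proof cases
    case 3
    then have "ncol a c x" using c ncolI R_unique x by metis
    then show ?thesis using off eq \<phi>c by blast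
  qed (use off eq in auto)
qed

section \<open>Translations\<close>

definition translation :: "('a \<Rightarrow> 'a) \<Rightarrow> bool" where
  "translation \<tau> \<longleftrightarrow> dilatation \<tau> \<and> ((\<forall>x\<in>A. \<tau> x = x) \<or> (\<forall>x\<in>A. \<tau> x \<noteq> x))"

text \<open>The line joining a point to its image is mapped into itself. If two such lines had
  different directions \<open>p\<close> and \<open>r\<close>, they would be coplanar and meet, and
  their common point \<open>z\<close> would be fixed.\<close>

lemma fixpoint_free_direction:
  assumes \<phi>: "dilatation \<phi>" and free: "\<And>x. x \<in> A \<Longrightarrow> \<phi> x \<noteq> x" and a: "R p a (\<phi> a)" and x: "x \<in> A"
  shows "R p x (\<phi> x)"
proof -
  obtain k r where R: "R k a x" "R r x (\<phi> x)" using a x R_in R_ex dilatation_closed[OF \<phi>] by meson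
  have k': "R k (\<phi> a) (\<phi> x)" using R dilatation_R \<phi> by blast
  have ne: "a \<noteq> \<phi> a" "x \<noteq> \<phi> x" using free a x R_in by metis+
  show ?thesis
  proof (cases "k = p \<or> p = r")
    case True
    then show ?thesis using R k' a R_sym R_trans by metis
  next
    case False
    have M: "p \<in> M" "k \<in> M" "r \<in> M" using a R R_in by blast+
    \<comment> \<open>Coplanarity of the quadrilateral \<open>a\<close>, \<open>x\<close>,
      \<open>\<phi> x\<close>, \<open>\<phi> a\<close>: its diagonal from \<open>a\<close> to
      \<open>\<phi> x\<close>, of direction \<open>j\<close>, splits it into two triangles to which
      \<open>menelaus\<close> applies.\<close>
    have "k \<in> L p r"
    proof (cases "a = \<phi> x")
      case True
      then have "R r a x" using R R_sym by metis
      then have "r = k \<or> a = x" using R R_unique by blast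
      then show ?thesis using L_right M ne True by metis
    next
      case a\<phi>x: False
      obtain j where j: "R j a (\<phi> x)" using a x R_in R_ex dilatation_closed[OF \<phi>] by meson
      then have jM: "j \<in> M" using R_in by blast
      have "j \<noteq> k"
      proof
        assume "j = k"
        then have "R k a (\<phi> a)" using j k' R_sym R_trans by metis
        then show False using a False ne R_unique by metis
      qed
      have "\<phi> a \<noteq> \<phi> x"
        using j a False dilatation_R[OF \<phi>] \<open>j \<noteq> k\<close> R ne k' R_unique R_sym R_trans
        by (metis free R_in menelaus L_same singletonD)
      then have 1: "k \<in> L p j" using menelaus a j k' by blast
      have 2: "j \<in> L k r" using menelaus[OF R_sym[OF R(1)] R(2) j] a\<phi>x by blast
      have "L k j = L k r" using L_eq_left[OF M(2,3) 2] \<open>j \<noteq> k\<close> by metis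
      moreover have "L k j = L p j"
        using L_eq[of p j k j] 1 \<open>j \<noteq> k\<close> M jM L_right by metis
      ultimately have "p \<in> L k r" "r \<in> L k r" "k \<in> L k r"
        using L_left L_right M jM by metis+
      then show ?thesis using L_eq[of k r p r] False M by metis
    qed
    then obtain z where z: "R p a z" "R r x z" using veblen R(1) M False by blast
    have "R p z (\<phi> z)" using z a dilatation_R[OF \<phi> z(1)] R_sym R_trans by metis
    moreover have "R r z (\<phi> z)" using z R dilatation_R[OF \<phi> z(2)] R_sym R_trans by metis
    ultimately have "z = \<phi> z" using R_unique False by blast
    then show ?thesis using free z R_in by metis
  qed
qed

lemma translation_dilatation: "translation \<tau> \<Longrightarrow> dilatation \<tau>"
  by (simp add: translation_def)

lemma translation_closed: "translation \<tau> \<Longrightarrow> x \<in> A \<Longrightarrow> \<tau> x \<in> A"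
  using translation_dilatation dilatation_closed by blast

lemma translation_R: "translation \<tau> \<Longrightarrow> R p x y \<Longrightarrow> R p (\<tau> x) (\<tau> y)"
  using translation_dilatation dilatation_R by blast

lemma translation_id: "translation (\<lambda>x. x)"
  by (simp add: translation_def dilatation_id)

lemma translation_direction:
  assumes "translation \<tau>" "R p a (\<tau> a)" "x \<in> A"
  shows "R p x (\<tau> x)"
proof (cases "\<forall>x\<in>A. \<tau> x = x")
  case True
  then show ?thesis using assms R_refl R_in by metis
next
  case False
  then show ?thesis using assms fixpoint_free_direction unfolding translation_def by blast
qed

text \<open>With \<open>c\<close> off the line \<open>a b\<close>, let \<open>c'\<close> complete
  the parallelogram. The dilatation carrying \<open>a\<close>, \<open>c\<close> to \<open>b\<close>,
  \<open>c'\<close> has no fixed point, since such a point would be on the two distinct parallels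
  \<open>a b\<close> and \<open>c c'\<close>.\<close>

lemma ex_translation:
  assumes "a \<in> A" "b \<in> A"
  shows "\<exists>\<tau>. translation \<tau> \<and> \<tau> a = b"
proof (cases "a = b")
  case True
  then show ?thesis using translation_id by blast
next
  case False
  obtain p where p: "R p a b" using assms R_ex by blast
  obtain q c where c: "q \<noteq> p" "c \<noteq> a" "R q a c" "\<not> R p a c"
    using ex_off_line p R_in by meson
  obtain r where r: "R r b c" using R_ex p c R_in by meson
  have M: "p \<in> M" "q \<in> M" "r \<in> M" using p c r R_in by blast+
  have "b \<noteq> c" using p c by blast
  then have "r \<in> L q p" using menelaus[OF c(3) p R_sym[OF r]] by blast
  then obtain c' where c': "R q b c'" "R p c c'" using veblen[OF r] M c(1) by blast
  have "b \<noteq> c'" using c' p c(4) R_sym R_trans by metis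
  then obtain \<phi> where \<phi>: "dilatation \<phi>" "\<phi> a = b" "\<phi> c = c'"
    using ex_dilatation c c' by metis
  have "c \<noteq> c'"
  proof
    assume "c = c'"
    then have "R q a b" using c' c(3) R_sym R_trans by metis
    then show False using p c(1) False R_unique by blast
  qed
  have "\<phi> z \<noteq> z" if z: "z \<in> A" for z
  proof
    assume fz: "\<phi> z = z"
    obtain k m where km: "R k a z" "R m c z" using R_ex z assms c R_in by meson
    have "R k b z" "R m c' z" using dilatation_R[OF \<phi>(1)] km \<phi> fz by metis+
    then have "R k a b" "R m c c'" using km R_sym R_trans by metis+
    then have "k = p" "m = p" using p c' False \<open>c \<noteq> c'\<close> R_unique by blast+
    then show False using km c(4) R_sym R_trans by metis
  qed
  then show ?thesis using \<phi> unfolding translation_def by blast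
qed

lemma translation_unique:
  assumes \<tau>: "translation \<tau>" and \<sigma>: "translation \<sigma>" and a: "a \<in> A" "\<tau> a = \<sigma> a" and x: "x \<in> A"
  shows "\<tau> x = \<sigma> x"
proof -
  obtain p where p: "R p a (\<tau> a)" using a \<tau> translation_closed R_ex by blast
  obtain q c where c: "q \<noteq> p" "c \<noteq> a" "R q a c" using ex_off_line p R_in by meson
  have A: "c \<in> A" using c R_in by blast
  have "R p c (\<tau> c)" "R p c (\<sigma> c)" using translation_direction \<tau> \<sigma> p a A by metis+
  moreover have "R q (\<tau> a) (\<tau> c)" "R q (\<tau> a) (\<sigma> c)" using translation_R \<tau> \<sigma> c a by metis+
  ultimately have "\<tau> c = \<sigma> c" using R_meet c(1) by metis
  then show ?thesis
    using dilatation_unique translation_dilatation \<tau> \<sigma> a A c x by metis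
qed

text \<open>If the composition fixes \<open>x\<close>, then \<open>\<sigma>\<close> and
  \<open>\<tau>\<close> move all points in one common direction \<open>p\<close>. A point
  \<open>c\<close> in another direction from \<open>x\<close> stays on the line \<open>x c\<close>
  and moves only along \<open>p\<close>, so it is fixed as well, and two fixed points give the
  identity.\<close>

lemma translation_comp:
  assumes \<tau>: "translation \<tau>" and \<sigma>: "translation \<sigma>"
  shows "translation (\<lambda>x. \<tau> (\<sigma> x))"
proof -
  have dil: "dilatation (\<lambda>x. \<tau> (\<sigma> x))" using \<tau> \<sigma> dilatation_comp translation_dilatation by blast
  have "\<tau> (\<sigma> y) = y" if x: "x \<in> A" "\<tau> (\<sigma> x) = x" and y: "y \<in> A" for x y
  proof -
    obtain p where p: "R p x (\<sigma> x)" using x \<sigma> translation_closed R_ex by blast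
    then have "R p (\<sigma> x) (\<tau> (\<sigma> x))" using x R_sym by simp
    then have dir: "R p z (\<tau> (\<sigma> z))" if "z \<in> A" for z
      using translation_direction \<tau> \<sigma> p that translation_closed R_trans by meson
    obtain q c where c: "q \<noteq> p" "c \<noteq> x" "R q x c" using ex_off_line p R_in by meson
    have "R q x (\<tau> (\<sigma> c))" using dilatation_R[OF dil c(3)] x by simp
    then have "R q c (\<tau> (\<sigma> c))" using c R_sym R_trans by metis
    then have "\<tau> (\<sigma> c) = c" using dir c R_in R_unique by metis
    then show ?thesis using dilatation_unique[OF dil dilatation_id] x y c R_in by metis
  qed
  then show ?thesis using dil unfolding translation_def by blast
qed

end

locale affine_origin = affine_directions +
  fixes b0 :: 'a
  assumes b0: "b0 \<in> A"
begin

section \<open>The abelian group of affine points\<close>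

definition tr :: "'a \<Rightarrow> 'a \<Rightarrow> 'a" where
  "tr a = (SOME \<tau>. translation \<tau> \<and> \<tau> b0 = a)"

definition vadd :: "'a \<Rightarrow> 'a \<Rightarrow> 'a"  (infixl "+\<^sub>v" 65) where
  "a +\<^sub>v b = tr a b"

lemma tr: "a \<in> A \<Longrightarrow> translation (tr a)" "a \<in> A \<Longrightarrow> tr a b0 = a"
  using someI_ex[OF ex_translation[OF b0, of a]] unfolding tr_def by auto

lemma vadd_closed: "a \<in> A \<Longrightarrow> b \<in> A \<Longrightarrow> a +\<^sub>v b \<in> A"
  using tr translation_closed by (simp add: vadd_def)

lemma vadd_right_zero: "a \<in> A \<Longrightarrow> a +\<^sub>v b0 = a"
  by (simp add: vadd_def tr)

lemma vadd_left_zero: "a \<in> A \<Longrightarrow> b0 +\<^sub>v a = a"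
  unfolding vadd_def using translation_unique[OF tr(1) translation_id b0] tr(2) b0 by metis

lemma vadd_assoc:
  assumes "a \<in> A" "b \<in> A" "c \<in> A"
  shows "a +\<^sub>v b +\<^sub>v c = a +\<^sub>v (b +\<^sub>v c)"
proof -
  have "translation (\<lambda>x. tr a (tr b x))" using assms tr translation_comp by blast
  moreover have "tr (a +\<^sub>v b) b0 = tr a (tr b b0)" using tr assms vadd_closed by (simp add: vadd_def)
  ultimately show ?thesis
    using translation_unique[of "tr (a +\<^sub>v b)" "\<lambda>x. tr a (tr b x)" b0 c] tr assms vadd_closed b0
    by (simp add: vadd_def)
qed

lemma vadd_left_inverse:
  assumes "a \<in> A"
  shows "\<exists>b\<in>A. b +\<^sub>v a = b0"
proof -
  obtain \<sigma> where \<sigma>: "translation \<sigma>" "\<sigma> a = b0" using ex_translation assms b0 by blast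
  have A: "\<sigma> b0 \<in> A" using \<sigma> translation_closed b0 by blast
  then have "tr (\<sigma> b0) a = \<sigma> a" using translation_unique[OF tr(1) \<sigma>(1) b0] tr assms by metis
  then show ?thesis using \<sigma> A unfolding vadd_def by metis
qed

lemma R_vadd_left: "R p x y \<Longrightarrow> c \<in> A \<Longrightarrow> R p (c +\<^sub>v x) (c +\<^sub>v y)"
  unfolding vadd_def using tr translation_R by blast

lemma R_vadd: "R p b0 a \<Longrightarrow> x \<in> A \<Longrightarrow> R p x (a +\<^sub>v x)"
  unfolding vadd_def using translation_direction[of "tr a" p b0 x] tr R_in by metis

text \<open>Both sums are the fourth vertex of the parallelogram with vertices \<open>b0\<close>,
  \<open>a\<close>, \<open>b\<close>.\<close>

lemma vadd_comm_off:
  assumes "R p b0 a" "R q b0 b" "p \<noteq> q"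
  shows "a +\<^sub>v b = b +\<^sub>v a"
proof -
  have A: "a \<in> A" "b \<in> A" using assms R_in by blast+
  have "R p b (a +\<^sub>v b)" "R q a (b +\<^sub>v a)" using R_vadd assms A by blast+
  moreover have "R q a (a +\<^sub>v b)" "R p b (b +\<^sub>v a)"
    using R_vadd_left[OF assms(2) A(1)] R_vadd_left[OF assms(1) A(2)] vadd_right_zero A by auto
  ultimately show ?thesis using R_meet assms(3) by metis
qed

lemma vadd_right_cancel:
  assumes "a \<in> A" "b \<in> A" "c \<in> A" "a +\<^sub>v c = b +\<^sub>v c"
  shows "a = b"
  using translation_unique[of "tr a" "tr b" c b0] assms tr b0 unfolding vadd_def by metis

lemma R_vadd_iff: "R p b0 x \<Longrightarrow> y \<in> A \<Longrightarrow> R p b0 (x +\<^sub>v y) \<longleftrightarrow> R p b0 y"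
  using R_vadd R_sym R_trans by meson

text \<open>For \<open>a\<close> and \<open>b\<close> in the same direction, an auxiliary
  \<open>c\<close> off their line is added: \<open>c\<close> and \<open>b + c\<close> are both in
  directions other than that of \<open>a\<close>, so they commute with \<open>a\<close>.\<close>

lemma vadd_comm:
  assumes "a \<in> A" "b \<in> A"
  shows "a +\<^sub>v b = b +\<^sub>v a"
proof -
  obtain p q where pq: "R p b0 a" "R q b0 b" using assms R_ex b0 by meson
  show ?thesis
  proof (cases "p = q")
    case False
    then show ?thesis using vadd_comm_off pq by blast
  next
    case True
    obtain r c where c: "r \<noteq> p" "R r b0 c" "\<not> R p b0 c"
      using ex_off_line pq b0 R_in by meson
    have A: "c \<in> A" using c R_in by blast
    have "\<not> R p b0 (b +\<^sub>v c)" using R_vadd_iff pq True c A by metis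
    then obtain s where s: "R s b0 (b +\<^sub>v c)" "s \<noteq> p"
      using R_ex b0 vadd_closed A assms by metis
    have "a +\<^sub>v b +\<^sub>v c = a +\<^sub>v (b +\<^sub>v c)" using vadd_assoc assms A by simp
    also have "\<dots> = b +\<^sub>v c +\<^sub>v a" using vadd_comm_off pq s by metis
    also have "\<dots> = b +\<^sub>v (c +\<^sub>v a)" using vadd_assoc assms A by simp
    also have "\<dots> = b +\<^sub>v (a +\<^sub>v c)" using vadd_comm_off pq c by metis
    also have "\<dots> = b +\<^sub>v a +\<^sub>v c" using vadd_assoc assms A by simp
    finally show ?thesis using vadd_right_cancel vadd_closed assms A by blast
  qed
qed

section \<open>Homotheties: the trace-preserving endomorphisms, zero included\<close>

definition homothety :: "('a \<Rightarrow> 'a) \<Rightarrow> bool" where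
  "homothety \<alpha> \<longleftrightarrow> (\<forall>x\<in>A. \<alpha> x \<in> A) \<and> (\<forall>x\<in>A. \<forall>y\<in>A. \<alpha> (x +\<^sub>v y) = \<alpha> x +\<^sub>v \<alpha> y) \<and>
     (\<forall>p x. R p b0 x \<longrightarrow> R p b0 (\<alpha> x))"

text \<open>A dilatation fixing \<open>b0\<close> is additive. For \<open>x\<close> and
  \<open>y\<close> in different directions it preserves the parallelogram they span; for equal
  directions an auxiliary \<open>c\<close> off the line is added and cancelled again, as for
  commutativity.\<close>

lemma ex_homothety:
  assumes "R p b0 a" "R p b0 b" "a \<noteq> b0"
  shows "\<exists>\<alpha>. homothety \<alpha> \<and> \<alpha> a = b"
proof -
  obtain \<alpha> where \<alpha>: "dilatation \<alpha>" "\<alpha> b0 = b0" "\<alpha> a = b"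
  proof (cases "b = b0")
    case True
    then show ?thesis using that dilatation_const b0 by blast
  next
    case False
    then show ?thesis using that ex_dilatation assms by metis
  qed
  have dir: "R q b0 (\<alpha> x)" if "R q b0 x" for q x
    using dilatation_R[OF \<alpha>(1) that] \<alpha>(2) by simp
  have cl: "\<alpha> x \<in> A" if "x \<in> A" for x using dilatation_closed \<alpha>(1) that by blast
  have off: "\<alpha> (x +\<^sub>v y) = \<alpha> x +\<^sub>v \<alpha> y" if xy: "R q b0 x" "R r b0 y" "q \<noteq> r" for q r x y
  proof -
    have A: "x \<in> A" "y \<in> A" using xy R_in by blast+
    have "R q y (x +\<^sub>v y)" "R r x (x +\<^sub>v y)"
      using R_vadd[OF xy(1) A(2)] R_vadd_left[OF xy(2) A(1)] vadd_right_zero A by auto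
    then have "R q (\<alpha> y) (\<alpha> (x +\<^sub>v y))" "R r (\<alpha> x) (\<alpha> (x +\<^sub>v y))"
      using dilatation_R \<alpha>(1) by blast+
    moreover have "R q (\<alpha> y) (\<alpha> x +\<^sub>v \<alpha> y)" "R r (\<alpha> x) (\<alpha> x +\<^sub>v \<alpha> y)"
      using R_vadd[OF dir[OF xy(1)]] R_vadd_left[OF dir[OF xy(2)]] vadd_right_zero cl A by metis+
    ultimately show ?thesis using R_meet xy(3) by metis
  qed
  have add: "\<alpha> (x +\<^sub>v y) = \<alpha> x +\<^sub>v \<alpha> y" if A: "x \<in> A" "y \<in> A" for x y
  proof -
    obtain q r where qr: "R q b0 x" "R r b0 y" using A R_ex b0 by meson
    show ?thesis
    proof (cases "q = r")
      case False
      then show ?thesis using off qr by blast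
    next
      case True
      obtain s c where c: "s \<noteq> q" "R s b0 c" "\<not> R q b0 c"
        using ex_off_line qr b0 R_in by meson
      have Ac: "c \<in> A" using c R_in by blast
      have "\<not> R q b0 (y +\<^sub>v c)" using R_vadd_iff qr True c Ac by metis
      then obtain t where t: "R t b0 (y +\<^sub>v c)" "t \<noteq> q"
        using R_ex b0 vadd_closed A Ac by metis
      have xy: "R q b0 (x +\<^sub>v y)" using R_vadd_iff qr True A by metis
      have "\<alpha> (x +\<^sub>v y) +\<^sub>v \<alpha> c = \<alpha> (x +\<^sub>v y +\<^sub>v c)" using off[OF xy c(2)] c(1) by metis
      also have "\<dots> = \<alpha> (x +\<^sub>v (y +\<^sub>v c))" using vadd_assoc A Ac by simp
      also have "\<dots> = \<alpha> x +\<^sub>v \<alpha> (y +\<^sub>v c)" using off[OF qr(1) t(1)] t(2) by metis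
      also have "\<dots> = \<alpha> x +\<^sub>v (\<alpha> y +\<^sub>v \<alpha> c)" using off[OF qr(2) c(2)] c(1) True by metis
      also have "\<dots> = \<alpha> x +\<^sub>v \<alpha> y +\<^sub>v \<alpha> c" using vadd_assoc cl A Ac by simp
      finally show ?thesis
        using vadd_right_cancel[OF _ _ cl[OF Ac]] vadd_closed[OF A] vadd_closed cl A by metis
    qed
  qed
  have "homothety \<alpha>"
    unfolding homothety_def by (intro conjI ballI allI impI dir cl add)
  then show ?thesis using \<alpha>(3) by blast
qed

lemma homothety_closed: "homothety \<alpha> \<Longrightarrow> x \<in> A \<Longrightarrow> \<alpha> x \<in> A"
  by (simp add: homothety_def)

lemma homothety_vadd: "homothety \<alpha> \<Longrightarrow> x \<in> A \<Longrightarrow> y \<in> A \<Longrightarrow> \<alpha> (x +\<^sub>v y) = \<alpha> x +\<^sub>v \<alpha> y"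
  by (simp add: homothety_def)

lemma homothety_R: "homothety \<alpha> \<Longrightarrow> R p b0 x \<Longrightarrow> R p b0 (\<alpha> x)"
  by (simp add: homothety_def)

lemma homothety_zero: "homothety \<alpha> \<Longrightarrow> \<alpha> b0 = b0"
  using homothety_vadd[of \<alpha> b0 b0] vadd_left_zero b0 homothety_closed vadd_right_cancel by metis

lemma homothety_id: "homothety (\<lambda>x. x)"
  by (simp add: homothety_def)

lemma homothety_comp: "homothety \<alpha> \<Longrightarrow> homothety \<beta> \<Longrightarrow> homothety (\<lambda>x. \<alpha> (\<beta> x))"
  by (simp add: homothety_def)

lemma homothety_add:
  assumes \<alpha>: "homothety \<alpha>" and \<beta>: "homothety \<beta>"
  shows "homothety (\<lambda>x. \<alpha> x +\<^sub>v \<beta> x)"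
  unfolding homothety_def
proof (intro conjI ballI allI impI)
  fix x y assume A: "x \<in> A" "y \<in> A"
  then have c: "\<alpha> x \<in> A" "\<alpha> y \<in> A" "\<beta> x \<in> A" "\<beta> y \<in> A" using \<alpha> \<beta> homothety_closed by blast+
  have "\<alpha> x +\<^sub>v \<alpha> y +\<^sub>v (\<beta> x +\<^sub>v \<beta> y) = \<alpha> x +\<^sub>v (\<alpha> y +\<^sub>v \<beta> x +\<^sub>v \<beta> y)"
    using c vadd_assoc vadd_closed by metis
  also have "\<dots> = \<alpha> x +\<^sub>v (\<beta> x +\<^sub>v \<alpha> y +\<^sub>v \<beta> y)" using c vadd_comm by simp
  also have "\<dots> = \<alpha> x +\<^sub>v \<beta> x +\<^sub>v (\<alpha> y +\<^sub>v \<beta> y)" using c vadd_assoc vadd_closed by metis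
  finally show "\<alpha> (x +\<^sub>v y) +\<^sub>v \<beta> (x +\<^sub>v y) = \<alpha> x +\<^sub>v \<beta> x +\<^sub>v (\<alpha> y +\<^sub>v \<beta> y)"
    using homothety_vadd \<alpha> \<beta> A by simp
next
  fix p x assume "R p b0 x"
  then have "R p b0 (\<alpha> x)" "R p b0 (\<beta> x)" using \<alpha> \<beta> homothety_R by blast+
  then show "R p b0 (\<alpha> x +\<^sub>v \<beta> x)" using R_vadd_iff R_in by blast
qed (use \<alpha> \<beta> homothety_closed vadd_closed in blast)

text \<open>The value at \<open>v\<close> determines the value at any \<open>y\<close> off the line
  \<open>b0 v\<close>: the image of \<open>v + y\<close> is on the line of direction
  \<open>s\<close> through \<open>b0\<close> and on the line of direction \<open>q\<close> through
  \<open>\<alpha> v\<close>. Points on the line \<open>b0 a\<close> are reached through an auxiliary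
  \<open>c\<close>.\<close>

lemma homothety_unique:
  assumes \<alpha>: "homothety \<alpha>" and \<beta>: "homothety \<beta>" and a: "a \<in> A" "a \<noteq> b0" "\<alpha> a = \<beta> a" and x: "x \<in> A"
  shows "\<alpha> x = \<beta> x"
proof -
  have off: "\<alpha> y = \<beta> y" if R: "R p b0 v" "R q b0 y" "\<not> R q b0 v" and v: "\<alpha> v = \<beta> v" for p q v y
  proof -
    have A: "v \<in> A" "y \<in> A" using R R_in by blast+
    note c = A[THEN homothety_closed[OF \<alpha>]] A[THEN homothety_closed[OF \<beta>]]
    obtain s where s: "R s b0 (v +\<^sub>v y)" using R_ex b0 A vadd_closed by blast
    have "s \<noteq> q" using s R A R_vadd_iff[of q y v] vadd_comm by metis
    moreover have "R s b0 (\<alpha> v +\<^sub>v \<alpha> y)" "R s b0 (\<alpha> v +\<^sub>v \<beta> y)"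
      using homothety_R[OF \<alpha> s] homothety_R[OF \<beta> s] homothety_vadd[OF \<alpha> A] homothety_vadd[OF \<beta> A] v
      by metis+
    moreover have "R q (\<alpha> v) (\<alpha> v +\<^sub>v \<alpha> y)" "R q (\<alpha> v) (\<alpha> v +\<^sub>v \<beta> y)"
      using R_vadd_left[OF homothety_R[OF \<alpha> R(2)] c(1)] R_vadd_left[OF homothety_R[OF \<beta> R(2)] c(1)]
        vadd_right_zero c by simp_all
    ultimately have "\<alpha> v +\<^sub>v \<alpha> y = \<alpha> v +\<^sub>v \<beta> y" using R_meet by metis
    then show ?thesis using c vadd_comm vadd_right_cancel by metis
  qed
  obtain p q where pq: "R p b0 a" "R q b0 x" using a x R_ex b0 by meson
  show ?thesis
  proof (cases "x = b0 \<or> p \<noteq> q")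
    case True
    then show ?thesis
      using off[of p a q x] pq a \<alpha> \<beta> homothety_zero R_unique by metis
  next
    case False
    obtain r c where c: "r \<noteq> p" "c \<noteq> b0" "R r b0 c" using ex_off_line pq b0 R_in by meson
    have "\<alpha> c = \<beta> c" using off[of p a r c] pq c a R_unique by metis
    then show ?thesis using off[of r c q x] pq c False R_unique by metis
  qed
qed

end

section \<open>Coordinates\<close>

text \<open>
  A scalar is represented by the image of \<open>u\<close> under the corresponding homothety, so that the carrier of
  the sfield is the affine line through \<open>b0\<close> and \<open>u\<close>.
\<close>

locale affine_coordinates = affine_origin +
  fixes k0 u
  assumes u: "R k0 b0 u" "u \<noteq> b0"
begin

definition scalar :: "'a \<Rightarrow> 'a \<Rightarrow> 'a" where
  "scalar a = (SOME \<alpha>. homothety \<alpha> \<and> \<alpha> u = a)"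

definition K :: "'a ring" where
  "K = \<lparr>carrier = {a. R k0 b0 a}, monoid.mult = scalar, one = u, zero = b0, add = vadd\<rparr>"

definition V :: "('a, 'a) module" where
  "V = \<lparr>carrier = A, monoid.mult = scalar, one = u, zero = b0, add = vadd, smult = scalar\<rparr>"

lemma K_simps [simp]:
  "carrier K = {a. R k0 b0 a}" "a \<otimes>\<^bsub>K\<^esub> b = scalar a b" "\<one>\<^bsub>K\<^esub> = u" "\<zero>\<^bsub>K\<^esub> = b0" "a \<oplus>\<^bsub>K\<^esub> b = a +\<^sub>v b"
  by (simp_all add: K_def)

lemma V_simps [simp]:
  "carrier V = A" "\<zero>\<^bsub>V\<^esub> = b0" "a \<oplus>\<^bsub>V\<^esub> b = a +\<^sub>v b" "a \<odot>\<^bsub>V\<^esub> b = scalar a b"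
  by (simp_all add: V_def)

lemma uA: "u \<in> A"
  using u R_in by blast

lemma K_in_A: "R k0 b0 a \<Longrightarrow> a \<in> A"
  using R_in by blast

lemma scalar: "R k0 b0 a \<Longrightarrow> homothety (scalar a)" "R k0 b0 a \<Longrightarrow> scalar a u = a"
  using someI_ex[OF ex_homothety[of k0 u a]] u unfolding scalar_def by auto

lemma scalar_closed: "R k0 b0 a \<Longrightarrow> x \<in> A \<Longrightarrow> scalar a x \<in> A"
  using scalar homothety_closed by blast

text \<open>Identities between scalars reduce to comparing two homotheties at the single point
  \<open>u\<close>.\<close>

lemma scalar_eqI:
  assumes "R k0 b0 a" "homothety \<alpha>" "\<alpha> u = a" "x \<in> A"
  shows "scalar a x = \<alpha> x"
  using homothety_unique[OF scalar(1) assms(2) uA] assms u scalar(2) by simp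

lemma scalar_scalar:
  assumes "R k0 b0 a" "R k0 b0 b" "x \<in> A"
  shows "scalar (scalar a b) x = scalar a (scalar b x)"
  using scalar_eqI[of "scalar a b" "\<lambda>x. scalar a (scalar b x)" x] homothety_comp scalar homothety_R assms
  by simp

lemma scalar_vadd_left:
  assumes "R k0 b0 a" "R k0 b0 b" "x \<in> A"
  shows "scalar (a +\<^sub>v b) x = scalar a x +\<^sub>v scalar b x"
  using scalar_eqI[OF _ homothety_add[OF scalar(1) scalar(1)], of "a +\<^sub>v b" a b x]
    scalar(2) R_vadd_iff K_in_A assms by simp

lemma scalar_one: "x \<in> A \<Longrightarrow> scalar u x = x"
  using scalar_eqI[of u "\<lambda>x. x" x] homothety_id u by simp

lemma scalar_vadd_right: "R k0 b0 a \<Longrightarrow> x \<in> A \<Longrightarrow> y \<in> A \<Longrightarrow> scalar a (x +\<^sub>v y) = scalar a x +\<^sub>v scalar a y"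
  using scalar homothety_vadd by blast

lemma scalar_R: "R k0 b0 a \<Longrightarrow> R p b0 x \<Longrightarrow> R p b0 (scalar a x)"
  using scalar homothety_R by blast

lemma ex_scalar:
  assumes "R p b0 x" "x \<noteq> b0" "R p b0 y"
  shows "\<exists>a\<in>carrier K. scalar a x = y"
proof -
  obtain \<alpha> where \<alpha>: "homothety \<alpha>" "\<alpha> x = y" using ex_homothety assms by blast
  then have "R k0 b0 (\<alpha> u)" using homothety_R u by blast
  then show ?thesis using scalar_eqI[of "\<alpha> u" \<alpha> x] \<alpha> assms R_in by auto
qed

lemma abelian_group_V: "abelian_group V"
  by (rule abelian_groupI)
    (use vadd_closed b0 vadd_assoc vadd_comm vadd_left_zero vadd_left_inverse in auto)

lemma ring_K: "ring K"
proof (rule ringI)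
  show "abelian_group K"
  proof (rule abelian_groupI)
    fix x assume x: "x \<in> carrier K"
    then obtain y where y: "y \<in> A" "y +\<^sub>v x = b0" using vadd_left_inverse[of x] K_in_A[of x] by auto
    then have "R k0 b0 y" using x R_vadd_iff[of k0 x y] vadd_comm R_in R_refl by simp
    then show "\<exists>y\<in>carrier K. y \<oplus>\<^bsub>K\<^esub> x = \<zero>\<^bsub>K\<^esub>" using y by auto
  next
    show "\<zero>\<^bsub>K\<^esub> \<in> carrier K" using u R_refl R_in by auto
  qed (auto simp: vadd_assoc vadd_left_zero R_vadd_iff K_in_A intro: vadd_comm)
  show "Group.monoid K"
    by (rule monoidI) (use u scalar_scalar scalar_one scalar K_in_A scalar_R in auto)
qed (use scalar_vadd_left scalar_vadd_right K_in_A in auto)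

lemma sfield_K: "sfield K"
proof -
  interpret K: ring K by (rule ring_K)
  show ?thesis
  proof
    show "\<one>\<^bsub>K\<^esub> \<noteq> \<zero>\<^bsub>K\<^esub>" using u by simp
    have inv: "\<exists>b\<in>carrier K. b \<noteq> \<zero>\<^bsub>K\<^esub> \<and> b \<otimes>\<^bsub>K\<^esub> a = \<one>\<^bsub>K\<^esub>" if a: "a \<in> carrier K" "a \<noteq> \<zero>\<^bsub>K\<^esub>" for a
    proof -
      obtain b where b: "b \<in> carrier K" "scalar b a = u" using ex_scalar[of k0 a u] a u by auto
      then have "b \<noteq> \<zero>\<^bsub>K\<^esub>" using K.l_null[OF a(1)] u by auto
      then show ?thesis using b by auto
    qed
    show "Units K = carrier K - {\<zero>\<^bsub>K\<^esub>}"
    proof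
      show "Units K \<subseteq> carrier K - {\<zero>\<^bsub>K\<^esub>}"
        using K.Units_r_inv K.l_null K.Units_closed K.Units_inv_closed u by force
      show "carrier K - {\<zero>\<^bsub>K\<^esub>} \<subseteq> Units K"
      proof
        fix a assume a: "a \<in> carrier K - {\<zero>\<^bsub>K\<^esub>}"
        then obtain b where b: "b \<in> carrier K" "b \<noteq> \<zero>\<^bsub>K\<^esub>" "b \<otimes>\<^bsub>K\<^esub> a = \<one>\<^bsub>K\<^esub>" using inv by blast
        \<comment> \<open>The left inverse \<open>c\<close> of the left inverse \<open>b\<close>
          turns out to be \<open>a\<close>, which makes \<open>b\<close> a two-sided
          inverse.\<close>
        then obtain c where c: "c \<in> carrier K" "c \<otimes>\<^bsub>K\<^esub> b = \<one>\<^bsub>K\<^esub>" using inv by blast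
        have "c = c \<otimes>\<^bsub>K\<^esub> (b \<otimes>\<^bsub>K\<^esub> a)" using b(3) c by (simp only: K.r_one)
        also have "\<dots> = a" using a b(1) c by (simp only: K.m_assoc[symmetric] Diff_iff K.l_one)
        finally show "a \<in> Units K" using a b c unfolding Units_def by blast
      qed
    qed
  qed
qed

lemma left_linear_space_V: "left_linear_space K V"
  by (intro left_linear_space.intro left_linear_space_axioms.intro sfield_K abelian_group_V)
    (use scalar_closed scalar_vadd_left scalar_vadd_right scalar_scalar scalar_one K_in_A in auto)

end

section \<open>The Hermitian form of a polarity\<close>

context sfield begin

text \<open>In \<open>hermitian_space\<close> the original names refer to the vector space instead of \<open>K\<close>.\<close>

lemmas scalar_add_inv_closed = add.inv_closed
  and scalar_add_inv_eq_1_iff = add.inv_eq_1_iff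
  and scalar_minus_eq = minus_eq
  and scalar_minus_equality = minus_equality
  and scalar_minus_minus = minus_minus
  and scalar_r_neg = r_neg

lemma nonzero_inv:
  assumes "a \<in> carrier K" "a \<noteq> \<zero>"
  shows "inv a \<in> carrier K" "inv a \<noteq> \<zero>" "inv a \<otimes> a = \<one>" "a \<otimes> inv a = \<one>" "inv (inv a) = a"
proof -
  have U: "a \<in> Units K" using assms nonzero_Units by blast
  then show "inv a \<in> carrier K" "inv a \<otimes> a = \<one>" "a \<otimes> inv a = \<one>" "inv (inv a) = a" by simp_all
  show "inv a \<noteq> \<zero>" using Units_inv_Units[OF U] nonzero_Units by blast
qed

lemma left_cancel:
  assumes "c \<in> carrier K" "c \<noteq> \<zero>" "a \<in> carrier K" "b \<in> carrier K" "c \<otimes> a = c \<otimes> b"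
  shows "a = b"
  using assms nonzero_inv[of c] m_assoc[of "inv c" c] by (metis l_one)

lemma inv_mult:
  assumes "a \<in> carrier K" "a \<noteq> \<zero>" "b \<in> carrier K" "b \<noteq> \<zero>"
  shows "inv (a \<otimes> b) = inv b \<otimes> inv a"
proof -
  note i = nonzero_inv[OF assms(1,2)] nonzero_inv[OF assms(3,4)]
  have ne: "a \<otimes> b \<noteq> \<zero>" using left_cancel[of a b \<zero>] assms by auto
  have "(a \<otimes> b) \<otimes> (inv b \<otimes> inv a) = a \<otimes> (b \<otimes> inv b) \<otimes> inv a" using assms i(1,6) by (simp add: m_assoc)
  also have "\<dots> = (a \<otimes> b) \<otimes> inv (a \<otimes> b)" using assms i nonzero_inv[OF _ ne] by simp
  finally show ?thesis using left_cancel[OF _ ne] nonzero_inv[OF _ ne] assms i by (metis m_closed)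
qed

lemma no_zero_divisors:
  assumes "a \<in> carrier K" "b \<in> carrier K" "a \<otimes> b = \<zero>"
  shows "a = \<zero> \<or> b = \<zero>"
  using assms left_cancel[of a b \<zero>] by auto

end

context left_linear_space begin

abbreviation vplus (infixl "\<^bold>+" 65) where "u \<^bold>+ v \<equiv> u \<oplus>\<^bsub>H\<^esub> v"
abbreviation vminus (infixl "\<^bold>-" 65) where "u \<^bold>- v \<equiv> u \<ominus>\<^bsub>H\<^esub> v"
abbreviation vscale (infixr "\<^bold>*" 70) where "a \<^bold>* v \<equiv> a \<odot>\<^bsub>H\<^esub> v"
abbreviation vzero ("\<^bold>0") where "\<^bold>0 \<equiv> \<zero>\<^bsub>H\<^esub>"

lemma smult_zero_left: "v \<in> carrier H \<Longrightarrow> \<zero> \<^bold>* v = \<^bold>0"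
proof -
  assume v: "v \<in> carrier H"
  then have "\<zero> \<^bold>* v \<^bold>+ \<zero> \<^bold>* v = \<zero> \<^bold>* v"
    using smult_l_distr[of \<zero> \<zero> v] by simp
  then show ?thesis using H.add.r_cancel_one[of "\<zero> \<^bold>* v" "\<zero> \<^bold>* v"] v smult_closed by simp
qed

lemma smult_zero_right: "a \<in> carrier K \<Longrightarrow> a \<^bold>* \<^bold>0 = \<^bold>0"
proof -
  assume a: "a \<in> carrier K"
  then have "a \<^bold>* \<^bold>0 \<^bold>+ a \<^bold>* \<^bold>0 = a \<^bold>* \<^bold>0"
    using smult_r_distr[of a "\<^bold>0" "\<^bold>0"] by simp
  then show ?thesis using H.add.r_cancel_one[of "a \<^bold>* \<^bold>0" "a \<^bold>* \<^bold>0"] a smult_closed by simp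
qed

lemma smult_minus_left: "a \<in> carrier K \<Longrightarrow> v \<in> carrier H \<Longrightarrow> (\<ominus> a) \<^bold>* v = \<ominus>\<^bsub>H\<^esub> (a \<^bold>* v)"
proof -
  assume a: "a \<in> carrier K" and v: "v \<in> carrier H"
  have "(\<ominus> a) \<^bold>* v \<^bold>+ a \<^bold>* v = \<^bold>0"
    using smult_l_distr[of "\<ominus> a" a v] a v by (simp add: K.l_neg smult_zero_left)
  then show ?thesis using H.minus_equality a v smult_closed by simp
qed

lemma smult_minus_one: "v \<in> carrier H \<Longrightarrow> (\<ominus> \<one>) \<^bold>* v = \<ominus>\<^bsub>H\<^esub> v"
  by (simp add: smult_minus_left smult_one)

lemma smult_inv_cancel:
  "a \<in> carrier K \<Longrightarrow> a \<noteq> \<zero> \<Longrightarrow> v \<in> carrier H \<Longrightarrow> inv a \<^bold>* (a \<^bold>* v) = v"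
  using smult_assoc1[of "inv a" a v] nonzero_inv[of a] smult_one by simp

lemma smult_eq_zero: "a \<in> carrier K \<Longrightarrow> v \<in> carrier H \<Longrightarrow> a \<^bold>* v = \<^bold>0 \<Longrightarrow> a = \<zero> \<or> v = \<^bold>0"
  using smult_inv_cancel[of a v] smult_zero_right nonzero_inv[of a] by auto

end

text \<open>
  The points of \<open>P(V \<oplus> K)\<close> are the affine points \<open>aff v = [(v, 1)]\<close> and the points at infinity
  \<open>dir v = [(v, 0)]\<close>, and \<open>aff 0\<close> is the pole of the hyperplane at infinity.
\<close>

locale polar_space = left_linear_space K H
  for K (structure) and H :: "('k, 'h, 'm) module_scheme" (structure) +
  fixes orth :: "'p \<Rightarrow> 'p \<Rightarrow> bool" (infix "\<perp>" 50) and aff :: "'h \<Rightarrow> 'p" and dir :: "'h \<Rightarrow> 'p"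
  assumes osym: "p \<perp> q \<Longrightarrow> q \<perp> p"
    and oirrefl: "\<not> p \<perp> p"
    and orth_aff_dir: "\<lbrakk>x \<in> carrier H; y \<in> carrier H; y \<noteq> \<zero>\<^bsub>H\<^esub>; q \<perp> aff x; q \<perp> dir y\<rbrakk>
       \<Longrightarrow> q \<perp> aff (x \<oplus>\<^bsub>H\<^esub> y)"
    and orth_dir_dir: "\<lbrakk>x \<in> carrier H; y \<in> carrier H; x \<noteq> \<zero>\<^bsub>H\<^esub>; y \<noteq> \<zero>\<^bsub>H\<^esub>; x \<oplus>\<^bsub>H\<^esub> y \<noteq> \<zero>\<^bsub>H\<^esub>;
        q \<perp> dir x; q \<perp> dir y\<rbrakk> \<Longrightarrow> q \<perp> dir (x \<oplus>\<^bsub>H\<^esub> y)"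
    and orth_aff_aff: "\<lbrakk>x \<in> carrier H; y \<in> carrier H; x \<noteq> y; q \<perp> aff x; q \<perp> aff y\<rbrakk>
       \<Longrightarrow> q \<perp> dir (x \<ominus>\<^bsub>H\<^esub> y)"
    and dir_smult: "\<lbrakk>c \<in> carrier K; c \<noteq> \<zero>; x \<in> carrier H; x \<noteq> \<zero>\<^bsub>H\<^esub>\<rbrakk> \<Longrightarrow> dir (c \<odot>\<^bsub>H\<^esub> x) = dir x"
    and dir_eqD: "\<lbrakk>x \<in> carrier H; x \<noteq> \<zero>\<^bsub>H\<^esub>; y \<in> carrier H; y \<noteq> \<zero>\<^bsub>H\<^esub>; dir x = dir y\<rbrakk>
       \<Longrightarrow> \<exists>c\<in>carrier K. y = c \<odot>\<^bsub>H\<^esub> x"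
    and origin_dir: "\<lbrakk>x \<in> carrier H; x \<noteq> \<zero>\<^bsub>H\<^esub>\<rbrakk> \<Longrightarrow> aff \<zero>\<^bsub>H\<^esub> \<perp> dir x"
    and origin_aff: "x \<in> carrier H \<Longrightarrow> \<not> aff \<zero>\<^bsub>H\<^esub> \<perp> aff x"
    and line_meets: "\<lbrakk>x \<in> carrier H; x \<noteq> \<zero>\<^bsub>H\<^esub>; v \<in> carrier H; \<not> dir x \<perp> aff v\<rbrakk>
       \<Longrightarrow> \<exists>c\<in>carrier K. aff (c \<odot>\<^bsub>H\<^esub> x) \<perp> aff v"
    and dir_separate: "\<lbrakk>x \<in> carrier H; x \<noteq> \<zero>\<^bsub>H\<^esub>; y \<in> carrier H; y \<noteq> \<zero>\<^bsub>H\<^esub>; dir x \<noteq> dir y\<rbrakk>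
       \<Longrightarrow> \<exists>k\<in>carrier H. k \<noteq> \<zero>\<^bsub>H\<^esub> \<and> dir k \<perp> dir x \<and> \<not> dir k \<perp> dir y"
    and ex_other_dir: "\<lbrakk>x \<in> carrier H\<rbrakk> \<Longrightarrow> \<exists>y\<in>carrier H. y \<noteq> \<zero>\<^bsub>H\<^esub> \<and> dir y \<noteq> dir x"
begin

section \<open>The functionals \<open>B\<close>: linearity in the first argument\<close>

lemma dir_orth_origin: "x \<in> carrier H \<Longrightarrow> x \<noteq> \<^bold>0 \<Longrightarrow> dir x \<perp> aff \<^bold>0"
  using origin_dir osym by blast

text \<open>Otherwise the polar of \<open>aff v\<close> contains the whole line through
  \<open>aff x\<close> and \<open>dir x\<close>, and with it the origin.\<close>

lemma aff_orth_not_dir: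
  assumes "x \<in> carrier H" "x \<noteq> \<^bold>0" "v \<in> carrier H" "aff x \<perp> aff v"
  shows "\<not> dir x \<perp> aff v"
proof
  assume d: "dir x \<perp> aff v"
  have "dir (\<ominus>\<^bsub>H\<^esub> x) = dir x"
    using dir_smult[of "\<ominus> \<one>" x] assms smult_minus_one
    by (metis H.add.inv_eq_1_iff K.add.inv_closed K.one_closed smult_zero_left)
  then have "aff v \<perp> aff (x \<^bold>+ \<ominus>\<^bsub>H\<^esub> x)"
    using orth_aff_dir[of x "\<ominus>\<^bsub>H\<^esub> x" "aff v"] assms d osym H.add.inv_eq_1_iff by simp
  then show False using origin_aff assms osym by (metis H.r_neg)
qed

text \<open>Two different affine points of this line in the polar of \<open>aff v\<close> would pull
  the point at infinity \<open>dir x\<close> into the polar.\<close>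

lemma aff_orth_unique:
  assumes "x \<in> carrier H" "x \<noteq> \<^bold>0" "v \<in> carrier H" "c \<in> carrier K" "d \<in> carrier K"
    and "aff (c \<^bold>* x) \<perp> aff v" "aff (d \<^bold>* x) \<perp> aff v"
  shows "c = d"
proof (rule ccontr)
  assume ne: "c \<noteq> d"
  have c0: "c \<noteq> \<zero>" using assms origin_aff smult_zero_left by metis
  have e: "c \<^bold>* x \<^bold>- d \<^bold>* x = (c \<ominus> d) \<^bold>* x"
    using assms by (simp add: K.minus_eq H.minus_eq smult_l_distr smult_minus_left)
  have cd: "c \<ominus> d \<noteq> \<zero>" using ne assms K.minus_equality[of c "\<ominus> d"] by (auto simp: K.minus_eq)
  then have nz: "(c \<ominus> d) \<^bold>* x \<noteq> \<^bold>0" using smult_eq_zero assms by (metis K.minus_closed)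
  then have "c \<^bold>* x \<noteq> d \<^bold>* x"
    using e assms H.r_neg smult_closed by (metis H.minus_eq)
  then have "aff v \<perp> dir ((c \<ominus> d) \<^bold>* x)"
    using orth_aff_aff[of "c \<^bold>* x" "d \<^bold>* x" "aff v"] e assms osym smult_closed by metis
  then have "dir (c \<^bold>* x) \<perp> aff v" using dir_smult cd c0 assms osym by (metis K.minus_closed)
  then show False
    using aff_orth_not_dir[of "c \<^bold>* x" v] assms smult_closed smult_eq_zero c0 by metis
qed

text \<open>
  The polar of \<open>[(v, 1)]\<close> does not contain \<open>[(0, 1)]\<close>, hence meets the line through \<open>[(0, 1)]\<close> and
  \<open>[(x, 0)]\<close> in a single point \<open>[(x, - B x v)]\<close>.
\<close>

definition B :: "'h \<Rightarrow> 'h \<Rightarrow> 'k" where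
  "B x v = (if x = \<^bold>0 \<or> dir x \<perp> aff v then \<zero>
     else \<ominus> (inv (SOME c. c \<in> carrier K \<and> aff (c \<^bold>* x) \<perp> aff v)))"

lemma B_zero_left: "B \<^bold>0 v = \<zero>"
  by (simp add: B_def)

lemma B_of_aff:
  assumes "x \<in> carrier H" "v \<in> carrier H" "c \<in> carrier K" "x \<noteq> \<^bold>0" "aff (c \<^bold>* x) \<perp> aff v"
  shows "c \<noteq> \<zero>" "B x v = \<ominus> (inv c)" "\<not> dir x \<perp> aff v"
proof -
  show c0: "c \<noteq> \<zero>" using assms origin_aff smult_zero_left by metis
  have cx: "c \<^bold>* x \<noteq> \<^bold>0" using assms c0 smult_eq_zero by blast
  then show nd: "\<not> dir x \<perp> aff v"
    using aff_orth_not_dir[of "c \<^bold>* x" v] dir_smult[of c x] assms c0 smult_closed by simp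
  have "(SOME c. c \<in> carrier K \<and> aff (c \<^bold>* x) \<perp> aff v) = c"
    using assms aff_orth_unique by (intro some_equality) blast+
  then show "B x v = \<ominus> (inv c)" using nd assms by (simp add: B_def)
qed

lemma B_nonzero_ex:
  assumes "x \<in> carrier H" "v \<in> carrier H" "x \<noteq> \<^bold>0" "\<not> dir x \<perp> aff v"
  obtains c where "c \<in> carrier K" "c \<noteq> \<zero>" "aff (c \<^bold>* x) \<perp> aff v" "B x v = \<ominus> (inv c)"
  using line_meets[of x v] B_of_aff assms by metis

lemma B_closed [simp]: "x \<in> carrier H \<Longrightarrow> v \<in> carrier H \<Longrightarrow> B x v \<in> carrier K"
  using B_nonzero_ex[of x v] nonzero_inv K.zero_closed K.add.inv_closed B_def by metis

lemma B_zero_iff: "x \<in> carrier H \<Longrightarrow> v \<in> carrier H \<Longrightarrow> B x v = \<zero> \<longleftrightarrow> x = \<^bold>0 \<or> dir x \<perp> aff v"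
proof (cases "x = \<^bold>0 \<or> dir x \<perp> aff v")
  case False
  assume "x \<in> carrier H" "v \<in> carrier H"
  then obtain c where "c \<in> carrier K" "c \<noteq> \<zero>" "B x v = \<ominus> (inv c)" using B_nonzero_ex False by metis
  then show ?thesis using False nonzero_inv[of c] K.add.inv_eq_1_iff by simp
qed (simp add: B_def)

text \<open>The value -1 is the normalization under which \<open>B x v \<oplus> \<one>\<close>
  vanishes exactly for orthogonal affine points; the sum becomes the form on the vectors
  \<open>(x, 1)\<close> and \<open>(v, 1)\<close>.\<close>

lemma B_minus_one_iff:
  assumes x: "x \<in> carrier H" and v: "v \<in> carrier H"
  shows "B x v = \<ominus> \<one> \<longleftrightarrow> aff x \<perp> aff v"
proof
  assume l: "B x v = \<ominus> \<one>"
  then have "B x v \<noteq> \<zero>" using K.add.inv_eq_1_iff one_not_zero by simp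
  then obtain c where c: "c \<in> carrier K" "c \<noteq> \<zero>" "aff (c \<^bold>* x) \<perp> aff v" "B x v = \<ominus> (inv c)"
    using B_nonzero_ex B_zero_iff x v by metis
  then have "inv c = \<one>" using l nonzero_inv[of c] by (metis K.minus_minus K.one_closed)
  then have "c = \<one>" using nonzero_inv[OF c(1,2)] c by (metis K.l_one)
  then show "aff x \<perp> aff v" using c x smult_one by simp
next
  assume o: "aff x \<perp> aff v"
  then have "x \<noteq> \<^bold>0" using origin_aff v by blast
  then show "B x v = \<ominus> \<one>" using B_of_aff[of x v \<one>] o x v smult_one by simp
qed

lemma B_smult:
  assumes "a \<in> carrier K" "x \<in> carrier H" "v \<in> carrier H"
  shows "B (a \<^bold>* x) v = a \<otimes> B x v"
proof (cases "a = \<zero> \<or> x = \<^bold>0 \<or> dir x \<perp> aff v")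
  case True
  then show ?thesis
  proof (elim disjE)
    assume "a = \<zero>" then show ?thesis using assms smult_zero_left B_zero_left by simp
  next
    assume "x = \<^bold>0" then show ?thesis using assms smult_zero_right B_zero_left by simp
  next
    assume "dir x \<perp> aff v"
    then have "B x v = \<zero>" "B (a \<^bold>* x) v = \<zero>"
      using B_zero_iff[of x v] B_zero_iff[of "a \<^bold>* x" v] dir_smult[of a x] smult_closed assms
        smult_zero_left smult_zero_right by metis+
    then show ?thesis using assms by simp
  qed
next
  case False
  then obtain c where c: "c \<in> carrier K" "c \<noteq> \<zero>" "aff (c \<^bold>* x) \<perp> aff v" "B x v = \<ominus> (inv c)"
    using B_nonzero_ex assms by metis
  have a: "a \<noteq> \<zero>" "inv a \<in> carrier K" "inv a \<noteq> \<zero>" "inv (inv a) = a"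
    using False nonzero_inv assms by blast+
  have ca: "c \<otimes> inv a \<in> carrier K" using c a by simp
  have "(c \<otimes> inv a) \<^bold>* (a \<^bold>* x) = c \<^bold>* x"
    using smult_assoc1[of c "inv a" "a \<^bold>* x"] smult_inv_cancel[of a x] a c assms smult_closed by simp
  moreover have "a \<^bold>* x \<noteq> \<^bold>0" using False smult_eq_zero assms by blast
  ultimately have "B (a \<^bold>* x) v = \<ominus> (inv (c \<otimes> inv a))"
    using B_of_aff[OF _ assms(3) ca] smult_closed assms c(3) by simp
  also have "inv (c \<otimes> inv a) = a \<otimes> inv c" using inv_mult[of c "inv a"] a c by simp
  also have "\<ominus> (a \<otimes> inv c) = a \<otimes> B x v" using c assms nonzero_inv by (simp add: K.r_minus)
  finally show ?thesis .
qed

lemma B_minus_left: "x \<in> carrier H \<Longrightarrow> v \<in> carrier H \<Longrightarrow> B (\<ominus>\<^bsub>H\<^esub> x) v = \<ominus> B x v"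
  using B_smult[of "\<ominus> \<one>" x v] smult_minus_one by (simp add: K.l_minus)

lemma B_normalize:
  assumes "x \<in> carrier H" "v \<in> carrier H" "B x v \<noteq> \<zero>"
  shows "\<ominus> (inv (B x v)) \<in> carrier K" "\<ominus> (inv (B x v)) \<noteq> \<zero>" "B ((\<ominus> (inv (B x v))) \<^bold>* x) v = \<ominus> \<one>"
    "aff ((\<ominus> (inv (B x v))) \<^bold>* x) \<perp> aff v"
proof -
  note i = nonzero_inv[OF B_closed[OF assms(1,2)] assms(3)]
  show c: "\<ominus> (inv (B x v)) \<in> carrier K" using i by simp
  show "\<ominus> (inv (B x v)) \<noteq> \<zero>" using i K.add.inv_eq_1_iff by simp
  show 1: "B ((\<ominus> (inv (B x v))) \<^bold>* x) v = \<ominus> \<one>"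
    using B_smult[OF c assms(1,2)] i assms by (simp add: K.l_minus)
  then show "aff ((\<ominus> (inv (B x v))) \<^bold>* x) \<perp> aff v"
    using B_minus_one_iff assms c smult_closed by metis
qed

text \<open>The polar of \<open>aff v\<close> contains the direction of \<open>x\<close>, so moving
  along it does not leave the polar. If \<open>B y v\<close> is nonzero, \<open>y\<close> is first
  rescaled to an affine point of the polar.\<close>

lemma B_add_zero:
  assumes V: "x \<in> carrier H" "y \<in> carrier H" "v \<in> carrier H" and x: "B x v = \<zero>"
  shows "B (x \<^bold>+ y) v = B y v"
proof (cases "x = \<^bold>0 \<or> y = \<^bold>0")
  case True
  then show ?thesis using V x B_zero_left by auto
next
  case False
  then have dx: "aff v \<perp> dir x" using V x B_zero_iff osym by blast
  show ?thesis
  proof (cases "B y v = \<zero>")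
    case True
    then have "aff v \<perp> dir y" using False V B_zero_iff osym by blast
    then have "x \<^bold>+ y = \<^bold>0 \<or> dir (x \<^bold>+ y) \<perp> aff v" using orth_dir_dir dx False V osym by blast
    then show ?thesis using B_zero_iff[of "x \<^bold>+ y" v] V True by simp
  next
    case y: False
    define c where "c = \<ominus> (inv (B y v))"
    have c: "c \<in> carrier K" "c \<noteq> \<zero>" "B (c \<^bold>* y) v = \<ominus> \<one>" "aff (c \<^bold>* y) \<perp> aff v"
      using B_normalize[OF V(2,3) y] unfolding c_def by blast+
    have "c \<^bold>* x \<noteq> \<^bold>0" using c False smult_eq_zero V by blast
    then have "aff v \<perp> aff (c \<^bold>* y \<^bold>+ c \<^bold>* x)"
      using orth_aff_dir[of "c \<^bold>* y" "c \<^bold>* x" "aff v"] dir_smult[of c x] False c V dx osym smult_closed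
      by simp
    moreover have "c \<^bold>* y \<^bold>+ c \<^bold>* x = c \<^bold>* (x \<^bold>+ y)"
      using smult_r_distr c V H.a_comm smult_closed by simp
    ultimately have "B (c \<^bold>* (x \<^bold>+ y)) v = \<ominus> \<one>"
      using B_minus_one_iff c V osym smult_closed by simp
    then have "c \<otimes> B (x \<^bold>+ y) v = c \<otimes> B y v" using B_smult c V by simp
    then show ?thesis using left_cancel[OF c(1,2)] V by simp
  qed
qed

lemma B_add:
  assumes V: "x \<in> carrier H" "y \<in> carrier H" "v \<in> carrier H"
  shows "B (x \<^bold>+ y) v = B x v \<oplus> B y v"
proof (cases "B x v = \<zero>")
  case True
  then show ?thesis using B_add_zero V by simp
next
  case x: False
  show ?thesis
  proof (cases "B y v = \<zero>")
    case True
    then show ?thesis using B_add_zero[of y x v] V H.a_comm by simp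
  next
    case y: False
    define a where "a = B x v"
    define b where "b = B y v"
    have ab: "a \<in> carrier K" "b \<in> carrier K" "a \<noteq> \<zero>" "b \<noteq> \<zero>" using x y V a_def b_def by simp_all
    note ia = nonzero_inv[OF ab(1,3)] and ib = nonzero_inv[OF ab(2,4)]
    define x' where "x' = (\<ominus> (inv a)) \<^bold>* x"
    define y' where "y' = (\<ominus> (inv b)) \<^bold>* y"
    have V': "x' \<in> carrier H" "y' \<in> carrier H" using ia ib V smult_closed x'_def y'_def by simp_all
    have o: "aff x' \<perp> aff v" "aff y' \<perp> aff v"
      using B_normalize(4)[OF V(1,3) x] B_normalize(4)[OF V(2,3) y]
      unfolding x'_def y'_def a_def b_def by blast+
    have d0: "B (x' \<^bold>- y') v = \<zero>"
    proof (cases "x' = y'")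
      case True
      then show ?thesis using V' B_zero_left by (simp add: H.minus_eq H.r_neg)
    next
      case False
      then have "aff v \<perp> dir (x' \<^bold>- y')" using orth_aff_aff V' o osym by blast
      then show ?thesis using B_zero_iff V V' osym by simp
    qed
    have by': "b \<^bold>* y' = \<ominus>\<^bsub>H\<^esub> y"
      using ib ab V unfolding y'_def by (simp add: smult_assoc1[symmetric] K.r_minus smult_minus_one)
    have bx': "b \<^bold>* x' = \<ominus>\<^bsub>H\<^esub> ((b \<otimes> inv a) \<^bold>* x)"
      using smult_assoc1[of b "\<ominus> (inv a)" x] smult_minus_left[of "b \<otimes> inv a" x] ia(1) ab V
      unfolding x'_def by (simp add: K.r_minus)
    have bm: "b \<^bold>* (\<ominus>\<^bsub>H\<^esub> y') = y"
      using by' smult_minus_one[of y'] smult_assoc1[of b "\<ominus> \<one>" y'] ab V V'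
      by (simp add: K.r_minus smult_minus_left)
    have "b \<^bold>* (x' \<^bold>- y') = \<ominus>\<^bsub>H\<^esub> ((b \<otimes> inv a) \<^bold>* x) \<^bold>+ y"
      using V' ab bx' bm by (simp add: H.minus_eq smult_r_distr)
    then have "B (\<ominus>\<^bsub>H\<^esub> ((b \<otimes> inv a) \<^bold>* x) \<^bold>+ y) v = \<zero>"
      using d0 B_smult[of b "x' \<^bold>- y'" v] V V' ab by simp
    \<comment> \<open>Rescaled to \<open>x'\<close> and \<open>y'\<close>, both points are in the
      polar of \<open>aff v\<close>, so \<open>B\<close> vanishes on their difference. Up to
      \<open>b\<close> times this difference, \<open>x + y\<close> is a multiple of \<open>x\<close>
      alone, and \<open>B_smult\<close> evaluates it to \<open>a \<oplus> b\<close>.\<close>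
    moreover have "x \<^bold>+ y = \<ominus>\<^bsub>H\<^esub> ((b \<otimes> inv a) \<^bold>* x) \<^bold>+ y \<^bold>+ (\<one> \<oplus> b \<otimes> inv a) \<^bold>* x"
    proof -
      let ?w = "(b \<otimes> inv a) \<^bold>* x"
      have w: "?w \<in> carrier H" using V ab ia smult_closed by simp
      have "(\<one> \<oplus> b \<otimes> inv a) \<^bold>* x = x \<^bold>+ ?w" using V ab ia smult_l_distr smult_one by simp
      then show ?thesis using w V by (simp add: H.a_ac H.r_neg2 H.r_neg1 H.r_neg)
    qed
    ultimately have "B (x \<^bold>+ y) v = (\<one> \<oplus> b \<otimes> inv a) \<otimes> a"
      using B_add_zero[of "\<ominus>\<^bsub>H\<^esub> ((b \<otimes> inv a) \<^bold>* x) \<^bold>+ y" "(\<one> \<oplus> b \<otimes> inv a) \<^bold>* x" v]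
        B_smult[of "\<one> \<oplus> b \<otimes> inv a" x v] V ab ia smult_closed a_def by simp
    also have "\<dots> = a \<oplus> b" using ab ia by (simp add: K.l_distr K.m_assoc)
    finally show ?thesis using a_def b_def by simp
  qed
qed

lemma B_diff:
  assumes "x \<in> carrier H" "y \<in> carrier H" "v \<in> carrier H"
  shows "B (x \<^bold>- y) v = B x v \<ominus> B y v"
  using assms by (simp add: H.minus_eq K.minus_eq B_add B_minus_left)

text \<open>Since \<open>dir x\<close> is always orthogonal to the origin, its orthogonality to
  \<open>aff v\<close> passes to the point at infinity of the line joining \<open>aff v\<close> and
  the origin, and back. The condition has become symmetric in \<open>x\<close> and
  \<open>v\<close>.\<close>

lemma B_zero_iff_dir:
  assumes "x \<in> carrier H" "v \<in> carrier H"
  shows "B x v = \<zero> \<longleftrightarrow> x = \<^bold>0 \<or> v = \<^bold>0 \<or> dir x \<perp> dir v"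
proof (cases "x = \<^bold>0 \<or> v = \<^bold>0")
  case True
  then show ?thesis using B_zero_iff assms dir_orth_origin by blast
next
  case False
  then have o: "dir x \<perp> aff \<^bold>0" using dir_orth_origin assms by blast
  have "dir x \<perp> dir v" if "dir x \<perp> aff v"
    using orth_aff_aff[of v "\<^bold>0" "dir x"] assms False that o H.minus_equality[of "\<^bold>0" "\<^bold>0"] by (simp add: H.minus_eq)
  moreover have "dir x \<perp> aff v" if "dir x \<perp> dir v"
    using orth_aff_dir[of "\<^bold>0" v "dir x"] assms False that o by simp
  ultimately show ?thesis using B_zero_iff assms False by blast
qed

section \<open>Symmetry of the zeros and additivity in the second argument\<close>

lemma B_zero_right: "x \<in> carrier H \<Longrightarrow> B x \<^bold>0 = \<zero>"
  using B_zero_iff_dir[of x "\<^bold>0"] by simp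

lemma B_zero_sym: "x \<in> carrier H \<Longrightarrow> v \<in> carrier H \<Longrightarrow> B x v = \<zero> \<Longrightarrow> B v x = \<zero>"
  using B_zero_iff_dir osym by meson

lemma B_self: "x \<in> carrier H \<Longrightarrow> x \<noteq> \<^bold>0 \<Longrightarrow> B x x \<noteq> \<zero>"
  using B_zero_iff_dir oirrefl by blast

text \<open>Here the polar of the first argument is used: once \<open>x\<close> is rescaled to
  \<open>c * x\<close> with \<open>aff (c * x)\<close> orthogonal to \<open>aff v\<close>, its polar
  contains \<open>aff v\<close> and \<open>dir w\<close>, hence \<open>aff (v + w)\<close>.\<close>

lemma B_add_right_zero:
  assumes V: "x \<in> carrier H" "v \<in> carrier H" "w \<in> carrier H" and w: "B x w = \<zero>"
  shows "B x (v \<^bold>+ w) = B x v"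
proof (cases "x = \<^bold>0 \<or> w = \<^bold>0")
  case True
  then show ?thesis using V B_zero_left by auto
next
  case False
  then have xw: "dir x \<perp> dir w" using V w B_zero_iff_dir by blast
  show ?thesis
  proof (cases "B x v = \<zero>")
    case True
    then have "dir x \<perp> aff v" using False V B_zero_iff by blast
    then have "dir x \<perp> aff (v \<^bold>+ w)" using orth_aff_dir False V xw by blast
    then have "B x (v \<^bold>+ w) = \<zero>" using B_zero_iff[of x "v \<^bold>+ w"] V by simp
    then show ?thesis using True by simp
  next
    case v: False
    define c where "c = \<ominus> (inv (B x v))"
    have c: "c \<in> carrier K" "c \<noteq> \<zero>" "B (c \<^bold>* x) v = \<ominus> \<one>" "aff (c \<^bold>* x) \<perp> aff v"
      using B_normalize[OF V(1,2) v] unfolding c_def by blast+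
    have cx: "c \<^bold>* x \<in> carrier H" "c \<^bold>* x \<noteq> \<^bold>0" using c V False smult_eq_zero smult_closed by blast+
    have "dir w \<perp> aff (\<^bold>0 \<^bold>+ c \<^bold>* x)"
      using orth_aff_dir[of "\<^bold>0" "c \<^bold>* x" "dir w"] cx dir_smult[of c x] c V False xw osym dir_orth_origin
      by simp
    then have "aff (c \<^bold>* x) \<perp> dir w" using osym cx by simp
    then have "aff (c \<^bold>* x) \<perp> aff (v \<^bold>+ w)" using orth_aff_dir c V False by blast
    then have "B (c \<^bold>* x) (v \<^bold>+ w) = B (c \<^bold>* x) v" using B_minus_one_iff[of "c \<^bold>* x" "v \<^bold>+ w"] cx V c by simp
    then have "c \<otimes> B x (v \<^bold>+ w) = c \<otimes> B x v" using B_smult c V by simp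
    then show ?thesis using left_cancel[OF c(1,2)] V by simp
  qed
qed

lemma ex_separating:
  assumes "v \<in> carrier H" "w \<in> carrier H" "v \<noteq> \<^bold>0" "w \<noteq> \<^bold>0" "dir v \<noteq> dir w"
  shows "\<exists>k\<in>carrier H. B k v = \<zero> \<and> B k w \<noteq> \<zero>"
  using dir_separate[of v w] assms B_zero_iff_dir by blast

text \<open>With \<open>k\<close> annihilated by \<open>v\<close> but not by \<open>w\<close>, write
  \<open>x\<close> as \<open>y\<close> plus a multiple of \<open>k\<close>, where \<open>y\<close>
  is annihilated by \<open>w\<close>. For \<open>y\<close> and \<open>k\<close> separately one of
  the two summands is negligible.\<close>

lemma B_add_right_indep:
  assumes V: "x \<in> carrier H" "v \<in> carrier H" "w \<in> carrier H" and ne: "v \<noteq> \<^bold>0" "w \<noteq> \<^bold>0" "dir v \<noteq> dir w"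
  shows "B x (v \<^bold>+ w) = B x v \<oplus> B x w"
proof -
  obtain k where k: "k \<in> carrier H" "B k v = \<zero>" "B k w \<noteq> \<zero>" using ex_separating V ne by blast
  note i = nonzero_inv[OF B_closed[OF k(1) V(3)] k(3)]
  define c where "c = B x w \<otimes> inv (B k w)"
  have c: "c \<in> carrier K" "c \<otimes> B k w = B x w" using i V k by (simp_all add: c_def K.m_assoc)
  define y where "y = x \<^bold>- c \<^bold>* k"
  have ck: "c \<^bold>* k \<in> carrier H" using c k smult_closed by blast
  have y: "y \<in> carrier H" "x = y \<^bold>+ c \<^bold>* k"
    using V ck by (simp_all add: y_def H.minus_eq H.a_assoc H.l_neg)
  have By: "B x z = B y z \<oplus> c \<otimes> B k z" if "z \<in> carrier H" for z
    using y(2) B_add[OF y(1) ck that] B_smult[OF c(1) k(1) that] by simp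
  have "B y w = \<zero>"
    using B_diff[OF V(1) ck V(3)] B_smult[OF c(1) k(1) V(3)] c V by (simp add: y_def K.minus_eq K.r_neg)
  then have "B y (v \<^bold>+ w) = B y v" using B_add_right_zero y V by blast
  moreover have "B k (v \<^bold>+ w) = B k w"
    using B_add_right_zero[of k w v] k V H.a_comm by simp
  moreover have "B x v = B y v" using By[OF V(2)] k c y V by simp
  ultimately show ?thesis using By[of "v \<^bold>+ w"] V c y by simp
qed

text \<open>For \<open>v\<close> and \<open>w\<close> in the same direction, a vector
  \<open>t\<close> in another direction is added, and \<open>v + w + t\<close> is split in two ways
  into independent pairs.\<close>

lemma B_add_right:
  assumes V: "x \<in> carrier H" "v \<in> carrier H" "w \<in> carrier H"
  shows "B x (v \<^bold>+ w) = B x v \<oplus> B x w"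
proof (cases "v = \<^bold>0 \<or> w = \<^bold>0 \<or> dir v \<noteq> dir w")
  case True
  then show ?thesis
    using B_add_right_indep[OF V] V B_zero_right by (cases "v = \<^bold>0"; cases "w = \<^bold>0") auto
next
  case False
  then obtain d where d: "d \<in> carrier K" "w = d \<^bold>* v" using dir_eqD V by metis
  obtain t where t: "t \<in> carrier H" "t \<noteq> \<^bold>0" "dir t \<noteq> dir v" using ex_other_dir V by blast
  have dirv: "c \<^bold>* v = \<^bold>0 \<or> dir (c \<^bold>* v) = dir v" if "c \<in> carrier K" for c
    using dir_smult[of c v] that False V smult_zero_left by blast
  have wt: "w \<^bold>+ t \<noteq> \<^bold>0" "dir (w \<^bold>+ t) \<noteq> dir v"
  proof -
    have *: "w \<^bold>+ t \<noteq> c \<^bold>* v" if c: "c \<in> carrier K" for c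
    proof
      assume "w \<^bold>+ t = c \<^bold>* v"
      then have "t = \<ominus>\<^bsub>H\<^esub> w \<^bold>+ c \<^bold>* v" using V t H.r_neg1 by metis
      also have "\<dots> = (\<ominus> d \<oplus> c) \<^bold>* v" using d c V by (simp add: smult_l_distr smult_minus_left)
      finally have "t = (\<ominus> d \<oplus> c) \<^bold>* v" .
      moreover have "\<ominus> d \<oplus> c \<in> carrier K" using c d by simp
      ultimately show False using dirv t by metis
    qed
    show "w \<^bold>+ t \<noteq> \<^bold>0" using *[of \<zero>] V smult_zero_left by simp
    then show "dir (w \<^bold>+ t) \<noteq> dir v" using * dir_eqD[of v "w \<^bold>+ t"] False V t by fastforce
  qed
  have "v \<^bold>+ w = (\<one> \<oplus> d) \<^bold>* v" using d V by (simp add: smult_l_distr smult_one)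
  then have vw: "v \<^bold>+ w = \<^bold>0 \<or> dir (v \<^bold>+ w) = dir v" using dirv d by simp
  have "B x (v \<^bold>+ w) \<oplus> B x t = B x (v \<^bold>+ w \<^bold>+ t)"
  proof (cases "v \<^bold>+ w = \<^bold>0")
    case True
    then show ?thesis using V t B_zero_right by simp
  next
    case False
    then show ?thesis using vw B_add_right_indep[of x "v \<^bold>+ w" t] V t by simp
  qed
  also have "\<dots> = B x (v \<^bold>+ (w \<^bold>+ t))" using V t by (simp add: H.a_assoc)
  also have "\<dots> = B x v \<oplus> B x (w \<^bold>+ t)"
    using B_add_right_indep[of x v "w \<^bold>+ t"] wt False V t by simp
  also have "\<dots> = B x v \<oplus> (B x w \<oplus> B x t)"
    using B_add_right_indep[of x w t] t False V by simp
  also have "\<dots> = (B x v \<oplus> B x w) \<oplus> B x t" using V t by (simp add: K.a_assoc)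
  finally show ?thesis using V t by simp
qed

section \<open>The involution and the Hermitian property\<close>

lemma ex_B_one:
  assumes "v \<in> carrier H" "v \<noteq> \<^bold>0"
  shows "\<exists>k\<in>carrier H. B k v = \<one>"
proof
  note i = nonzero_inv[OF B_closed[OF assms(1,1)] B_self[OF assms]]
  show "B (inv (B v v) \<^bold>* v) v = \<one>" "inv (B v v) \<^bold>* v \<in> carrier H"
    using B_smult[OF i(1) assms(1,1)] i assms smult_closed by simp_all
qed

text \<open>As functionals of \<open>x\<close>, \<open>B x (a * v)\<close> and \<open>B x v\<close>
  have the same kernel, so they differ by a right factor. Evaluation at a \<open>k\<close> with
  \<open>B k v = \<one>\<close> gives this factor.\<close>

lemma ex_star_at:
  assumes a: "a \<in> carrier K" "a \<noteq> \<zero>" and v: "v \<in> carrier H" "v \<noteq> \<^bold>0"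
  shows "\<exists>s\<in>carrier K. \<forall>x\<in>carrier H. B x (a \<^bold>* v) = B x v \<otimes> s"
proof -
  obtain k where k: "k \<in> carrier H" "B k v = \<one>" using ex_B_one v by blast
  have av: "a \<^bold>* v \<in> carrier H" "a \<^bold>* v \<noteq> \<^bold>0" "dir (a \<^bold>* v) = dir v"
    using a v smult_closed smult_eq_zero dir_smult by blast+
  have "B x (a \<^bold>* v) = B x v \<otimes> B k (a \<^bold>* v)" if x: "x \<in> carrier H" for x
  proof -
    have ck: "B x v \<^bold>* k \<in> carrier H" using x v k smult_closed by simp
    let ?y = "x \<^bold>- B x v \<^bold>* k"
    have y: "?y \<in> carrier H" "x = ?y \<^bold>+ B x v \<^bold>* k"
      using x ck by (simp_all add: H.minus_eq H.a_assoc H.l_neg)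
    have "B ?y v = \<zero>"
      using B_diff[OF x ck v(1)] B_smult[of "B x v" k v] k x v by (simp add: K.minus_eq K.r_neg)
    then have "B ?y (a \<^bold>* v) = \<zero>" using B_zero_iff_dir y(1) v av by simp
    then show ?thesis
      using B_add[OF y(1) ck av(1)] B_smult[of "B x v" k "a \<^bold>* v"] y(2) av k x v by simp
  qed
  then show ?thesis using B_closed k av by blast
qed

lemma ex_star:
  assumes a: "a \<in> carrier K"
  shows "\<exists>s\<in>carrier K. \<forall>x\<in>carrier H. \<forall>v\<in>carrier H. B x (a \<^bold>* v) = B x v \<otimes> s"
proof (cases "a = \<zero>")
  case True
  then show ?thesis using smult_zero_left B_zero_right by (intro bexI[of _ \<zero>]) auto
next
  case False
  define s where "s v = (SOME s. s \<in> carrier K \<and> (\<forall>x\<in>carrier H. B x (a \<^bold>* v) = B x v \<otimes> s))" for v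
  have s: "s v \<in> carrier K \<and> (\<forall>x\<in>carrier H. B x (a \<^bold>* v) = B x v \<otimes> s v)"
    if v: "v \<in> carrier H" "v \<noteq> \<^bold>0" for v
  proof -
    have "\<exists>s. s \<in> carrier K \<and> (\<forall>x\<in>carrier H. B x (a \<^bold>* v) = B x v \<otimes> s)"
      using ex_star_at[OF a False v] by blast
    then show ?thesis unfolding s_def by (rule someI_ex)
  qed
  \<comment> \<open>Evaluating at a \<open>k\<close> annihilated by \<open>v\<close> isolates the
    term of \<open>w\<close> and compares its factor with that of the sum. Exchanging
    \<open>v\<close> and \<open>w\<close> then gives \<open>s v = s w\<close> for independent
    vectors.\<close>
  have half: "s w = s (v \<^bold>+ w)"
    if V: "v \<in> carrier H" "w \<in> carrier H" "v \<noteq> \<^bold>0" "w \<noteq> \<^bold>0" "dir v \<noteq> dir w" "v \<^bold>+ w \<noteq> \<^bold>0" for v w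
  proof -
    obtain k where k: "k \<in> carrier H" "B k v = \<zero>" "B k w \<noteq> \<zero>" using ex_separating V by blast
    have "B k w \<otimes> s (v \<^bold>+ w) = B k (v \<^bold>+ w) \<otimes> s (v \<^bold>+ w)" using B_add_right k V by simp
    also have "\<dots> = B k (a \<^bold>* v \<^bold>+ a \<^bold>* w)" using s[of "v \<^bold>+ w"] V k smult_r_distr a by simp
    also have "\<dots> = B k v \<otimes> s v \<oplus> B k w \<otimes> s w"
      using B_add_right k V a smult_closed s[of v] s[of w] by simp
    also have "\<dots> = B k w \<otimes> s w" using k V s[of v] s[of w] by simp
    finally show ?thesis
      using left_cancel[of "B k w" "s (v \<^bold>+ w)" "s w"] s[of w] s[of "v \<^bold>+ w"] V k by simp
  qed
  have indep: "s v = s w"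
    if V: "v \<in> carrier H" "w \<in> carrier H" "v \<noteq> \<^bold>0" "w \<noteq> \<^bold>0" "dir v \<noteq> dir w" for v w
  proof -
    have "v \<^bold>+ w \<noteq> \<^bold>0"
    proof
      assume "v \<^bold>+ w = \<^bold>0"
      then have "v = (\<ominus> \<one>) \<^bold>* w" using V H.minus_equality smult_minus_one by metis
      then show False
        using dir_smult[of "\<ominus> \<one>" w] V smult_zero_left
        by (metis K.add.inv_closed K.one_closed)
    qed
    then show ?thesis using half[of v w] half[of w v] V H.a_comm by simp
  qed
  have all: "s v = s w" if V: "v \<in> carrier H" "w \<in> carrier H" "v \<noteq> \<^bold>0" "w \<noteq> \<^bold>0" for v w
  proof (cases "dir v = dir w")
    case True
    obtain t where "t \<in> carrier H" "t \<noteq> \<^bold>0" "dir t \<noteq> dir v" using ex_other_dir V by blast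
    then show ?thesis using indep[of t v] indep[of t w] V True by simp
  qed (use indep V in blast)
  obtain v0 where v0: "v0 \<in> carrier H" "v0 \<noteq> \<^bold>0" using ex_other_dir[of "\<^bold>0"] by blast
  have "B x (a \<^bold>* v) = B x v \<otimes> s v0" if "x \<in> carrier H" "v \<in> carrier H" for x v
  proof (cases "v = \<^bold>0")
    case True
    then show ?thesis using that smult_zero_right a B_zero_right s[OF v0] by simp
  next
    case False
    then show ?thesis using all[of v v0] v0 s[of v] that by simp
  qed
  then show ?thesis using s[OF v0] by blast
qed

definition star :: "'k \<Rightarrow> 'k" where
  "star a = (SOME s. s \<in> carrier K \<and> (\<forall>x\<in>carrier H. \<forall>v\<in>carrier H. B x (a \<^bold>* v) = B x v \<otimes> s))"

lemma star_spec:
  assumes "a \<in> carrier K"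
  shows "star a \<in> carrier K \<and> (\<forall>x\<in>carrier H. \<forall>v\<in>carrier H. B x (a \<^bold>* v) = B x v \<otimes> star a)"
proof -
  have "\<exists>s. s \<in> carrier K \<and> (\<forall>x\<in>carrier H. \<forall>v\<in>carrier H. B x (a \<^bold>* v) = B x v \<otimes> s)"
    using ex_star[OF assms] by blast
  then show ?thesis unfolding star_def by (rule someI_ex)
qed

lemma star_closed: "a \<in> carrier K \<Longrightarrow> star a \<in> carrier K"
  using star_spec by blast

lemma B_smult_right:
  "a \<in> carrier K \<Longrightarrow> x \<in> carrier H \<Longrightarrow> v \<in> carrier H \<Longrightarrow> B x (a \<^bold>* v) = B x v \<otimes> star a"
  using star_spec by blast

lemma ex_normalized_pair: "\<exists>k\<in>carrier H. \<exists>v\<in>carrier H. B k v = \<one>"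
  using ex_other_dir[of "\<^bold>0"] ex_B_one by blast

lemma star_add:
  assumes "a \<in> carrier K" "b \<in> carrier K"
  shows "star (a \<oplus> b) = star a \<oplus> star b"
proof -
  obtain k v where kv: "k \<in> carrier H" "v \<in> carrier H" "B k v = \<one>" using ex_normalized_pair by blast
  have "B k ((a \<oplus> b) \<^bold>* v) = B k (a \<^bold>* v) \<oplus> B k (b \<^bold>* v)"
    using assms kv smult_l_distr B_add_right smult_closed by simp
  then show ?thesis using B_smult_right kv assms star_closed by simp
qed

lemma star_mult:
  assumes "a \<in> carrier K" "b \<in> carrier K"
  shows "star (a \<otimes> b) = star b \<otimes> star a"
proof -
  obtain k v where kv: "k \<in> carrier H" "v \<in> carrier H" "B k v = \<one>" using ex_normalized_pair by blast
  have "B k ((a \<otimes> b) \<^bold>* v) = B k (b \<^bold>* v) \<otimes> star a"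
    using assms kv smult_assoc1 B_smult_right smult_closed by simp
  then show ?thesis using B_smult_right kv assms star_closed by simp
qed

lemma star_zero: "star \<zero> = \<zero>"
  using star_add[of \<zero> \<zero>] star_closed[of \<zero>] K.add.r_cancel_one by simp

lemma star_minus: "a \<in> carrier K \<Longrightarrow> star (\<ominus> a) = \<ominus> star a"
  using star_add[of "\<ominus> a" a] star_closed[of a] star_closed[of "\<ominus> a"] star_zero
    K.minus_equality[of "star (\<ominus> a)" "star a"] by (simp add: K.l_neg)

text \<open>Orthogonality of affine points is symmetric and means the value -1 in either order. So
  the claim holds for the rescaled \<open>x'\<close>, and the scalar returning from
  \<open>x'\<close> to \<open>x\<close> comes out starred in the second argument.\<close>

lemma B_hermitian:
  assumes "x \<in> carrier H" "v \<in> carrier H"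
  shows "B v x = star (B x v)"
proof (cases "B x v = \<zero>")
  case True
  then show ?thesis using B_zero_sym assms star_zero by simp
next
  case False
  define l where "l = B x v"
  have l: "l \<in> carrier K" "l \<noteq> \<zero>" using False assms l_def by simp_all
  note i = nonzero_inv[OF l]
  define x' where "x' = (\<ominus> (inv l)) \<^bold>* x"
  have x': "x' \<in> carrier H" "aff x' \<perp> aff v"
    using B_normalize(1,4)[OF assms False] smult_closed assms unfolding x'_def l_def by blast+
  then have "B v x' = \<ominus> \<one>" using B_minus_one_iff assms osym by blast
  moreover have "x = (\<ominus> l) \<^bold>* x'"
    using smult_assoc1[of "\<ominus> l" "\<ominus> (inv l)" x] i l assms smult_one
    by (simp add: x'_def K.l_minus K.r_minus)
  ultimately have "B v x = (\<ominus> \<one>) \<otimes> star (\<ominus> l)" using B_smult_right x' assms l by simp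
  then show ?thesis using star_minus star_closed l l_def by (simp add: K.l_minus)
qed

text \<open>Every scalar is a value of \<open>B\<close>, and exchanging the arguments twice restores
  it.\<close>

lemma star_star:
  assumes "a \<in> carrier K"
  shows "star (star a) = a"
proof -
  obtain k v where kv: "k \<in> carrier H" "v \<in> carrier H" "B k v = \<one>" using ex_normalized_pair by blast
  define x where "x = a \<^bold>* k"
  have x: "x \<in> carrier H" "B x v = a" using B_smult assms kv smult_closed by (simp_all add: x_def)
  then show ?thesis using B_hermitian kv by metis
qed

lemma star_one: "star \<one> = \<one>"
proof -
  obtain k v where kv: "k \<in> carrier H" "v \<in> carrier H" "B k v = \<one>" using ex_normalized_pair by blast
  then show ?thesis using B_smult_right[of \<one> k v] star_closed smult_one by simp
qed

lemma star_sfield_star: "star_sfield K star"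
  by unfold_locales (use star_closed star_add star_mult star_star in auto)

end

section \<open>The Hermitian space on \<open>V \<oplus> K\<close>\<close>

locale coordinatization = polar_space K H orth aff dir
  for K (structure) and H :: "('k, 'h, 'm) module_scheme" (structure)
    and orth :: "'p \<Rightarrow> 'p \<Rightarrow> bool" (infix "\<perp>" 50) and aff :: "'h \<Rightarrow> 'p" and dir :: "'h \<Rightarrow> 'p" +
  assumes aff_inj: "x \<in> carrier H \<Longrightarrow> y \<in> carrier H \<Longrightarrow> aff x = aff y \<Longrightarrow> x = y"
    and aff_or_dir: "(\<exists>x\<in>carrier H. p = aff x) \<or> (\<exists>x\<in>carrier H. x \<noteq> \<zero>\<^bsub>H\<^esub> \<and> p = dir x)"
begin

definition HK :: "('k, 'h \<times> 'k) module" where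
  "HK = \<lparr>carrier = carrier H \<times> carrier K, monoid.mult = undefined, one = undefined,
     zero = (\<^bold>0, \<zero>), add = (\<lambda>z w. (fst z \<^bold>+ fst w, snd z \<oplus> snd w)),
     smult = (\<lambda>c z. (c \<^bold>* fst z, c \<otimes> snd z))\<rparr>"

text \<open>The second summand is the normalization that makes \<open>(0, 1)\<close>, the vector
  representing the origin, a unit vector.\<close>

definition form :: "'h \<times> 'k \<Rightarrow> 'h \<times> 'k \<Rightarrow> 'k" where
  "form z w = B (fst z) (fst w) \<oplus> snd z \<otimes> star (snd w)"

text \<open>Homogeneous coordinates for left scalars: if \<open>a\<close> is nonzero,
  \<open>(x, a)\<close> is \<open>a\<close> times \<open>(inv a * x, 1)\<close>.\<close>

definition pt :: "'h \<times> 'k \<Rightarrow> 'p" where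
  "pt z = (if snd z = \<zero> then dir (fst z) else aff (inv (snd z) \<^bold>* fst z))"

lemma HK_simps [simp]:
  "carrier HK = carrier H \<times> carrier K" "\<zero>\<^bsub>HK\<^esub> = (\<^bold>0, \<zero>)"
  "z \<oplus>\<^bsub>HK\<^esub> w = (fst z \<^bold>+ fst w, snd z \<oplus> snd w)" "c \<odot>\<^bsub>HK\<^esub> z = (c \<^bold>* fst z, c \<otimes> snd z)"
  by (simp_all add: HK_def)

lemma abelian_group_HK: "abelian_group HK"
proof (rule abelian_groupI)
  fix z assume "z \<in> carrier HK"
  then show "\<exists>w\<in>carrier HK. w \<oplus>\<^bsub>HK\<^esub> z = \<zero>\<^bsub>HK\<^esub>"
    by (intro bexI[of _ "(\<ominus>\<^bsub>H\<^esub> fst z, \<ominus> snd z)"]) (auto simp: H.l_neg K.l_neg)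
qed (auto simp: H.a_ac K.a_ac)

lemma left_linear_space_HK: "left_linear_space K HK"
  by (intro left_linear_space.intro left_linear_space_axioms.intro abelian_group_HK)
    (auto simp: smult_closed smult_l_distr smult_r_distr smult_assoc1 smult_one
      K.l_distr K.r_distr K.m_assoc sfield_axioms)

lemma form_add_left:
  assumes "z \<in> carrier HK" "z' \<in> carrier HK" "w \<in> carrier HK"
  shows "form (z \<oplus>\<^bsub>HK\<^esub> z') w = form z w \<oplus> form z' w"
  using assms by (auto simp: form_def B_add K.l_distr K.a_ac star_closed)

lemma form_smult_left:
  assumes "c \<in> carrier K" "z \<in> carrier HK" "w \<in> carrier HK"
  shows "form (c \<odot>\<^bsub>HK\<^esub> z) w = c \<otimes> form z w"
  using assms by (auto simp: form_def B_smult K.r_distr K.m_assoc star_closed)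

lemma form_closed: "z \<in> carrier HK \<Longrightarrow> w \<in> carrier HK \<Longrightarrow> form z w \<in> carrier K"
  by (auto simp: form_def star_closed)

lemma form_hermitian:
  assumes "z \<in> carrier HK" "w \<in> carrier HK"
  shows "form z w = star (form w z)"
  using assms B_hermitian[of "fst w" "fst z"]
  by (auto simp: form_def star_closed star_add star_mult star_star)

lemma pt_orth_iff:
  assumes z: "z \<in> carrier HK" "z \<noteq> \<zero>\<^bsub>HK\<^esub>" and w: "w \<in> carrier HK" "w \<noteq> \<zero>\<^bsub>HK\<^esub>"
  shows "pt z \<perp> pt w \<longleftrightarrow> form z w = \<zero>"
proof -
  obtain x a y b where [simp]: "z = (x, a)" "w = (y, b)" by (cases z, cases w) auto
  have c: "x \<in> carrier H" "a \<in> carrier K" "y \<in> carrier H" "b \<in> carrier K" using z w by auto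
  have half: "dir x \<perp> aff (inv b \<^bold>* y) \<longleftrightarrow> B x y = \<zero>"
    if c: "x \<in> carrier H" "y \<in> carrier H" "b \<in> carrier K" and "b \<noteq> \<zero>" "x \<noteq> \<^bold>0" for x y b
  proof -
    note i = nonzero_inv[OF c(3) that(4)]
    have "dir x \<perp> aff (inv b \<^bold>* y) \<longleftrightarrow> B x (inv b \<^bold>* y) = \<zero>"
      using B_zero_iff c i that smult_closed by blast
    also have "\<dots> \<longleftrightarrow> inv b \<^bold>* y = \<^bold>0 \<or> dir x \<perp> dir (inv b \<^bold>* y)"
      using B_zero_iff_dir[of x "inv b \<^bold>* y"] c i that smult_closed by simp
    also have "\<dots> \<longleftrightarrow> y = \<^bold>0 \<or> dir x \<perp> dir y"
      using dir_smult[of "inv b" y] i c smult_eq_zero[of "inv b" y] smult_zero_right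
      by (cases "y = \<^bold>0") auto
    also have "\<dots> \<longleftrightarrow> B x y = \<zero>" using B_zero_iff_dir c that by simp
    finally show ?thesis .
  qed
  consider "a = \<zero>" "b = \<zero>" | "a = \<zero>" "b \<noteq> \<zero>" | "a \<noteq> \<zero>" "b = \<zero>" | "a \<noteq> \<zero>" "b \<noteq> \<zero>" by blast
  then show ?thesis
  proof cases
    case 1
    then show ?thesis using z w c B_zero_iff_dir[of x y] star_zero by (simp add: pt_def form_def)
  next
    case 2
    then show ?thesis using z w c half star_closed by (simp add: pt_def form_def)
  next
    case 3
    have "aff (inv a \<^bold>* x) \<perp> dir y \<longleftrightarrow> B y x = \<zero>" using half[of y x a] c 3 w osym by auto
    also have "\<dots> \<longleftrightarrow> B x y = \<zero>" using B_zero_sym c by blast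
    finally show ?thesis using 3 c star_zero by (simp add: pt_def form_def)
  next
    case 4
    note ia = nonzero_inv[OF c(2) 4(1)] and ib = nonzero_inv[OF c(4) 4(2)]
    define x' where "x' = inv a \<^bold>* x"
    define y' where "y' = inv b \<^bold>* y"
    have c': "x' \<in> carrier H" "y' \<in> carrier H" using c ia ib smult_closed x'_def y'_def by simp_all
    have xy: "x = a \<^bold>* x'" "y = b \<^bold>* y'"
      using smult_inv_cancel[of "inv a" x] smult_inv_cancel[of "inv b" y] c ia ib x'_def y'_def by simp_all
    have sb: "star b \<in> carrier K" "star b \<noteq> \<zero>"
      using star_closed[of b] star_star[of b] star_zero c 4 by auto
    \<comment> \<open>For two affine points the form is, up to nonzero outer factors, its value on
      the dehomogenized vectors, where vanishing means that \<open>B\<close> has the value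
      -1.\<close>
    have "form z w = a \<otimes> (B x' y' \<oplus> \<one>) \<otimes> star b"
      using c c' sb by (simp add: form_def xy B_smult B_smult_right smult_closed K.r_distr K.l_distr K.m_assoc)
    then have "form z w = \<zero> \<longleftrightarrow> B x' y' \<oplus> \<one> = \<zero>"
      using no_zero_divisors[of a "B x' y' \<oplus> \<one>"] no_zero_divisors[of "a \<otimes> (B x' y' \<oplus> \<one>)" "star b"] c c' sb 4
      by auto
    also have "\<dots> \<longleftrightarrow> B x' y' = \<ominus> \<one>"
      using c' K.minus_equality[of "B x' y'" \<one>] K.l_neg by auto
    also have "\<dots> \<longleftrightarrow> pt z \<perp> pt w"
      using B_minus_one_iff c' 4 by (simp add: pt_def x'_def y'_def)
    finally show ?thesis by blast
  qed
qed

lemma pt_smult: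
  assumes c: "c \<in> carrier K" "c \<noteq> \<zero>" and z: "z \<in> carrier HK" "z \<noteq> \<zero>\<^bsub>HK\<^esub>"
  shows "pt (c \<odot>\<^bsub>HK\<^esub> z) = pt z"
proof -
  obtain x a where [simp]: "z = (x, a)" by (cases z) auto
  have xa: "x \<in> carrier H" "a \<in> carrier K" using z by auto
  show ?thesis
  proof (cases "a = \<zero>")
    case True
    then show ?thesis using dir_smult c xa z by (simp add: pt_def)
  next
    case False
    have "c \<otimes> a \<noteq> \<zero>" using no_zero_divisors c xa False by blast
    moreover have "inv (c \<otimes> a) \<^bold>* (c \<^bold>* x) = inv a \<^bold>* x"
      using inv_mult[of c a] smult_assoc1[of "inv a" "inv c" "c \<^bold>* x"] smult_inv_cancel[of c x]
        nonzero_inv[of a] nonzero_inv[of c] c xa False smult_closed by simp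
    ultimately show ?thesis using False by (simp add: pt_def)
  qed
qed

lemma aff_neq_dir: "x \<in> carrier H \<Longrightarrow> y \<in> carrier H \<Longrightarrow> y \<noteq> \<^bold>0 \<Longrightarrow> aff x \<noteq> dir y"
  using origin_aff origin_dir by metis

lemma pt_eqD:
  assumes z: "z \<in> carrier HK" "z \<noteq> \<zero>\<^bsub>HK\<^esub>" and w: "w \<in> carrier HK" "w \<noteq> \<zero>\<^bsub>HK\<^esub>" and eq: "pt z = pt w"
  shows "\<exists>c\<in>carrier K. w = c \<odot>\<^bsub>HK\<^esub> z"
proof -
  obtain x a y b where [simp]: "z = (x, a)" "w = (y, b)" by (cases z, cases w) auto
  have c: "x \<in> carrier H" "a \<in> carrier K" "y \<in> carrier H" "b \<in> carrier K" using z w by auto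
  show ?thesis
  proof (cases "a = \<zero>")
    case True
    then have "b = \<zero>"
      using eq c z aff_neq_dir[of "inv b \<^bold>* y" x] nonzero_inv[of b] smult_closed
      by (auto simp: pt_def split: if_splits)
    then show ?thesis using dir_eqD[of x y] eq True c z w by (auto simp: pt_def)
  next
    case False
    note ia = nonzero_inv[OF c(2) False]
    have b: "b \<noteq> \<zero>"
      using eq c w aff_neq_dir[of "inv a \<^bold>* x" y] ia smult_closed False
      by (auto simp: pt_def split: if_splits)
    note ib = nonzero_inv[OF c(4) b]
    have "inv a \<^bold>* x = inv b \<^bold>* y"
      using aff_inj eq False b c ia ib smult_closed by (simp add: pt_def)
    then have "y = b \<^bold>* (inv a \<^bold>* x)" using smult_inv_cancel[of "inv b" y] c ib by simp
    then have "y = (b \<otimes> inv a) \<^bold>* x" using smult_assoc1 c ia by simp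
    moreover have "b = (b \<otimes> inv a) \<otimes> a" using c ia by (simp add: K.m_assoc)
    ultimately show ?thesis using c ia by (intro bexI[of _ "b \<otimes> inv a"]) simp_all
  qed
qed

lemma pt_surj: "\<exists>z\<in>carrier HK. z \<noteq> \<zero>\<^bsub>HK\<^esub> \<and> pt z = p"
proof -
  consider x where "x \<in> carrier H" "p = aff x" | x where "x \<in> carrier H" "x \<noteq> \<^bold>0" "p = dir x"
    using aff_or_dir by blast
  then show ?thesis
  proof cases
    case 1
    then show ?thesis
      using one_not_zero smult_one by (intro bexI[of _ "(x, \<one>)"]) (simp_all add: pt_def)
  next
    case 2
    then show ?thesis by (intro bexI[of _ "(x, \<zero>)"]) (simp_all add: pt_def)
  qed
qed

lemma hermitian_space_HK: "hermitian_space K star HK form"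
proof -
  interpret S: star_sfield K star by (rule star_sfield_star)
  interpret HK: left_linear_space K HK by (rule left_linear_space_HK)
  show ?thesis
  proof
    fix u v assume "u \<in> carrier HK" "v \<in> carrier HK"
    then show "form u v \<in> carrier K" "form u v = star (form v u)"
      using form_closed form_hermitian by blast+
  next
    fix u assume "u \<in> carrier HK" "form u u = \<zero>"
    then show "u = \<zero>\<^bsub>HK\<^esub>" using pt_orth_iff[of u u] oirrefl by blast
  next
    fix a b u v w
    assume c: "a \<in> carrier K" "b \<in> carrier K" "u \<in> carrier HK" "v \<in> carrier HK" "w \<in> carrier HK"
    have au: "a \<odot>\<^bsub>HK\<^esub> u \<in> carrier HK" "b \<odot>\<^bsub>HK\<^esub> v \<in> carrier HK" using c HK.smult_closed by blast+
    have lin: "form (a \<odot>\<^bsub>HK\<^esub> u \<oplus>\<^bsub>HK\<^esub> b \<odot>\<^bsub>HK\<^esub> v) w = a \<otimes> form u w \<oplus> b \<otimes> form v w"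
      using form_add_left[OF au c(5)] form_smult_left c by presburger
    then show "form (a \<odot>\<^bsub>HK\<^esub> u \<oplus>\<^bsub>HK\<^esub> b \<odot>\<^bsub>HK\<^esub> v) w = a \<otimes> form u w \<oplus> b \<otimes> form v w" .
    have "a \<odot>\<^bsub>HK\<^esub> u \<oplus>\<^bsub>HK\<^esub> b \<odot>\<^bsub>HK\<^esub> v \<in> carrier HK" using au HK.H.a_closed by blast
    then have "form w (a \<odot>\<^bsub>HK\<^esub> u \<oplus>\<^bsub>HK\<^esub> b \<odot>\<^bsub>HK\<^esub> v) = star (a \<otimes> form u w \<oplus> b \<otimes> form v w)"
      using form_hermitian[OF c(5)] lin by presburger
    also have "\<dots> = star (form u w) \<otimes> star a \<oplus> star (form v w) \<otimes> star b"
      using star_add[of "a \<otimes> form u w" "b \<otimes> form v w"] star_mult c form_closed K.m_closed by presburger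
    also have "\<dots> = form w u \<otimes> star a \<oplus> form w v \<otimes> star b" 
      using form_hermitian[OF c(5,3)] form_hermitian[OF c(5,4)] by simp
    finally show "form w (a \<odot>\<^bsub>HK\<^esub> u \<oplus>\<^bsub>HK\<^esub> b \<odot>\<^bsub>HK\<^esub> v) = form w u \<otimes> star a \<oplus> form w v \<otimes> star b" .
  qed
qed

lemma ray_eq_iff:
  assumes z: "z \<in> carrier HK" "z \<noteq> \<zero>\<^bsub>HK\<^esub>" and w: "w \<in> carrier HK" "w \<noteq> \<zero>\<^bsub>HK\<^esub>"
  shows "ray K HK z = ray K HK w \<longleftrightarrow> pt z = pt w"
proof -
  interpret HK: left_linear_space K HK by (rule left_linear_space_HK)
  have nz: "c \<noteq> \<zero>" if "w = c \<odot>\<^bsub>HK\<^esub> z" for c using that w z HK.smult_zero_left by metis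
  show ?thesis
  proof
    assume "ray K HK z = ray K HK w"
    moreover have "w \<in> ray K HK w"
      unfolding ray_def using w HK.smult_one K.one_closed by (metis (mono_tags, lifting) mem_Collect_eq)
    ultimately obtain c where c: "c \<in> carrier K" "w = c \<odot>\<^bsub>HK\<^esub> z" unfolding ray_def by blast
    then show "pt z = pt w" using pt_smult nz z by metis
  next
    assume "pt z = pt w"
    then obtain c where c: "c \<in> carrier K" "w = c \<odot>\<^bsub>HK\<^esub> z" using pt_eqD z w by blast
    note i = nonzero_inv[OF c(1) nz[OF c(2)]]
    have "\<exists>b\<in>carrier K. a \<odot>\<^bsub>HK\<^esub> z = b \<odot>\<^bsub>HK\<^esub> w" if "a \<in> carrier K" for a
    proof
      show "a \<otimes> inv c \<in> carrier K" using that i by simp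
      have "z = inv c \<odot>\<^bsub>HK\<^esub> w" using HK.smult_inv_cancel[OF c(1) nz[OF c(2)] z(1)] c(2) by metis
      then show "a \<odot>\<^bsub>HK\<^esub> z = (a \<otimes> inv c) \<odot>\<^bsub>HK\<^esub> w" using HK.smult_assoc1 that i w by metis
    qed
    moreover have "\<exists>b\<in>carrier K. a \<odot>\<^bsub>HK\<^esub> w = b \<odot>\<^bsub>HK\<^esub> z" if "a \<in> carrier K" for a
      using HK.smult_assoc1[OF that c(1) z(1)] c that by (metis K.m_closed)
    ultimately show "ray K HK z = ray K HK w" unfolding ray_def by auto
  qed
qed

section \<open>The isomorphism onto the projective space\<close>

definition rep :: "'p \<Rightarrow> 'h \<times> 'k" where
  "rep p = (SOME z. z \<in> carrier HK \<and> z \<noteq> \<zero>\<^bsub>HK\<^esub> \<and> pt z = p)"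

lemma rep: "rep p \<in> carrier HK" "rep p \<noteq> \<zero>\<^bsub>HK\<^esub>" "pt (rep p) = p"
proof -
  have "\<exists>z. z \<in> carrier HK \<and> z \<noteq> \<zero>\<^bsub>HK\<^esub> \<and> pt z = p" using pt_surj by blast
  then have "rep p \<in> carrier HK \<and> rep p \<noteq> \<zero>\<^bsub>HK\<^esub> \<and> pt (rep p) = p" unfolding rep_def by (rule someI_ex)
  then show "rep p \<in> carrier HK" "rep p \<noteq> \<zero>\<^bsub>HK\<^esub>" "pt (rep p) = p" by blast+
qed

lemma iso_HK:
  "orthoset_iso_on UNIV orth (proj_points K HK) (proj_orth K HK form) (\<lambda>p. ray K HK (rep p))"
  unfolding orthoset_iso_on_def
proof (intro conjI ballI)
  show "bij_betw (\<lambda>p. ray K HK (rep p)) UNIV (proj_points K HK)"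
  proof (rule bij_betwI')
    show "(ray K HK (rep p) = ray K HK (rep q)) = (p = q)" for p q
      using ray_eq_iff[OF rep(1,2) rep(1,2), of p q] rep(3) by metis
    show "ray K HK (rep p) \<in> proj_points K HK" for p
      using rep(1,2)[of p] unfolding proj_points_def by blast
    fix P assume "P \<in> proj_points K HK"
    then obtain z where z: "z \<in> carrier HK" "z \<noteq> \<zero>\<^bsub>HK\<^esub>" "P = ray K HK z"
      unfolding proj_points_def by blast
    then have "P = ray K HK (rep (pt z))" using ray_eq_iff[OF z(1,2) rep(1,2), of "pt z"] rep(3) by metis
    then show "\<exists>p\<in>UNIV. P = ray K HK (rep p)" by blast
  qed
  show "p \<perp> q \<longleftrightarrow> proj_orth K HK form (ray K HK (rep p)) (ray K HK (rep q))" for p q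
  proof
    assume "p \<perp> q"
    then have "form (rep p) (rep q) = \<zero>" using pt_orth_iff[OF rep(1,2) rep(1,2), of p q] rep(3) by metis
    then show "proj_orth K HK form (ray K HK (rep p)) (ray K HK (rep q))"
      unfolding proj_orth_def using rep(1,2) by blast
  next
    assume "proj_orth K HK form (ray K HK (rep p)) (ray K HK (rep q))"
    then obtain u v where uv: "u \<in> carrier HK" "u \<noteq> \<zero>\<^bsub>HK\<^esub>" "v \<in> carrier HK" "v \<noteq> \<zero>\<^bsub>HK\<^esub>"
      "ray K HK (rep p) = ray K HK u" "ray K HK (rep q) = ray K HK v" "form u v = \<zero>"
      unfolding proj_orth_def by blast
    then have "pt u = p" "pt v = q"
      using ray_eq_iff[OF rep(1,2) uv(1,2), of p] ray_eq_iff[OF rep(1,2) uv(3,4), of q] rep(3) by metis+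
    then show "p \<perp> q" using pt_orth_iff uv by metis
  qed
qed

lemma form_origin: "form (\<^bold>0, \<one>) (\<^bold>0, \<one>) = \<one>" "pt (\<^bold>0, \<one>) = aff \<^bold>0" "(\<^bold>0, \<one>) \<noteq> \<zero>\<^bsub>HK\<^esub>"
  "(\<^bold>0, \<one>) \<in> carrier HK"
  using one_not_zero star_one smult_one by (auto simp: form_def B_zero_left pt_def)

end

section \<open>Unit vectors\<close>

context star_sfield begin

lemma star_zero: "star \<zero> = \<zero>"
  using star_add[of \<zero> \<zero>] star_closed[of \<zero>] add.r_cancel_one by simp

lemma star_minus: "a \<in> carrier K \<Longrightarrow> star (\<ominus> a) = \<ominus> star a"
  using star_add[of "\<ominus> a" a] star_closed[of a] star_closed[of "\<ominus> a"] star_zero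
    minus_equality[of "star (\<ominus> a)" "star a"] by (simp add: l_neg)

lemma star_one: "star \<one> = \<one>"
  using star_mult[of "star \<one>" \<one>] star_star[of \<one>] star_closed[of \<one>] by simp

lemma star_nonzero: "a \<in> carrier K \<Longrightarrow> a \<noteq> \<zero> \<Longrightarrow> star a \<noteq> \<zero>"
  using star_star star_zero by metis

end

context hermitian_space begin

lemma form_smult_left:
  "\<lbrakk>a \<in> carrier K; u \<in> carrier H; w \<in> carrier H\<rbrakk> \<Longrightarrow> form (a \<^bold>* u) w = a \<otimes> form u w"
  using form_linear_left[of a \<zero> u u w] smult_zero_left smult_closed form_closed by simp

lemma form_add_left:
  "\<lbrakk>u \<in> carrier H; v \<in> carrier H; w \<in> carrier H\<rbrakk> \<Longrightarrow> form (u \<^bold>+ v) w = form u w \<oplus> form v w"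
  using form_linear_left[of \<one> \<one> u v w] smult_one form_closed by simp

lemma form_smult_right:
  "\<lbrakk>a \<in> carrier K; u \<in> carrier H; w \<in> carrier H\<rbrakk> \<Longrightarrow> form w (a \<^bold>* u) = form w u \<otimes> star a"
  using form_semilinear_right[of a \<zero> u u w] smult_zero_left smult_closed form_closed star_zero star_closed
  by simp

lemma form_add_right:
  "\<lbrakk>u \<in> carrier H; v \<in> carrier H; w \<in> carrier H\<rbrakk> \<Longrightarrow> form w (u \<^bold>+ v) = form w u \<oplus> form w v"
  using form_semilinear_right[of \<one> \<one> u v w] smult_one form_closed star_one by simp

lemma form_zero_left: "w \<in> carrier H \<Longrightarrow> form \<^bold>0 w = \<zero>"
  using form_smult_left[of \<zero> "\<^bold>0" w] smult_zero_left form_closed by simp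

lemma form_zero_sym: "u \<in> carrier H \<Longrightarrow> v \<in> carrier H \<Longrightarrow> form u v = \<zero> \<Longrightarrow> form v u = \<zero>"
  using form_hermitian[of v u] star_zero by simp

text \<open>Let \<open>y\<close> be the negative of the projection of \<open>x\<close> onto the span
  of \<open>v\<close> and \<open>t\<close>. Then \<open>x + y\<close> is orthogonal to
  \<open>v\<close> and \<open>t\<close>, hence by assumption to \<open>x\<close>, and so to itself;
  anisotropy makes it zero.\<close>

lemma in_orthogonal_span:
  assumes V: "v \<in> carrier H" "t \<in> carrier H" "x \<in> carrier H" and nz: "v \<noteq> \<^bold>0" "t \<noteq> \<^bold>0"
    and vt: "form v t = \<zero>"
    and x: "\<And>q. q \<in> carrier H \<Longrightarrow> form q v = \<zero> \<Longrightarrow> form q t = \<zero> \<Longrightarrow> form q x = \<zero>"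
  shows "\<exists>a\<in>carrier K. \<exists>b\<in>carrier K. x = a \<^bold>* v \<^bold>+ b \<^bold>* t"
proof -
  have tv: "form t v = \<zero>" using form_zero_sym V vt by blast
  have n: "form v v \<in> carrier K" "form t t \<in> carrier K" "form v v \<noteq> \<zero>" "form t t \<noteq> \<zero>"
    using V nz form_closed form_anisotropic by blast+
  note iv = nonzero_inv[OF n(1,3)] and it = nonzero_inv[OF n(2,4)]
  define a where "a = \<ominus> (form x v \<otimes> inv (form v v))"
  define b where "b = \<ominus> (form x t \<otimes> inv (form t t))"
  have ab: "a \<in> carrier K" "b \<in> carrier K" using V iv it form_closed by (simp_all add: a_def b_def)
  have av: "a \<^bold>* v \<in> carrier H" "b \<^bold>* t \<in> carrier H" using ab V smult_closed by blast+
  define y where "y = a \<^bold>* v \<^bold>+ b \<^bold>* t"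
  have y: "y \<in> carrier H" using av y_def by simp
  have fy: "form y z = a \<otimes> form v z \<oplus> b \<otimes> form t z" if "z \<in> carrier H" for z
    unfolding y_def using form_linear_left ab V that by blast
  have av': "a \<otimes> form v v = \<ominus> form x v" "b \<otimes> form t t = \<ominus> form x t"
    using V iv it n form_closed by (simp_all add: a_def b_def l_minus m_assoc)
  have 1: "form (x \<^bold>+ y) v = \<zero>" "form (x \<^bold>+ y) t = \<zero>"
    using form_add_left[OF V(3) y] fy V av' tv vt ab form_closed scalar_r_neg by simp_all
  then have "form (x \<^bold>+ y) x = \<zero>" using x V y by simp
  moreover have "form (x \<^bold>+ y) y = \<zero>"
    using form_semilinear_right[of a b v t "x \<^bold>+ y"] 1 ab V y star_closed by (simp add: y_def)
  ultimately have "form (x \<^bold>+ y) (x \<^bold>+ y) = \<zero>" using form_add_right V y by simp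
  then have "x \<^bold>+ y = \<^bold>0" using form_anisotropic V y by blast
  then have "x = (\<ominus> \<one>) \<^bold>* y" using H.minus_equality[of x y] V y smult_minus_one by simp
  also have "\<dots> = (\<ominus> a) \<^bold>* v \<^bold>+ (\<ominus> b) \<^bold>* t"
    using smult_r_distr[of "\<ominus> \<one>" "a \<^bold>* v" "b \<^bold>* t"] smult_assoc1[of "\<ominus> \<one>" a v] smult_assoc1[of "\<ominus> \<one>" b t]
      ab av V by (simp add: y_def l_minus)
  finally show ?thesis using ab scalar_add_inv_closed by blast
qed

text \<open>
  There is a multiple \<open>v'\<close> of \<open>v\<close> such that \<open>\<phi>\<close> maps \<open>[u + t]\<close> to \<open>[v' + t]\<close> for \<open>t = w\<close>, then for
  \<open>t = w'\<close>, then for every multiple of \<open>w\<close>. Choosing \<open>t = f w\<close> with \<open>u + w\<close> orthogonal to \<open>u + t\<close>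
  yields \<open>(v', v') = - (w, t) = (u, u)\<close>.
\<close>

lemma unit_vector_transport:
  fixes P :: "'b \<Rightarrow> 'p" and orth :: "'p \<Rightarrow> 'p \<Rightarrow> bool" (infix "\<perp>" 50) and \<phi> :: "'p \<Rightarrow> 'p"
  assumes P_eqD: "\<And>x y. \<lbrakk>x \<in> carrier H; x \<noteq> \<^bold>0; y \<in> carrier H; y \<noteq> \<^bold>0; P x = P y\<rbrakk> \<Longrightarrow> \<exists>c\<in>carrier K. y = c \<^bold>* x"
    and P_smult: "\<And>c x. \<lbrakk>c \<in> carrier K; c \<noteq> \<zero>; x \<in> carrier H; x \<noteq> \<^bold>0\<rbrakk> \<Longrightarrow> P (c \<^bold>* x) = P x"
    and P_orth: "\<And>x y. \<lbrakk>x \<in> carrier H; x \<noteq> \<^bold>0; y \<in> carrier H; y \<noteq> \<^bold>0\<rbrakk> \<Longrightarrow> P x \<perp> P y \<longleftrightarrow> form x y = \<zero>"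
    and P_surj: "\<And>p. \<exists>x\<in>carrier H. x \<noteq> \<^bold>0 \<and> P x = p"
    and \<phi>_bij: "bij \<phi>" and \<phi>_orth: "\<And>p q. p \<perp> q \<longleftrightarrow> \<phi> p \<perp> \<phi> q"
    and u: "u \<in> carrier H" "form u u = \<one>" and v: "v \<in> carrier H" "v \<noteq> \<^bold>0"
    and \<phi>u: "\<phi> (P u) = P v" and fix\<phi>: "\<And>q. q \<perp> P u \<Longrightarrow> q \<perp> P v \<Longrightarrow> \<phi> q = q"
    and w: "w \<in> carrier H" "w \<noteq> \<^bold>0" "form w u = \<zero>" "form w v = \<zero>"
    and w': "w' \<in> carrier H" "w' \<noteq> \<^bold>0" "form w' u = \<zero>" "form w' v = \<zero>" and ww': "form w w' = \<zero>"
  shows "\<exists>c\<in>carrier K. form (c \<^bold>* v) (c \<^bold>* v) = \<one>"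
proof -
  define N where "N = {t \<in> carrier H. t \<noteq> \<^bold>0 \<and> form t u = \<zero> \<and> form t v = \<zero>}"
  have N: "t \<in> carrier H" "t \<noteq> \<^bold>0" "form t u = \<zero>" "form t v = \<zero>" "form u t = \<zero>" "form v t = \<zero>"
    "form t t \<in> carrier K" "form t t \<noteq> \<zero>" "\<phi> (P t) = P t" if t: "t \<in> N" for t
  proof -
    show *: "t \<in> carrier H" "t \<noteq> \<^bold>0" "form t u = \<zero>" "form t v = \<zero>" using t by (auto simp: N_def)
    then show "form u t = \<zero>" "form v t = \<zero>" using form_zero_sym u v by blast+
    show "form t t \<in> carrier K" "form t t \<noteq> \<zero>" using * form_closed form_anisotropic by blast+
    have "u \<noteq> \<^bold>0" using u one_not_zero form_zero_left by metis
    then show "\<phi> (P t) = P t" using * P_orth u v fix\<phi> by blast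
  qed
  have u0: "u \<noteq> \<^bold>0" using u one_not_zero form_zero_left by metis
  have preimage: "\<exists>y\<in>carrier H. y \<noteq> \<^bold>0 \<and> \<phi> (P y) = p" for p
    using P_surj \<phi>_bij by (metis bij_pointE)
  have sum_nz: "u \<^bold>+ t \<noteq> \<^bold>0" "u \<^bold>+ t \<in> carrier H" if "t \<in> N" for t
  proof -
    show "u \<^bold>+ t \<in> carrier H" using u N[OF that] by simp
    have "form (u \<^bold>+ t) u = \<one>" using form_add_left u N[OF that] by simp
    then show "u \<^bold>+ t \<noteq> \<^bold>0" using one_not_zero u form_zero_left by metis
  qed
  have image: "\<exists>a\<in>carrier K. \<exists>b\<in>carrier K. a \<noteq> \<zero> \<and> b \<noteq> \<zero> \<and> \<phi> (P (u \<^bold>+ t)) = P (a \<^bold>* v \<^bold>+ b \<^bold>* t)"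
    if tN: "t \<in> N" for t
  proof -
    note t = N[OF tN] and ut = sum_nz[OF tN]
    obtain x where x: "x \<in> carrier H" "x \<noteq> \<^bold>0" "P x = \<phi> (P (u \<^bold>+ t))" using P_surj by blast
    \<comment> \<open>The image of the line through \<open>P u\<close> and \<open>P t\<close> is the
      line through \<open>P v\<close> and \<open>P t\<close>: a point orthogonal to the latter two
      has a preimage orthogonal to the former two.\<close>
    have "form q x = \<zero>" if q: "q \<in> carrier H" "form q v = \<zero>" "form q t = \<zero>" for q
    proof (cases "q = \<^bold>0")
      case False
      obtain y where y: "y \<in> carrier H" "y \<noteq> \<^bold>0" "\<phi> (P y) = P q" using preimage by blast
      have "P q \<perp> \<phi> (P u)" "P q \<perp> \<phi> (P t)" using P_orth q False v t \<phi>u by simp_all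
      then have "form y u = \<zero>" "form y t = \<zero>" using y \<phi>_orth P_orth u u0 t by metis+
      then have "form y (u \<^bold>+ t) = \<zero>" using form_add_right u t y by simp
      then show ?thesis using P_orth y ut x q False \<phi>_orth by metis
    qed (use x form_zero_left in simp)
    then obtain a b where ab: "a \<in> carrier K" "b \<in> carrier K" "x = a \<^bold>* v \<^bold>+ b \<^bold>* t"
      using in_orthogonal_span[of v t x] v t x by blast
    have inj: "p = q" if "\<phi> p = \<phi> q" for p q using that \<phi>_bij by (meson bij_is_inj injD)
    have "a \<noteq> \<zero>"
    proof
      assume "a = \<zero>"
      then have xb: "x = b \<^bold>* t" using ab v t smult_zero_left smult_closed by simp
      then have "b \<noteq> \<zero>" using x t smult_zero_left by auto
      then have "P x = \<phi> (P t)" using xb P_smult ab t by simp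
      then have "P t = P (u \<^bold>+ t)" using x inj by metis
      then obtain c where c: "c \<in> carrier K" "u \<^bold>+ t = c \<^bold>* t" using P_eqD t ut by blast
      have "form (u \<^bold>+ t) u = \<one>" using form_add_left u t by simp
      then show False using c form_smult_left u t one_not_zero by simp
    qed
    moreover have "b \<noteq> \<zero>"
    proof
      assume "b = \<zero>"
      then have xa: "x = a \<^bold>* v" using ab v t smult_zero_left smult_closed by simp
      then have "P x = \<phi> (P u)" using P_smult ab v \<open>a \<noteq> \<zero>\<close> \<phi>u by simp
      then have "P u = P (u \<^bold>+ t)" using x inj by metis
      then obtain c where c: "c \<in> carrier K" "u \<^bold>+ t = c \<^bold>* u" using P_eqD u u0 ut by blast
      have "form (u \<^bold>+ t) t = form t t" using form_add_left u t by simp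
      then show False using c form_smult_left u t by simp
    qed
    ultimately show ?thesis using ab x(3) by metis
  qed
  have wN: "w \<in> N" "w' \<in> N" using w w' by (auto simp: N_def)
  obtain a b where ab: "a \<in> carrier K" "b \<in> carrier K" "a \<noteq> \<zero>" "b \<noteq> \<zero>" "\<phi> (P (u \<^bold>+ w)) = P (a \<^bold>* v \<^bold>+ b \<^bold>* w)"
    using image[OF wN(1)] by blast
  \<comment> \<open>This factor absorbs both coefficients into \<open>v\<close>, so that in the
    image of \<open>u + w\<close> the vector \<open>w\<close> has coefficient one.\<close>
  define d where "d = inv b \<otimes> a"
  note ib = nonzero_inv[OF ab(2,4)]
  have d: "d \<in> carrier K" "d \<noteq> \<zero>" using ib ab no_zero_divisors by (auto simp: d_def)
  note id = nonzero_inv[OF d]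
  define v' where "v' = d \<^bold>* v"
  have v': "v' \<in> carrier H" "v' \<noteq> \<^bold>0" using d v smult_closed smult_eq_zero v'_def by auto
  have v'N: "form t v' = \<zero>" "form v' t = \<zero>" if "t \<in> N" for t
    using N[OF that] v d form_smult_left form_smult_right star_closed by (simp_all add: v'_def)
  have n': "form v' v' \<in> carrier K" "form v' v' \<noteq> \<zero>" using v' form_closed form_anisotropic by blast+
  note i' = nonzero_inv[OF n']
  have sum'_nz: "v' \<^bold>+ t \<noteq> \<^bold>0" "v' \<^bold>+ t \<in> carrier H" if "t \<in> N" for t
  proof -
    show "v' \<^bold>+ t \<in> carrier H" using v' N[OF that] by simp
    have "form (v' \<^bold>+ t) v' = form v' v'" using form_add_left v' v'N[OF that] N[OF that] n' by simp
    then show "v' \<^bold>+ t \<noteq> \<^bold>0" using n' v' form_zero_left by metis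
  qed
  have smultN: "c \<^bold>* t \<in> N" if "c \<in> carrier K" "c \<noteq> \<zero>" "t \<in> N" for c t
    using that N[OF that(3)] smult_closed smult_eq_zero form_smult_left u v by (auto simp: N_def)
  have \<phi>w: "\<phi> (P (u \<^bold>+ w)) = P (v' \<^bold>+ w)"
  proof -
    have "b \<^bold>* (v' \<^bold>+ w) = a \<^bold>* v \<^bold>+ b \<^bold>* w"
    proof -
      have "b \<^bold>* v' = (b \<otimes> d) \<^bold>* v" using smult_assoc1 ab d v v'_def by simp
      also have "b \<otimes> d = a" using ab(1,2) ib by (simp add: d_def m_assoc[symmetric])
      finally show ?thesis using smult_r_distr ab v' w by simp
    qed
    then show ?thesis using P_smult[OF ab(2,4)] sum'_nz[OF wN(1)] ab by metis
  qed
  have image': "\<exists>c\<in>carrier K. c \<noteq> \<zero> \<and> \<phi> (P (u \<^bold>+ t)) = P (v' \<^bold>+ c \<^bold>* t)" if tN: "t \<in> N" for t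
  proof -
    obtain a b where ab: "a \<in> carrier K" "b \<in> carrier K" "a \<noteq> \<zero>" "b \<noteq> \<zero>" "\<phi> (P (u \<^bold>+ t)) = P (a \<^bold>* v \<^bold>+ b \<^bold>* t)"
      using image[OF tN] by blast
    define e where "e = a \<otimes> inv d"
    have e: "e \<in> carrier K" "e \<noteq> \<zero>" using ab id no_zero_divisors by (auto simp: e_def)
    note ie = nonzero_inv[OF e]
    have c: "inv e \<otimes> b \<in> carrier K" "inv e \<otimes> b \<noteq> \<zero>" using ab ie no_zero_divisors by auto
    have "e \<^bold>* v' = a \<^bold>* v"
    proof -
      have "e \<^bold>* v' = (e \<otimes> d) \<^bold>* v" using smult_assoc1 e d v v'_def by simp
      also have "e \<otimes> d = a" using ab(1) d id by (simp add: e_def m_assoc)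
      finally show ?thesis .
    qed
    moreover have "e \<^bold>* ((inv e \<otimes> b) \<^bold>* t) = b \<^bold>* t"
    proof -
      have "e \<otimes> (inv e \<otimes> b) = b" using e ie ab(2) by (simp add: m_assoc[symmetric])
      then show ?thesis using smult_assoc1[OF e(1) c(1) N(1)[OF tN]] by simp
    qed
    ultimately have "e \<^bold>* (v' \<^bold>+ (inv e \<otimes> b) \<^bold>* t) = a \<^bold>* v \<^bold>+ b \<^bold>* t"
      using smult_r_distr e v' smult_closed c N[OF tN] by simp
    then have "P (a \<^bold>* v \<^bold>+ b \<^bold>* t) = P (v' \<^bold>+ (inv e \<otimes> b) \<^bold>* t)"
      using P_smult[OF e] sum'_nz[OF smultN[OF c tN]] by metis
    then show ?thesis using c ab by auto
  qed
  \<comment> \<open>The difference \<open>n\<close> of \<open>t\<close> and \<open>s\<close>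
    represents a point fixed by \<open>\<phi>\<close>, and every point orthogonal to those of
    \<open>u + t\<close> and \<open>u + s\<close> is orthogonal to it. Transporting this by
    \<open>\<phi>\<close> to \<open>v' + t\<close> and \<open>v' + c * s\<close> leaves only
    \<open>c = \<one>\<close>.\<close>
  have rigid: "c = \<one>"
    if tN: "t \<in> N" "s \<in> N" and ts: "form t s = \<zero>" and c: "c \<in> carrier K" "c \<noteq> \<zero>"
      and \<phi>t: "\<phi> (P (u \<^bold>+ t)) = P (v' \<^bold>+ t)" and \<phi>s: "\<phi> (P (u \<^bold>+ s)) = P (v' \<^bold>+ c \<^bold>* s)" for t s c
  proof -
    note t = N[OF tN(1)] and s = N[OF tN(2)]
    note it = nonzero_inv[OF t(7,8)] and iss = nonzero_inv[OF s(7,8)]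
    have st: "form s t = \<zero>" using form_zero_sym t s ts by blast
    have sc: "star c \<in> carrier K" "star c \<noteq> \<zero>" using c star_closed star_nonzero by blast+
    note isc = nonzero_inv[OF sc]
    \<comment> \<open>The coefficients are solved from the requirement that \<open>q\<close> be
      orthogonal to \<open>v' + t\<close> and to \<open>v' + c * s\<close>, with
      \<open>form q v' = \<one>\<close>.\<close>
    define g where "g = \<ominus> (inv (star c) \<otimes> inv (form s s))"
    define h where "h = \<ominus> (inv (form t t))"
    have gh: "g \<in> carrier K" "h \<in> carrier K" using it iss isc by (simp_all add: g_def h_def)
    define r where "r = h \<^bold>* t \<^bold>+ g \<^bold>* s"
    define q where "q = inv (form v' v') \<^bold>* v' \<^bold>+ r"
    have r: "r \<in> carrier H" using gh t s smult_closed by (simp add: r_def)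
    have iv': "inv (form v' v') \<^bold>* v' \<in> carrier H" using i' v' smult_closed by simp
    have q: "q \<in> carrier H" using r iv' by (simp add: q_def)
    have fr: "form r z = h \<otimes> form t z \<oplus> g \<otimes> form s z" if "z \<in> carrier H" for z
      unfolding r_def using form_linear_left gh t s that by blast
    have fq: "form q z = inv (form v' v') \<otimes> form v' z \<oplus> (h \<otimes> form t z \<oplus> g \<otimes> form s z)"
      if "z \<in> carrier H" for z
      using form_add_left[OF iv' r that] form_smult_left[OF i'(1) v'(1) that] fr[OF that]
      by (simp add: q_def)
    have qv: "form q v' = \<one>" using fq[OF v'(1)] v'N[OF tN(1)] v'N[OF tN(2)] i' gh by simp
    have qt: "form q t = \<ominus> \<one>"
      using fq[OF t(1)] v'N[OF tN(1)] st i' it t gh by (simp add: h_def l_minus)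
    have qs: "form q s = \<ominus> (inv (star c))"
    proof -
      have "g \<otimes> form s s = \<ominus> (inv (star c))"
        using iss isc s by (simp add: g_def l_minus m_assoc)
      then show ?thesis using fq[OF s(1)] v'N[OF tN(2)] ts i' gh isc by simp
    qed
    have q0: "q \<noteq> \<^bold>0" using qv one_not_zero form_zero_left v' by metis
    have "form q (v' \<^bold>+ t) = \<zero>" using form_add_right[OF v'(1) t(1) q] qv qt by (simp add: scalar_r_neg)
    moreover have "form q (v' \<^bold>+ c \<^bold>* s) = \<zero>"
      using form_add_right[OF v'(1) _ q] form_smult_right[OF c(1) s(1) q] smult_closed c s qv qs isc sc
      by (simp add: l_minus scalar_r_neg)
    ultimately have o: "P q \<perp> \<phi> (P (u \<^bold>+ t))" "P q \<perp> \<phi> (P (u \<^bold>+ s))"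
      unfolding \<phi>t \<phi>s using P_orth q q0 sum'_nz[OF tN(1)] sum'_nz[OF smultN[OF c tN(2)]] by blast+
    obtain y where y: "y \<in> carrier H" "y \<noteq> \<^bold>0" "\<phi> (P y) = P q" using preimage by blast
    have "form y (u \<^bold>+ t) = \<zero>" "form y (u \<^bold>+ s) = \<zero>"
      using o y \<phi>_orth P_orth sum_nz[OF tN(1)] sum_nz[OF tN(2)] by metis+
    then have "form y u \<oplus> form y t = form y u \<oplus> form y s" using form_add_right u t s y by simp
    then have yts: "form y t = form y s" using form_closed u t s y by simp
    define n where "n = t \<^bold>+ (\<ominus> \<one>) \<^bold>* s"
    have ms: "(\<ominus> \<one>) \<^bold>* s \<in> carrier H" using s smult_closed by simp
    have s1: "star (\<ominus> \<one>) = \<ominus> \<one>" using star_minus[of \<one>] star_one by simp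
    have fn: "form z n = form z t \<ominus> form z s" if "z \<in> carrier H" for z
      using form_add_right[OF t(1) ms that] form_smult_right[of "\<ominus> \<one>" s z] s that form_closed s1
      by (simp add: n_def scalar_minus_eq r_minus)
    have fn': "form n z = form t z \<ominus> form s z" if "z \<in> carrier H" for z
      using form_add_left[OF t(1) ms that] form_smult_left[of "\<ominus> \<one>" s z] s that form_closed
      by (simp add: n_def scalar_minus_eq l_minus)
    have nH: "n \<in> carrier H" using t ms by (simp add: n_def)
    have "form n t = form t t" using fn'[OF t(1)] st t by (simp add: scalar_minus_eq)
    then have "n \<noteq> \<^bold>0" using t form_zero_left by metis
    moreover have "form n u = \<zero>" "form n v = \<zero>"
      using fn'[OF u(1)] fn'[OF v(1)] t s by (simp_all add: scalar_minus_eq)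
    ultimately have nN: "n \<in> N" using nH by (simp add: N_def)
    have "form y n = \<zero>" using fn[OF y(1)] yts form_closed[OF y(1) s(1)] by (simp add: scalar_minus_eq scalar_r_neg)
    then have "P q \<perp> P n" using P_orth[OF y(1,2) N(1,2)[OF nN]] y(3) \<phi>_orth N(9)[OF nN] by metis
    then have "form q n = \<zero>" using P_orth q q0 N[OF nN] by blast
    then have "\<ominus> \<one> \<oplus> inv (star c) = \<zero>" using fn[OF q] qt qs isc by (simp add: scalar_minus_eq)
    then have "inv (star c) = \<one>" using scalar_minus_equality[of "\<ominus> \<one>" "inv (star c)"] isc
      by (metis scalar_add_inv_closed scalar_minus_minus one_closed)
    then have "star c = \<one>" using isc sc by (metis l_one)
    then show ?thesis using star_star[OF c(1)] star_one by simp
  qed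
  have w'w: "form w' w = \<zero>" using form_zero_sym w w' ww' by blast
  have \<phi>w': "\<phi> (P (u \<^bold>+ w')) = P (v' \<^bold>+ w')"
    using image'[OF wN(2)] rigid[OF wN ww' _ _ \<phi>w] smult_one w' by metis
  note nw = N[OF wN(1)]
  note iw = nonzero_inv[OF nw(7,8)]
  \<comment> \<open>Chosen such that \<open>form w (f * w)\<close> is -1, which makes
    \<open>u + w\<close> orthogonal to \<open>u + f * w\<close>. As \<open>t\<close> is not
    orthogonal to \<open>w\<close>, rigidity reaches it only by way of \<open>w'\<close>.\<close>
  define f where "f = \<ominus> star (inv (form w w))"
  have f: "f \<in> carrier K" "f \<noteq> \<zero>"
    using iw star_closed star_nonzero scalar_add_inv_eq_1_iff by (simp_all add: f_def)
  define t where "t = f \<^bold>* w"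
  have tN: "t \<in> N" using smultN f wN t_def by simp
  have w't: "form w' t = \<zero>"
    using form_smult_right[OF f(1) w(1) w'(1)] w'w star_closed f by (simp add: t_def)
  have \<phi>t: "\<phi> (P (u \<^bold>+ t)) = P (v' \<^bold>+ t)"
    using image'[OF tN] rigid[OF wN(2) tN w't _ _ \<phi>w'] smult_one N(1)[OF tN] by metis
  have "star f = \<ominus> (inv (form w w))" using star_minus star_star star_closed iw by (simp add: f_def)
  then have wt: "form w t = \<ominus> \<one>"
    using form_smult_right[OF f(1) w(1) w(1)] iw nw by (simp add: t_def r_minus)
  have "form (u \<^bold>+ w) (u \<^bold>+ t) = \<zero>"
  proof -
    have "form (u \<^bold>+ w) (u \<^bold>+ t) = form u u \<oplus> form u t \<oplus> (form w u \<oplus> form w t)"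
      using form_add_left form_add_right u w N[OF tN] by simp
    then show ?thesis using u w wt N[OF tN] by (simp add: scalar_r_neg)
  qed
  then have "\<phi> (P (u \<^bold>+ w)) \<perp> \<phi> (P (u \<^bold>+ t))"
    using P_orth sum_nz[OF wN(1)] sum_nz[OF tN] \<phi>_orth by metis
  then have "form (v' \<^bold>+ w) (v' \<^bold>+ t) = \<zero>"
    unfolding \<phi>w \<phi>t using P_orth sum'_nz[OF wN(1)] sum'_nz[OF tN] by blast
  moreover have "form (v' \<^bold>+ w) (v' \<^bold>+ t) = form v' v' \<oplus> form w v' \<oplus> (form v' t \<oplus> form w t)"
    using form_add_left form_add_right v' w N[OF tN] by simp
  ultimately have "form v' v' \<oplus> \<ominus> \<one> = \<zero>"
    using v'N[OF tN] v'N[OF wN(1)] wt n' by simp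
  then have "form v' v' = \<one>" using scalar_minus_equality[of "form v' v'" "\<ominus> \<one>"] n' by simp
  then show ?thesis using d v'_def by blast
qed

end

section \<open>Coordinatization of linear orthosets\<close>

locale pointed_linear_orthoset = linear_orthoset +
  fixes b0 :: 'a
begin

section \<open>The affine space in the complement of a polar hyperplane\<close>

definition A :: "'a set" where "A = {x. \<not> b0 \<perp> x}"

definition M :: "'a set" where "M = {x. b0 \<perp> x}"

definition R :: "'a \<Rightarrow> 'a \<Rightarrow> 'a \<Rightarrow> bool" where
  "R p x y \<longleftrightarrow> p \<in> M \<and> x \<in> A \<and> y \<in> A \<and> y \<in> cl {x, p}"

lemma A_neq_M: "x \<in> A \<Longrightarrow> p \<in> M \<Longrightarrow> x \<noteq> p"
  by (auto simp: A_def M_def)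

lemma A_or_M: "x \<in> A \<or> x \<in> M"
  by (auto simp: A_def M_def)

lemma cl_in_M: "S \<subseteq> M \<Longrightarrow> cl S \<subseteq> M"
proof
  fix x assume "S \<subseteq> M" "x \<in> cl S"
  moreover from this have "b0 \<in> perp S" by (auto simp: perp_def M_def)
  ultimately show "x \<in> M" using in_clD unfolding M_def by blast
qed

text \<open>Two points at infinity on the line would put the whole line at infinity, including
  \<open>x\<close>.\<close>

lemma line_meets_M_once: "x \<in> A \<Longrightarrow> p \<in> M \<Longrightarrow> y \<in> cl {x, p} \<Longrightarrow> y \<noteq> p \<Longrightarrow> y \<in> A"
proof (rule ccontr)
  assume a: "x \<in> A" "p \<in> M" "y \<in> cl {x, p}" "y \<noteq> p" "y \<notin> A"
  then have "cl {y, p} = cl {x, p}" using cl_pair_eq[of y x p p] by simp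
  moreover have "cl {y, p} \<subseteq> M" using a A_or_M by (intro cl_in_M) auto
  ultimately show False using a(1) A_neq_M cl_base[of x "{x, p}"] by blast
qed

lemma ex_in_M: "\<exists>p. p \<in> M"
proof -
  obtain f where "f \<noteq> b0" using ex_distinct by blast
  then obtain g where "g \<perp> b0" using perp_pair_orthogonal by metis
  then show ?thesis using orth_sym unfolding M_def by blast
qed

lemma b0_in_A: "b0 \<in> A"
  by (simp add: A_def orth_irrefl)

lemma ex_direction:
  assumes "x \<in> A" "y \<in> A"
  shows "\<exists>p. R p x y"
proof (cases "x = y")
  case True
  then show ?thesis using ex_in_M assms by (auto simp: R_def)
next
  case False
  then obtain r where r: "r \<in> cl {x, y}" "r \<perp> b0" using line_meets_hyperplane by blast
  then have rM: "r \<in> M" using orth_sym by (simp add: M_def)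
  then have "y \<in> cl {x, r}" using cl_pair_exchange[OF r(1)] A_neq_M assms by blast
  then show ?thesis using rM assms unfolding R_def by blast
qed

sublocale affine_origin A M R "\<lambda>p q. cl {p, q}" b0
proof
  show "R p x y \<Longrightarrow> p \<in> M \<and> x \<in> A \<and> y \<in> A" for p x y by (simp add: R_def)
  show "p \<in> M \<Longrightarrow> x \<in> A \<Longrightarrow> R p x x" for p x by (simp add: R_def)
  show "R p y x" if "R p x y" for p x y
    using that cl_pair_exchange[of y p x] A_neq_M unfolding R_def by (metis insert_commute)
  show "R p x z" if "R p x y" "R p y z" for p x y z
    using that cl_least[of "{y, p}" "{x, p}"] unfolding R_def by auto
  show "x \<in> A \<Longrightarrow> y \<in> A \<Longrightarrow> \<exists>p. R p x y" for x y by (rule ex_direction)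
  show "x = y" if r: "R p x y" "R q x y" "p \<noteq> q" for p q x y
  proof (rule ccontr)
    assume "x \<noteq> y"
    then have "cl {x, y} = cl {x, p}" "cl {x, y} = cl {x, q}"
      using r cl_pair_eq[of x x p y] cl_pair_eq[of x x q y] by (simp_all add: R_def)
    moreover have "p \<in> cl {x, p}" "q \<in> cl {x, q}" by simp_all
    ultimately have "cl {p, q} = cl {x, y}" using cl_pair_eq[of p x y q] r(3) by metis
    then have "x \<in> cl {p, q}" by simp
    moreover have "cl {p, q} \<subseteq> M" using r by (intro cl_in_M) (auto simp: R_def)
    ultimately show False using r A_neq_M unfolding R_def by blast
  qed
  show "r \<in> cl {p, q}" if h: "R p a c" "R q a d" "R r c d" "c \<noteq> d" for p a c q d r
  \<comment> \<open>If \<open>r\<close> were off the line \<open>p q\<close>, exchange would place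
    the affine point \<open>a\<close> in the plane spanned by the points at infinity
    \<open>r\<close>, \<open>p\<close>, \<open>q\<close>.\<close>
  proof (rule ccontr)
    assume nr: "r \<notin> cl {p, q}"
    have "r \<in> cl {c, d}" using h cl_pair_exchange[of d c r] by (simp add: R_def)
    moreover have "cl {a, p} \<subseteq> cl {a, p, q}" "cl {a, q} \<subseteq> cl {a, p, q}" by (auto intro!: cl_mono)
    then have "cl {c, d} \<subseteq> cl {a, p, q}" using h by (intro cl_least) (auto simp: R_def)
    ultimately have "a \<in> cl {r, p, q}" using exchange[OF gram_schmidt_pair _ nr] by blast
    moreover have "cl {r, p, q} \<subseteq> M" using h by (intro cl_in_M) (auto simp: R_def)
    ultimately show False using h A_neq_M unfolding R_def by blast
  qed
  show "\<exists>x. R p a x \<and> R q b x"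
    if h: "R r a b" "r \<in> cl {p, q}" "p \<in> M" "q \<in> M" "p \<noteq> q" for r a b p q
  proof -
    have A: "a \<in> A" "b \<in> A" using h by (simp_all add: R_def)
    have "r \<in> cl {a, p, q}" using h(2) cl_mono[of "{p, q}" "{a, p, q}"] by blast
    then have "cl {a, r} \<subseteq> cl {a, p, q}" by (intro cl_least) auto
    then have "b \<in> cl {a, p, q}" using h by (auto simp: R_def)
    then obtain x where x: "x \<in> cl {a, p}" "x \<in> cl {b, q}"
      using coplanar_lines_meet[of b q a p] A_neq_M A h by blast
    then have "x \<in> A" using line_meets_M_once A h by metis
    then show ?thesis using x A h unfolding R_def by blast
  qed
  show "\<exists>y. y \<noteq> x \<and> R p x y" if "x \<in> A" "p \<in> M" for x p
    using ex_third_point[of x p] line_meets_M_once A_neq_M that unfolding R_def by metis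
  show "\<exists>s\<in>M. s \<notin> cl {p, q}" if pq: "p \<in> M" "q \<in> M" for p q
  proof -
    \<comment> \<open>Of two orthogonal points at infinity that are both orthogonal to
      \<open>p\<close>, one is off the line \<open>p q\<close>: otherwise \<open>g\<close> and
      \<open>p\<close> span this line, and \<open>h\<close> on it would be orthogonal to
      itself.\<close>
    obtain g h where gh: "g \<perp> b0" "g \<perp> p" "h \<perp> b0" "h \<perp> p" "g \<perp> h"
      using ex_orthogonal_pair[of b0 p] A_neq_M b0_in_A pq by blast
    then have M: "g \<in> M" "h \<in> M" using orth_sym by (simp_all add: M_def)
    have "\<not> (g \<in> cl {p, q} \<and> h \<in> cl {p, q})"
    proof
      assume a: "g \<in> cl {p, q} \<and> h \<in> cl {p, q}"
      have "g \<noteq> p" using gh orth_irrefl by blast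
      then have "cl {g, p} = cl {p, q}" using a cl_pair_eq[of g p q p] by simp
      then have "h \<in> cl {g, p}" using a by blast
      moreover have "h \<in> perp {g, p}" using gh orth_sym by (auto simp: perp_def)
      ultimately show False using in_clD orth_irrefl by blast
    qed
    then show ?thesis using M by blast
  qed
  show "cl {r, s} = cl {p, q}" if "r \<in> cl {p, q}" "s \<in> cl {p, q}" "r \<noteq> s" for p q r s
    by (rule cl_pair_eq[OF that])
  show "cl {p, p} = {p}" for p by (simp add: cl_singleton)
  show "b0 \<in> A" by (rule b0_in_A)
qed simp_all

definition unit :: 'a where
  "unit = (SOME u. u \<noteq> b0 \<and> R (SOME p. p \<in> M) b0 u)"

lemma unit: "unit \<noteq> b0 \<and> R (SOME p. p \<in> M) b0 unit"
  unfolding unit_def by (rule someI_ex) (rule R_move[OF b0_in_A someI_ex[OF ex_in_M]])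

sublocale affine_coordinates A M R "\<lambda>p q. cl {p, q}" b0 "SOME p. p \<in> M" unit
  by unfold_locales (use unit in blast)+

text \<open>At \<open>b0\<close> every direction qualifies, so the value there is an arbitrary point
  at infinity.\<close>

definition dir :: "'a \<Rightarrow> 'a" where
  "dir v = (SOME p. R p b0 v)"

lemma dir: "v \<in> A \<Longrightarrow> R (dir v) b0 v"
  unfolding dir_def using someI_ex[OF R_ex[OF b0_in_A]] .

lemma R_cl: "R p x y \<Longrightarrow> y \<in> cl {x, p}"
  by (simp add: R_def)

lemma dir_in_M: "v \<in> A \<Longrightarrow> dir v \<in> M"
  using dir R_in by blast

lemma dir_eqI: "R p b0 v \<Longrightarrow> v \<noteq> b0 \<Longrightarrow> dir v = p"
  using dir R_unique R_in by metis

lemma in_cl_pair_orth: "x \<in> cl {y, z} \<Longrightarrow> q \<perp> y \<Longrightarrow> q \<perp> z \<Longrightarrow> q \<perp> x"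
  using in_clD[of x "{y, z}" q] by (simp add: perp_def)

text \<open>Affine vectors are themselves points of the orthoset, which is why the identity serves
  as the map \<open>aff\<close>.\<close>

sublocale coordinatization K V orth "\<lambda>x. x" dir
proof -
  interpret left_linear_space K V by (rule left_linear_space_V)
  show "coordinatization K V orth (\<lambda>x. x) dir"
  proof (intro coordinatization.intro polar_space.intro left_linear_space_V polar_space_axioms.intro
      coordinatization_axioms.intro; (simp only: V_simps(1,2))?)
    show "p \<perp> q \<Longrightarrow> q \<perp> p" "\<not> p \<perp> p" for p q using orth_sym orth_irrefl by blast+
    show "q \<perp> x \<oplus>\<^bsub>V\<^esub> y" if "x \<in> A" "y \<in> A" "q \<perp> x" "q \<perp> dir y" for x y q
    proof -
      have "R (dir y) x (vadd x y)" using R_vadd[OF dir] that vadd_comm by metis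
      then show ?thesis using that in_cl_pair_orth[OF R_cl] by simp
    qed
    show "q \<perp> dir (x \<oplus>\<^bsub>V\<^esub> y)"
      if h: "x \<in> A" "y \<in> A" "x \<oplus>\<^bsub>V\<^esub> y \<noteq> b0" "q \<perp> dir x" "q \<perp> dir y" for x y q
    proof -
      have "R (dir y) x (vadd x y)" using R_vadd[OF dir] h vadd_comm by metis
      moreover have "R (dir (vadd x y)) b0 (vadd x y)" using dir vadd_closed h by blast
      ultimately have "dir (vadd x y) \<in> cl {dir x, dir y}"
        using menelaus[OF R_sym[OF dir[OF h(1)]]] h by simp
      then show ?thesis using h in_cl_pair_orth by simp
    qed
    show "q \<perp> dir (x \<ominus>\<^bsub>V\<^esub> y)" if h: "x \<in> A" "y \<in> A" "x \<noteq> y" "q \<perp> x" "q \<perp> y" for x y q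
    proof -
      define z where "z = x \<ominus>\<^bsub>V\<^esub> y"
      have z: "z \<in> A" "vadd z y = x"
      proof -
        have "x \<in> carrier V" "y \<in> carrier V" using h by simp_all
        then have "z \<in> carrier V" "z \<oplus>\<^bsub>V\<^esub> y = x"
          unfolding z_def H.minus_eq
          by (simp_all only: H.a_closed H.a_assoc H.a_inv_closed H.l_neg H.r_zero)
        then show "z \<in> A" "vadd z y = x" by simp_all
      qed
      then have "x \<in> cl {y, dir z}" using R_cl[OF R_vadd[OF dir[OF z(1)] h(2)]] by simp
      then have "dir z \<in> cl {y, x}" using cl_pair_exchange h by blast
      then show ?thesis using h in_cl_pair_orth z_def by simp
    qed
    show "dir (c \<odot>\<^bsub>V\<^esub> x) = dir x" if h: "c \<in> carrier K" "c \<noteq> \<zero>\<^bsub>K\<^esub>" "x \<in> A" "x \<noteq> b0" for c x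
    proof -
      have "c \<odot>\<^bsub>V\<^esub> x \<noteq> b0" using smult_eq_zero[of c x] h by auto
      then show ?thesis using dir_eqI scalar_R[OF _ dir[OF h(3)], of c] h by simp
    qed
    show "\<exists>c\<in>carrier K. y = c \<odot>\<^bsub>V\<^esub> x" if "x \<in> A" "x \<noteq> b0" "y \<in> A" "dir x = dir y" for x y
      using ex_scalar[of "dir x" x y] dir[of x] dir[of y] that by auto
    show "b0 \<perp> dir x" if "x \<in> A" for x using dir_in_M[OF that] by (simp add: M_def)
    show "\<not> b0 \<perp> x" if "x \<in> A" for x using that by (simp add: A_def)
    show "\<exists>c\<in>carrier K. c \<odot>\<^bsub>V\<^esub> x \<perp> v"
      if h: "x \<in> A" "x \<noteq> b0" "v \<in> A" "\<not> dir x \<perp> v" for x v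
    proof -
      have M: "dir x \<in> M" using dir_in_M h by blast
      then obtain r where r: "r \<in> cl {b0, dir x}" "r \<perp> v"
        using line_meets_hyperplane[of b0 "dir x" v] b0_in_A A_neq_M by blast
      then have "r \<in> A" using line_meets_M_once[OF b0_in_A M] h by blast
      then have "R (dir x) b0 r" using r M b0_in_A by (simp add: R_def)
      then show ?thesis using ex_scalar[OF dir[OF h(1)] h(2)] r by auto
    qed
    show "\<exists>k\<in>A. k \<noteq> b0 \<and> dir k \<perp> dir x \<and> \<not> dir k \<perp> dir y"
      if h: "x \<in> A" "y \<in> A" "dir x \<noteq> dir y" for x y
    proof -
      \<comment> \<open>On the line joining the two directions, \<open>g\<close> is the point
        orthogonal to \<open>dir x\<close>. It cannot be orthogonal to \<open>dir y\<close> too, and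
        any further affine point in its direction serves as \<open>k\<close>.\<close>
      obtain g where g: "g \<perp> dir x" "perp {dir x, dir y} = perp {dir x, g}"
        using perp_pair_orthogonal h by blast
      have "g \<in> cl {dir x, dir y}" using cl_eq_if_perp_eq[OF g(2)] by simp
      moreover have "cl {dir x, dir y} \<subseteq> M" using dir_in_M h by (intro cl_in_M) auto
      ultimately obtain k where k: "k \<noteq> b0" "R g b0 k" using R_move b0_in_A by blast
      have "\<not> g \<perp> dir y"
      proof
        assume "g \<perp> dir y"
        then have "g \<in> perp {dir x, g}" using g by (auto simp: perp_def)
        then show False using orth_irrefl by (simp add: perp_def)
      qed
      then show ?thesis using k g(1) dir_eqI R_in by metis
    qed
    show "\<exists>y\<in>A. y \<noteq> b0 \<and> dir y \<noteq> dir x" if "x \<in> A" for x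
    proof -
      have "dir x \<in> M" using dir_in_M[OF that] .
      then obtain s where "s \<in> M" "s \<notin> cl {dir x, dir x}" using noncoplanar by blast
      moreover from this obtain y where "y \<noteq> b0" "R s b0 y" using R_move b0_in_A by blast
      ultimately show ?thesis using dir_eqI R_in by (metis cl_base insertI1)
    qed
    show "(\<exists>x\<in>A. p = x) \<or> (\<exists>x\<in>A. x \<noteq> b0 \<and> p = dir x)" for p
      using A_or_M R_move b0_in_A dir_eqI R_in by metis
  qed
qed

end

theorem theorem5p11:
  fixes orth :: "'a \<Rightarrow> 'a \<Rightarrow> bool"
  assumes "orthoset orth"
    and "homogeneously_transitive orth"
    and "|{..<4::nat}| \<le>o orthoset_rank orth"
  shows "Boolean_orthoset orth \<or>
    (\<exists>(K :: 'a ring) star (H :: ('a, 'a \<times> 'a) module) form.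
       hermitian_space K star H form \<and>
       unit_vector_in_each_line K H form \<and>
       (\<exists>\<phi>. orthoset_iso_on UNIV orth (proj_points K H) (proj_orth K H form) \<phi>))"
proof (cases "Boolean_orthoset orth")
  case False
  define b0 :: 'a where "b0 = undefined"
  interpret linear_orthoset orth using linear_orthoset_of_transitive assms False by blast
  interpret X: pointed_linear_orthoset orth b0 ..
  interpret S: hermitian_space X.K X.star X.HK X.form by (rule X.hermitian_space_HK)
  have "\<exists>u\<in>P. X.form u u = \<one>\<^bsub>X.K\<^esub>" if P: "P \<in> proj_points X.K X.HK" for P
  proof -
    obtain z where z: "z \<in> carrier X.HK" "z \<noteq> \<zero>\<^bsub>X.HK\<^esub>" "P = ray X.K X.HK z"
      using P unfolding proj_points_def by blast
    define u0 where "u0 = (\<zero>\<^bsub>X.V\<^esub>, \<one>\<^bsub>X.K\<^esub>)"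
    have u0: "u0 \<in> carrier X.HK" "u0 \<noteq> \<zero>\<^bsub>X.HK\<^esub>" "X.form u0 u0 = \<one>\<^bsub>X.K\<^esub>" "X.pt u0 = b0"
      using X.form_origin unfolding u0_def by simp_all
    have conn: "X.pt z = b0 \<Longrightarrow> \<exists>c\<in>carrier X.K. u0 = c \<odot>\<^bsub>X.HK\<^esub> z"
      by (rule X.pt_eqD[OF z(1,2) u0(1,2)]) (use u0(4) in simp)
    \<comment> \<open>A ray representing \<open>b0\<close> contains a multiple of itself equal to
      the unit vector \<open>u0\<close>; for any other ray, \<open>u0\<close> is transported along
      an automorphism given by (HT1).\<close>
    have "\<exists>c\<in>carrier X.K. X.form (c \<odot>\<^bsub>X.HK\<^esub> z) (c \<odot>\<^bsub>X.HK\<^esub> z) = \<one>\<^bsub>X.K\<^esub>"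
    proof (cases "X.pt z = b0")
      case True
      then obtain c where c: "c \<in> carrier X.K" "u0 = c \<odot>\<^bsub>X.HK\<^esub> z" using conn by blast
      show ?thesis by (rule bexI[OF _ c(1)]) (use u0(3) in \<open>simp only: c(2)\<close>)
    next
      case False
      then obtain \<phi> where \<phi>: "\<phi> \<in> G_fix orth b0 (X.pt z)" "\<phi> b0 = X.pt z"
        by (rule ex_fixing_aut[OF assms(2) not_sym])
      then have aut: "\<phi> \<in> orthoset_aut orth" and fixed: "\<And>q. orth q b0 \<Longrightarrow> orth q (X.pt z) \<Longrightarrow> \<phi> q = q"
        by (auto simp: G_fix_def)
      \<comment> \<open>Representatives of these two points become the orthogonal vectors
        \<open>w\<close> and \<open>w'\<close> of the transport argument.\<close>
      obtain g h where gh: "orth g b0" "orth g (X.pt z)" "orth h b0" "orth h (X.pt z)" "orth g h"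
        using ex_orthogonal_pair False by metis
      have form_rep: "X.form (X.rep p) y = \<zero>\<^bsub>X.K\<^esub>"
        if "orth p (X.pt y)" "y \<in> carrier X.HK" "y \<noteq> \<zero>\<^bsub>X.HK\<^esub>" for p y
        using X.pt_orth_iff[OF X.rep(1,2) that(2,3), of p] that(1) X.rep(3)[of p] by simp
      show ?thesis
      proof (rule S.unit_vector_transport[where P = X.pt and orth = orth and \<phi> = \<phi> and u = u0
            and w = "X.rep g" and w' = "X.rep h"])
        show "bij \<phi>" by (rule orthoset_autD(1)[OF aut])
        show "\<And>p q. orth p q \<longleftrightarrow> orth (\<phi> p) (\<phi> q)" by (rule orthoset_autD(2)[OF aut])
        show "\<phi> (X.pt u0) = X.pt z" using \<phi>(2) u0(4) by simp
        show "\<And>q. orth q (X.pt u0) \<Longrightarrow> orth q (X.pt z) \<Longrightarrow> \<phi> q = q" using fixed u0(4) by simp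
        show "X.form (X.rep g) u0 = \<zero>\<^bsub>X.K\<^esub>" "X.form (X.rep h) u0 = \<zero>\<^bsub>X.K\<^esub>"
          using form_rep gh u0 by metis+
        show "X.form (X.rep g) z = \<zero>\<^bsub>X.K\<^esub>" "X.form (X.rep h) z = \<zero>\<^bsub>X.K\<^esub>"
          using form_rep gh z by metis+
        show "X.form (X.rep g) (X.rep h) = \<zero>\<^bsub>X.K\<^esub>"
          using form_rep[OF _ X.rep(1,2)] gh(5) X.rep(3) by metis
      qed (fact X.pt_eqD X.pt_smult X.pt_orth_iff X.pt_surj u0 z X.rep)+
    qed
    then show ?thesis unfolding z(3) ray_def by blast
  qed
  then show ?thesis using X.hermitian_space_HK X.iso_HK unfolding unit_vector_in_each_line_def by blast
qed simp

end
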